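(* Let $R$ be a commutative domain. Then the following conditions are equivalent: (1) $R$ is a Dedekind domain; (2) $R$ is a pure-tilting hereditary ring; (3) $R$ is a pure $0$-tilting hereditary ring.
   Context: Rings are associative with identity. A Dedekind domain is a commutative domain in which every nonzero ideal is invertible. A module is pure projective if it is projective with respect to pure exact sequences (equivalently, a direct summand of a direct sum of finitely presented modules). For an integer $n\ge 0$, an $R$-module $T$ is $n$-tilting if (i) $\mathrm{pd}_R(T)\le n$; (ii) $\mathrm{Ext}_R^i(T,T^{(\kappa)})=0$ for all $i\ge 1$ and all cardinals $\kappa$; (iii) there are $r\ge 0$ and an exact sequence $0\to R\to T_0\to\cdots\to T_r\to 0$ with each $T_i\in\mathrm{Add}(T)$ (direct summands of direct sums of copies of $T$). A module is tilting if it is $n$-tilting for some $n$. $R$ is pure-tilting hereditary if every nonzero ideal of $R$ is both pure projective and tilting; $R$ is pure $0$-tilting hereditary if every nonzero ideal of $R$ is both pure projective and $0$-tilting. *)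

theory Defs
  imports "HOL-Algebra.Algebra"
begin

text \<open>
  Universes. HOL cannot quantify over all types inside a formula, so every notion that ranges over
  ``all modules'' or ``all cardinals'' takes a type argument \<open>'u itself\<close> and ranges over the
  modules whose carrier is a subset of \<open>'u\<close> and over the index sets of elements of \<open>'u\<close>. The type
  \<open>'u\<close> plays the part of a universe: the results are stated for an arbitrary \<open>'u\<close> that is infinite
  and at least as large as the ring, so that (up to isomorphism) the modules over \<open>'u\<close> include the
  ring and the finitely presented modules and are closed under submodules, quotients and direct
  sums indexed by subsets of \<open>'u\<close>.
\<close>


section \<open>Modules and homomorphisms\<close>

definition mod_hom ::
  "('a, 'm) ring_scheme \<Rightarrow> ('a, 'b, 'p) module_scheme \<Rightarrow> ('a, 'c, 'q) module_scheme \<Rightarrow> ('b \<Rightarrow> 'c) set"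
  where "mod_hom R M N =
    {f \<in> carrier M \<rightarrow> carrier N.
       (\<forall>x\<in>carrier M. \<forall>y\<in>carrier M. f (x \<oplus>\<^bsub>M\<^esub> y) = f x \<oplus>\<^bsub>N\<^esub> f y) \<and>
       (\<forall>a\<in>carrier R. \<forall>x\<in>carrier M. f (a \<odot>\<^bsub>M\<^esub> x) = a \<odot>\<^bsub>N\<^esub> f x)}"

definition mod_iso ::
  "('a, 'm) ring_scheme \<Rightarrow> ('a, 'b, 'p) module_scheme \<Rightarrow> ('a, 'c, 'q) module_scheme \<Rightarrow> bool"
  where "mod_iso R M N \<longleftrightarrow> (\<exists>f\<in>mod_hom R M N. bij_betw f (carrier M) (carrier N))"

text \<open>The record type of modules extends that of rings; only the additive and the scalar structure
  of a module are ever used, its \<open>mult\<close> and \<open>one\<close> fields are irrelevant.\<close>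

definition ideal_module :: "('a, 'm) ring_scheme \<Rightarrow> 'a set \<Rightarrow> ('a, 'a) module"
  where "ideal_module R I =
    \<lparr>carrier = I, monoid.mult = monoid.mult R, one = one R, ring.zero = ring.zero R, ring.add = ring.add R, smult = monoid.mult R\<rparr>"

abbreviation regular_module :: "('a, 'm) ring_scheme \<Rightarrow> ('a, 'a) module"
  where "regular_module R \<equiv> ideal_module R (carrier R)"

definition direct_sum ::
  "'i set \<Rightarrow> ('i \<Rightarrow> ('a, 'b, 'p) module_scheme) \<Rightarrow> ('a, 'i \<Rightarrow> 'b) module"
  where "direct_sum I M =
    \<lparr>carrier = {x \<in> \<Pi>\<^sub>E i\<in>I. carrier (M i). finite {i \<in> I. x i \<noteq> \<zero>\<^bsub>M i\<^esub>}},
     monoid.mult = (\<lambda>x y. \<lambda>i\<in>I. x i \<otimes>\<^bsub>M i\<^esub> y i),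
     one = (\<lambda>i\<in>I. \<one>\<^bsub>M i\<^esub>),
     ring.zero = (\<lambda>i\<in>I. \<zero>\<^bsub>M i\<^esub>),
     ring.add = (\<lambda>x y. \<lambda>i\<in>I. x i \<oplus>\<^bsub>M i\<^esub> y i),
     smult = (\<lambda>a x. \<lambda>i\<in>I. a \<odot>\<^bsub>M i\<^esub> x i)\<rparr>"

definition free_module :: "('a, 'm) ring_scheme \<Rightarrow> nat \<Rightarrow> ('a, nat \<Rightarrow> 'a) module"
  where "free_module R n = direct_sum {..<n} (\<lambda>_. regular_module R)"

text \<open>\<open>M\<close> is isomorphic to an internal direct summand of \<open>D\<close>.\<close>

definition direct_summand ::
  "('a, 'm) ring_scheme \<Rightarrow> ('a, 'b, 'p) module_scheme \<Rightarrow> ('a, 'c, 'q) module_scheme \<Rightarrow> bool"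
  where "direct_summand R M D \<longleftrightarrow>
    (\<exists>N N'. submodule N R D \<and> submodule N' R D \<and> N \<inter> N' = {\<zero>\<^bsub>D\<^esub>} \<and>
            N <+>\<^bsub>D\<^esub> N' = carrier D \<and> mod_iso R M (D\<lparr>carrier := N\<rparr>))"


section \<open>Purity\<close>

text \<open>There is an exact sequence \<open>R\<^sup>m \<rightarrow> R\<^sup>n \<rightarrow> M \<rightarrow> 0\<close>.\<close>

definition finitely_presented :: "('a, 'm) ring_scheme \<Rightarrow> ('a, 'b, 'p) module_scheme \<Rightarrow> bool"
  where "finitely_presented R M \<longleftrightarrow> module R M \<and>
    (\<exists>m n. \<exists>p\<in>mod_hom R (free_module R m) (free_module R n).
           \<exists>q\<in>mod_hom R (free_module R n) M.
       p ` carrier (free_module R m) = a_kernel (free_module R n) M q \<and>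
       q ` carrier (free_module R n) = carrier M)"

definition short_exact ::
  "('a, 'm) ring_scheme \<Rightarrow> ('a, 'b, 'p) module_scheme \<Rightarrow> ('b \<Rightarrow> 'c) \<Rightarrow> ('a, 'c, 'q) module_scheme
    \<Rightarrow> ('c \<Rightarrow> 'd) \<Rightarrow> ('a, 'd, 'r) module_scheme \<Rightarrow> bool"
  where "short_exact R A f B g C \<longleftrightarrow>
    module R A \<and> module R B \<and> module R C \<and> f \<in> mod_hom R A B \<and> g \<in> mod_hom R B C \<and>
    inj_on f (carrier A) \<and> f ` carrier A = a_kernel B C g \<and> g ` carrier B = carrier C"

text \<open>Every homomorphism from \<open>P\<close> to \<open>C\<close> lifts along \<open>g : B \<rightarrow> C\<close>.\<close>

definition lifts_along ::
  "('a, 'm) ring_scheme \<Rightarrow> ('a, 'b, 'p) module_scheme \<Rightarrow> ('a, 'c, 'q) module_scheme \<Rightarrow> ('c \<Rightarrow> 'd)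
    \<Rightarrow> ('a, 'd, 'r) module_scheme \<Rightarrow> bool"
  where "lifts_along R P B g C \<longleftrightarrow>
    (\<forall>f\<in>mod_hom R P C. \<exists>h\<in>mod_hom R P B. \<forall>x\<in>carrier P. g (h x) = f x)"

text \<open>A short exact sequence is pure if it stays exact under \<open>Hom\<^sub>R(F, -)\<close> for every finitely
  presented module \<open>F\<close>; only surjectivity on the right has to be required.\<close>

definition pure_exact ::
  "'u itself \<Rightarrow> ('a, 'm) ring_scheme \<Rightarrow> ('a, 'b, 'p) module_scheme \<Rightarrow> ('b \<Rightarrow> 'c)
    \<Rightarrow> ('a, 'c, 'q) module_scheme \<Rightarrow> ('c \<Rightarrow> 'd) \<Rightarrow> ('a, 'd, 'r) module_scheme \<Rightarrow> bool"
  where "pure_exact U R A f B g C \<longleftrightarrow>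
    short_exact R A f B g C \<and>
    (\<forall>F :: ('a, 'u) module. finitely_presented R F \<longrightarrow> lifts_along R F B g C)"

definition pure_projective ::
  "'u itself \<Rightarrow> ('a, 'm) ring_scheme \<Rightarrow> ('a, 'b, 'p) module_scheme \<Rightarrow> bool"
  where "pure_projective U R P \<longleftrightarrow> module R P \<and>
    (\<forall>(A :: ('a, 'u) module) f (B :: ('a, 'u) module) g (C :: ('a, 'u) module).
       pure_exact U R A f B g C \<longrightarrow> lifts_along R P B g C)"


section \<open>Projective resolutions and Ext\<close>

definition projective_module ::
  "'u itself \<Rightarrow> ('a, 'm) ring_scheme \<Rightarrow> ('a, 'b, 'p) module_scheme \<Rightarrow> bool"
  where "projective_module U R P \<longleftrightarrow> module R P \<and>
    (\<forall>(B :: ('a, 'u) module) g (C :: ('a, 'u) module).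
       module R B \<and> module R C \<and> g \<in> mod_hom R B C \<and> g ` carrier B = carrier C
       \<longrightarrow> lifts_along R P B g C)"

text \<open>The sequence \<open>\<cdots> \<rightarrow> P 2 \<rightarrow> P 1 \<rightarrow> P 0 \<rightarrow> A \<rightarrow> 0\<close> with \<open>d i : P (Suc i) \<rightarrow> P i\<close> and
  augmentation \<open>e : P 0 \<rightarrow> A\<close>.\<close>

definition projective_resolution ::
  "'u itself \<Rightarrow> ('a, 'm) ring_scheme \<Rightarrow> (nat \<Rightarrow> ('a, 'u) module) \<Rightarrow> (nat \<Rightarrow> 'u \<Rightarrow> 'u) \<Rightarrow> ('u \<Rightarrow> 'b)
    \<Rightarrow> ('a, 'b, 'p) module_scheme \<Rightarrow> bool"
  where "projective_resolution U R P d e A \<longleftrightarrow>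
    module R A \<and>
    (\<forall>i. projective_module U R (P i)) \<and>
    (\<forall>i. d i \<in> mod_hom R (P (Suc i)) (P i)) \<and>
    e \<in> mod_hom R (P 0) A \<and>
    e ` carrier (P 0) = carrier A \<and>
    d 0 ` carrier (P (Suc 0)) = a_kernel (P 0) A e \<and>
    (\<forall>i. d (Suc i) ` carrier (P (Suc (Suc i))) = a_kernel (P (Suc i)) (P i) (d i))"

text \<open>A resolution of length at most \<open>n\<close> is one that vanishes in all degrees above \<open>n\<close>.\<close>

definition pd_le ::
  "'u itself \<Rightarrow> ('a, 'm) ring_scheme \<Rightarrow> ('a, 'b, 'p) module_scheme \<Rightarrow> nat \<Rightarrow> bool"
  where "pd_le U R A n \<longleftrightarrow>
    (\<exists>P d e. projective_resolution U R P d e A \<and> (\<forall>i>n. carrier (P i) = {\<zero>\<^bsub>P i\<^esub>}))"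

text \<open>The additive group of homomorphisms; its elements are cut down to extensional functions so
  that homomorphisms are equal as soon as they agree on the carrier.\<close>

definition Hom_group ::
  "('a, 'm) ring_scheme \<Rightarrow> ('a, 'b, 'p) module_scheme \<Rightarrow> ('a, 'c, 'q) module_scheme \<Rightarrow> ('b \<Rightarrow> 'c) monoid"
  where "Hom_group R M N =
    \<lparr>carrier = mod_hom R M N \<inter> extensional (carrier M),
     monoid.mult = (\<lambda>f g. \<lambda>x\<in>carrier M. f x \<oplus>\<^bsub>N\<^esub> g x),
     one = (\<lambda>x\<in>carrier M. \<zero>\<^bsub>N\<^esub>)\<rparr>"

text \<open>The coboundary map \<open>Hom(P i, B) \<rightarrow> Hom(P (Suc i), B)\<close>, composition with \<open>d i\<close>.\<close>

definition coboundary ::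
  "(nat \<Rightarrow> ('a, 'u) module) \<Rightarrow> (nat \<Rightarrow> 'u \<Rightarrow> 'u) \<Rightarrow> nat \<Rightarrow> ('u \<Rightarrow> 'c) \<Rightarrow> 'u \<Rightarrow> 'c"
  where "coboundary P d i f = compose (carrier (P (Suc i))) f (d i)"

definition cocycles ::
  "('a, 'm) ring_scheme \<Rightarrow> (nat \<Rightarrow> ('a, 'u) module) \<Rightarrow> (nat \<Rightarrow> 'u \<Rightarrow> 'u)
    \<Rightarrow> ('a, 'c, 'q) module_scheme \<Rightarrow> nat \<Rightarrow> ('u \<Rightarrow> 'c) set"
  where "cocycles R P d B i =
    kernel (Hom_group R (P i) B) (Hom_group R (P (Suc i)) B) (coboundary P d i)"

fun coboundaries ::
  "('a, 'm) ring_scheme \<Rightarrow> (nat \<Rightarrow> ('a, 'u) module) \<Rightarrow> (nat \<Rightarrow> 'u \<Rightarrow> 'u)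
    \<Rightarrow> ('a, 'c, 'q) module_scheme \<Rightarrow> nat \<Rightarrow> ('u \<Rightarrow> 'c) set"
  where
    "coboundaries R P d B 0 = {\<one>\<^bsub>Hom_group R (P 0) B\<^esub>}"
  | "coboundaries R P d B (Suc i) = coboundary P d i ` carrier (Hom_group R (P i) B)"

text \<open>\<open>Ext\<^sup>i(A, B)\<close> computed from a projective resolution \<open>P\<close>, \<open>d\<close> of \<open>A\<close>: the \<open>i\<close>-th cohomology group
  of the complex \<open>Hom(P, B)\<close>.\<close>

definition Ext_group ::
  "('a, 'm) ring_scheme \<Rightarrow> (nat \<Rightarrow> ('a, 'u) module) \<Rightarrow> (nat \<Rightarrow> 'u \<Rightarrow> 'u)
    \<Rightarrow> ('a, 'c, 'q) module_scheme \<Rightarrow> nat \<Rightarrow> ('u \<Rightarrow> 'c) set monoid"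
  where "Ext_group R P d B i =
    (Hom_group R (P i) B)\<lparr>carrier := cocycles R P d B i\<rparr> Mod coboundaries R P d B i"

text \<open>As the group does not depend on the resolution up to isomorphism, vanishing is expressed by
  quantifying over all resolutions; one exists whenever \<open>A\<close> embeds into \<open>'u\<close> and \<open>'u\<close> is infinite
  and at least as large as the ring.\<close>

definition Ext_vanishes ::
  "'u itself \<Rightarrow> ('a, 'm) ring_scheme \<Rightarrow> nat \<Rightarrow> ('a, 'b, 'p) module_scheme
    \<Rightarrow> ('a, 'c, 'q) module_scheme \<Rightarrow> bool"
  where "Ext_vanishes U R i A B \<longleftrightarrow>
    (\<forall>(P :: nat \<Rightarrow> ('a, 'u) module) d e.
       projective_resolution U R P d e A \<longrightarrow> trivial_group (Ext_group R P d B i))"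


section \<open>Tilting modules\<close>

definition in_Add ::
  "'u itself \<Rightarrow> ('a, 'm) ring_scheme \<Rightarrow> ('a, 'b, 'p) module_scheme \<Rightarrow> ('a, 'c, 'q) module_scheme \<Rightarrow> bool"
  where "in_Add U R T M \<longleftrightarrow> module R M \<and>
    (\<exists>K :: 'u set. direct_summand R M (direct_sum K (\<lambda>_. T)))"

text \<open>An exact sequence \<open>0 \<rightarrow> R \<rightarrow> T\<^sub>0 \<rightarrow> \<cdots> \<rightarrow> T\<^sub>r \<rightarrow> 0\<close> with all \<open>T\<^sub>i\<close> in \<open>Add(T)\<close>, continued by
  zero modules beyond \<open>T\<^sub>r\<close>.\<close>

definition Add_coresolution ::
  "'u itself \<Rightarrow> ('a, 'm) ring_scheme \<Rightarrow> ('a, 'b, 'p) module_scheme \<Rightarrow> nat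
    \<Rightarrow> (nat \<Rightarrow> ('a, 'u) module) \<Rightarrow> (nat \<Rightarrow> 'u \<Rightarrow> 'u) \<Rightarrow> ('a \<Rightarrow> 'u) \<Rightarrow> bool"
  where "Add_coresolution U R T r Ts d e \<longleftrightarrow>
    (\<forall>i. in_Add U R T (Ts i)) \<and>
    (\<forall>i>r. carrier (Ts i) = {\<zero>\<^bsub>Ts i\<^esub>}) \<and>
    e \<in> mod_hom R (regular_module R) (Ts 0) \<and>
    (\<forall>i. d i \<in> mod_hom R (Ts i) (Ts (Suc i))) \<and>
    inj_on e (carrier R) \<and>
    e ` carrier R = a_kernel (Ts 0) (Ts (Suc 0)) (d 0) \<and>
    (\<forall>i. d i ` carrier (Ts i) = a_kernel (Ts (Suc i)) (Ts (Suc (Suc i))) (d (Suc i)))"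

definition n_tilting ::
  "'u itself \<Rightarrow> ('a, 'm) ring_scheme \<Rightarrow> nat \<Rightarrow> ('a, 'b, 'p) module_scheme \<Rightarrow> bool"
  where "n_tilting U R n T \<longleftrightarrow>
    module R T \<and>
    pd_le U R T n \<and>
    (\<forall>i\<ge>1. \<forall>K :: 'u set. Ext_vanishes U R i T (direct_sum K (\<lambda>_. T))) \<and>
    (\<exists>r Ts d e. Add_coresolution U R T r Ts d e)"

definition tilting ::
  "'u itself \<Rightarrow> ('a, 'm) ring_scheme \<Rightarrow> ('a, 'b, 'p) module_scheme \<Rightarrow> bool"
  where "tilting U R T \<longleftrightarrow> (\<exists>n. n_tilting U R n T)"

definition pure_tilting_hereditary :: "'u itself \<Rightarrow> ('a, 'm) ring_scheme \<Rightarrow> bool"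
  where "pure_tilting_hereditary U R \<longleftrightarrow>
    (\<forall>I. ideal I R \<and> I \<noteq> {\<zero>\<^bsub>R\<^esub>} \<longrightarrow>
       pure_projective U R (ideal_module R I) \<and> tilting U R (ideal_module R I))"

definition pure_0_tilting_hereditary :: "'u itself \<Rightarrow> ('a, 'm) ring_scheme \<Rightarrow> bool"
  where "pure_0_tilting_hereditary U R \<longleftrightarrow>
    (\<forall>I. ideal I R \<and> I \<noteq> {\<zero>\<^bsub>R\<^esub>} \<longrightarrow>
       pure_projective U R (ideal_module R I) \<and> n_tilting U R 0 (ideal_module R I))"


section \<open>Fraction field and Dedekind domains\<close>

definition nonzero_denom_pairs :: "('a, 'm) ring_scheme \<Rightarrow> ('a \<times> 'a) set"
  where "nonzero_denom_pairs R = carrier R \<times> (carrier R - {\<zero>\<^bsub>R\<^esub>})"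

definition frac_rel :: "('a, 'm) ring_scheme \<Rightarrow> (('a \<times> 'a) \<times> ('a \<times> 'a)) set"
  where "frac_rel R =
    {((a, b), (c, d)). (a, b) \<in> nonzero_denom_pairs R \<and> (c, d) \<in> nonzero_denom_pairs R \<and>
                       a \<otimes>\<^bsub>R\<^esub> d = c \<otimes>\<^bsub>R\<^esub> b}"

definition fraction :: "('a, 'm) ring_scheme \<Rightarrow> 'a \<Rightarrow> 'a \<Rightarrow> ('a \<times> 'a) set"
  where "fraction R a b = frac_rel R `` {(a, b)}"

definition fraction_field :: "('a, 'm) ring_scheme \<Rightarrow> ('a \<times> 'a) set ring"
  where "fraction_field R =
    \<lparr>carrier = nonzero_denom_pairs R // frac_rel R,
     monoid.mult = (\<lambda>p q. \<Union>(a, b)\<in>p. \<Union>(c, d)\<in>q. fraction R (a \<otimes>\<^bsub>R\<^esub> c) (b \<otimes>\<^bsub>R\<^esub> d)),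
     one = fraction R \<one>\<^bsub>R\<^esub> \<one>\<^bsub>R\<^esub>,
     ring.zero = fraction R \<zero>\<^bsub>R\<^esub> \<one>\<^bsub>R\<^esub>,
     ring.add = (\<lambda>p q. \<Union>(a, b)\<in>p. \<Union>(c, d)\<in>q. fraction R (a \<otimes>\<^bsub>R\<^esub> d \<oplus>\<^bsub>R\<^esub> c \<otimes>\<^bsub>R\<^esub> b) (b \<otimes>\<^bsub>R\<^esub> d))\<rparr>"

definition frac_embed :: "('a, 'm) ring_scheme \<Rightarrow> 'a \<Rightarrow> ('a \<times> 'a) set"
  where "frac_embed R a = fraction R a \<one>\<^bsub>R\<^esub>"

text \<open>An \<open>R\<close>-submodule of the fraction field whose elements have a common denominator.\<close>

definition fractional_ideal :: "('a, 'm) ring_scheme \<Rightarrow> ('a \<times> 'a) set set \<Rightarrow> bool"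
  where "fractional_ideal R J \<longleftrightarrow>
    additive_subgroup J (fraction_field R) \<and>
    (\<forall>a\<in>carrier R. \<forall>x\<in>J. frac_embed R a \<otimes>\<^bsub>fraction_field R\<^esub> x \<in> J) \<and>
    (\<exists>s\<in>carrier R - {\<zero>\<^bsub>R\<^esub>}. \<forall>x\<in>J.
       frac_embed R s \<otimes>\<^bsub>fraction_field R\<^esub> x \<in> frac_embed R ` carrier R)"

text \<open>The product \<open>ideal_prod\<close> is the set of finite sums of products, here formed inside the
  fraction field.\<close>

definition invertible_ideal :: "('a, 'm) ring_scheme \<Rightarrow> 'a set \<Rightarrow> bool"
  where "invertible_ideal R I \<longleftrightarrow>
    (\<exists>J. fractional_ideal R J \<and>
         ideal_prod (fraction_field R) (frac_embed R ` I) J = frac_embed R ` carrier R)"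

definition dedekind_domain :: "('a, 'm) ring_scheme \<Rightarrow> bool"
  where "dedekind_domain R \<longleftrightarrow>
    domain R \<and> (\<forall>I. ideal I R \<and> I \<noteq> {\<zero>\<^bsub>R\<^esub>} \<longrightarrow> invertible_ideal R I)"

end

(*
  (2) to (1). A pure projective nonzero ideal I is a direct summand of the direct sum of its finitely
  generated subideals, and since I has rank one the splitting involves only finitely many of them; so I is
  finitely generated and R is noetherian. If R is not Dedekind, choose p maximal among the
  non-invertible nonzero ideals. Then p is a maximal ideal, every fraction q with q p inside R maps p
  into p, and by Nakayama's lemma there is a simple quotient p/N of p, isomorphic to R/p.
  Pulling back 0 -> p -> R -> R/p -> 0 along p -> R/p gives an extension of p by p that cannot split,
  so that Ext^1(p, p) is nonzero and p is not tilting.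

  (1) to (3). An invertible ideal I has a dual basis, so it is projective, and R is a direct
  summand of a finite power of I.
*)
theory Submission
  imports Defs
begin

section \<open>Homomorphisms and transport of structure\<close>

text \<open>The predicates test only modules with carrier in the type 'u, whereas the modules built
  here (sums of subideals, extensions of ideals) live in other types. Lifting problems are therefore
  copied along injections into 'u, and each construction needs a proof that it embeds; this is what
  infinitude and size of 'u supply.

  The extension fails to split for the following reason. Every homomorphism from p to R is
  multiplication by a fraction q with q p inside R. Since such a q maps p into p, the map Hom(p, R)
  -> Hom(p, R/p) is zero. But p -> p/N followed by p/N = R/p is a nonzero element of Hom(p, R/p), so
  its image in Ext^1(p, p) is nonzero. Taking p maximal among the noninvertible ideals does the work
  of localising at a bad prime: every larger ideal may be inverted. Fractions are not formed in this
  part; q is a numerator with a denominator, and invertibility of I is an equation I J = (d) between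
  ideals of R.\<close>

lemma mod_homI:
  assumes "\<And>x. x \<in> carrier M \<Longrightarrow> f x \<in> carrier N"
    and "\<And>x y. x \<in> carrier M \<Longrightarrow> y \<in> carrier M \<Longrightarrow> f (x \<oplus>\<^bsub>M\<^esub> y) = f x \<oplus>\<^bsub>N\<^esub> f y"
    and "\<And>a x. a \<in> carrier R \<Longrightarrow> x \<in> carrier M \<Longrightarrow> f (a \<odot>\<^bsub>M\<^esub> x) = a \<odot>\<^bsub>N\<^esub> f x"
  shows "f \<in> mod_hom R M N"
  using assms by (simp add: mod_hom_def)

lemma mod_hom_closed: "f \<in> mod_hom R M N \<Longrightarrow> x \<in> carrier M \<Longrightarrow> f x \<in> carrier N"
  by (auto simp: mod_hom_def)

lemma mod_hom_add:
  "f \<in> mod_hom R M N \<Longrightarrow> x \<in> carrier M \<Longrightarrow> y \<in> carrier M \<Longrightarrow> f (x \<oplus>\<^bsub>M\<^esub> y) = f x \<oplus>\<^bsub>N\<^esub> f y"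
  by (auto simp: mod_hom_def)

lemma mod_hom_smult:
  "f \<in> mod_hom R M N \<Longrightarrow> a \<in> carrier R \<Longrightarrow> x \<in> carrier M \<Longrightarrow> f (a \<odot>\<^bsub>M\<^esub> x) = a \<odot>\<^bsub>N\<^esub> f x"
  by (auto simp: mod_hom_def)

lemma mod_hom_zero:
  assumes "module R M" "module R N" "f \<in> mod_hom R M N"
  shows "f \<zero>\<^bsub>M\<^esub> = \<zero>\<^bsub>N\<^esub>"
proof -
  interpret M: module R M by fact
  interpret N: module R N by fact
  have "f (\<zero>\<^bsub>R\<^esub> \<odot>\<^bsub>M\<^esub> \<zero>\<^bsub>M\<^esub>) = \<zero>\<^bsub>R\<^esub> \<odot>\<^bsub>N\<^esub> f \<zero>\<^bsub>M\<^esub>"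
    using assms(3) by (intro mod_hom_smult) auto
  with mod_hom_closed[OF assms(3)] show ?thesis by simp
qed

lemma mod_hom_minus:
  assumes "module R M" "module R N" "f \<in> mod_hom R M N" "x \<in> carrier M" "y \<in> carrier M"
  shows "f (x \<ominus>\<^bsub>M\<^esub> y) = f x \<ominus>\<^bsub>N\<^esub> f y"
proof -
  interpret M: module R M by fact
  interpret N: module R N by fact
  have *: "f (\<ominus>\<^bsub>M\<^esub> y) = \<ominus>\<^bsub>N\<^esub> f y"
    using mod_hom_smult[OF assms(3), of "\<ominus>\<^bsub>R\<^esub> \<one>\<^bsub>R\<^esub>" y] assms(5) mod_hom_closed[OF assms(3)]
    by (simp add: M.smult_l_minus N.smult_l_minus)
  show ?thesis
    using assms(4,5) by (simp add: M.minus_eq N.minus_eq mod_hom_add[OF assms(3)] *)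
qed

lemma mod_hom_compose:
  "f \<in> mod_hom R L M \<Longrightarrow> g \<in> mod_hom R M N \<Longrightarrow> (\<lambda>x. g (f x)) \<in> mod_hom R L N"
  by (auto simp: mod_hom_def Pi_iff)

lemma mod_hom_id: "(\<lambda>x. x) \<in> mod_hom R M M"
  by (simp add: mod_hom_def)

lemma mod_hom_cong:
  assumes "module R M" "\<And>x. x \<in> carrier M \<Longrightarrow> f x = g x"
  shows "f \<in> mod_hom R M N \<longleftrightarrow> g \<in> mod_hom R M N"
proof -
  interpret M: module R M by fact
  show ?thesis using assms(2) by (auto simp: mod_hom_def Pi_iff)
qed

lemma mod_hom_plus:
  assumes "module R M" "module R N" "f \<in> mod_hom R M N" "g \<in> mod_hom R M N"
  shows "(\<lambda>x. f x \<oplus>\<^bsub>N\<^esub> g x) \<in> mod_hom R M N"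
proof -
  interpret M: module R M by fact
  interpret N: module R N by fact
  show ?thesis
    using assms(3,4)
    by (auto intro!: mod_homI
        simp: mod_hom_closed mod_hom_add mod_hom_smult N.smult_r_distr N.a_ac)
qed

lemma mod_hom_diff:
  assumes "module R M" "module R N" "f \<in> mod_hom R M N" "g \<in> mod_hom R M N"
  shows "(\<lambda>x. f x \<ominus>\<^bsub>N\<^esub> g x) \<in> mod_hom R M N"
proof -
  interpret M: module R M by fact
  interpret N: module R N by fact
  show ?thesis
    using assms(3,4)
    by (auto intro!: mod_homI
        simp: mod_hom_closed mod_hom_add mod_hom_smult N.smult_r_distr N.a_ac N.minus_eq
          N.smult_r_minus N.minus_add)
qed

lemma mod_hom_const_zero:
  assumes "module R N"
  shows "(\<lambda>_. \<zero>\<^bsub>N\<^esub>) \<in> mod_hom R M N"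
proof -
  interpret N: module R N by fact
  show ?thesis by (auto intro!: mod_homI)
qed

lemma a_kernel_iff: "x \<in> a_kernel M N f \<longleftrightarrow> x \<in> carrier M \<and> f x = \<zero>\<^bsub>N\<^esub>"
  by (simp add: a_kernel_def kernel_def)

lemma submodule_a_kernel:
  assumes "module R M" "module R N" "f \<in> mod_hom R M N"
  shows "submodule (a_kernel M N f) R M"
proof -
  interpret M: module R M by fact
  interpret N: module R N by fact
  have inv: "f (\<ominus>\<^bsub>M\<^esub> x) = \<ominus>\<^bsub>N\<^esub> f x" if "x \<in> carrier M" for x
    using that mod_hom_minus[OF assms, of "\<zero>\<^bsub>M\<^esub>" x]
    by (simp add: M.minus_eq N.minus_eq mod_hom_zero[OF assms] mod_hom_closed[OF assms(3)])
  show ?thesis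
    by (rule M.submoduleI)
      (auto simp: a_kernel_iff mod_hom_zero[OF assms] mod_hom_add[OF assms(3)] inv
        mod_hom_smult[OF assms(3)])
qed

text \<open>The copy of \<open>M\<close> on the image of an injection, by which a module of any type
  enters the universe 'u.\<close>

definition transport_module ::
  "('b \<Rightarrow> 'c) \<Rightarrow> ('a, 'b, 'p) module_scheme \<Rightarrow> ('a, 'c) module"
  where "transport_module \<iota> M =
    \<lparr>carrier = \<iota> ` carrier M,
     monoid.mult = (\<lambda>_ _. \<iota> \<zero>\<^bsub>M\<^esub>),
     one = \<iota> \<zero>\<^bsub>M\<^esub>,
     ring.zero = \<iota> \<zero>\<^bsub>M\<^esub>,
     ring.add = (\<lambda>x y. \<iota> (inv_into (carrier M) \<iota> x \<oplus>\<^bsub>M\<^esub> inv_into (carrier M) \<iota> y)),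
     smult = (\<lambda>a x. \<iota> (a \<odot>\<^bsub>M\<^esub> inv_into (carrier M) \<iota> x))\<rparr>"

lemma transport_module_simps [simp]:
  "carrier (transport_module \<iota> M) = \<iota> ` carrier M"
  "\<zero>\<^bsub>transport_module \<iota> M\<^esub> = \<iota> \<zero>\<^bsub>M\<^esub>"
  "inj_on \<iota> (carrier M) \<Longrightarrow> x \<in> carrier M \<Longrightarrow> y \<in> carrier M \<Longrightarrow>
     \<iota> x \<oplus>\<^bsub>transport_module \<iota> M\<^esub> \<iota> y = \<iota> (x \<oplus>\<^bsub>M\<^esub> y)"
  "inj_on \<iota> (carrier M) \<Longrightarrow> x \<in> carrier M \<Longrightarrow> a \<odot>\<^bsub>transport_module \<iota> M\<^esub> \<iota> x = \<iota> (a \<odot>\<^bsub>M\<^esub> x)"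
  by (simp_all add: transport_module_def inv_into_f_f)

lemma module_transport:
  assumes "module R M" "inj_on \<iota> (carrier M)"
  shows "module R (transport_module \<iota> M)"
proof -
  interpret M: module R M by fact
  note [simp] = assms(2)
  show ?thesis
  proof (rule moduleI)
    show "abelian_group (transport_module \<iota> M)"
    proof (rule abelian_groupI)
      fix x assume "x \<in> carrier (transport_module \<iota> M)"
      then obtain u where u: "u \<in> carrier M" "x = \<iota> u" by auto
      show "\<exists>y\<in>carrier (transport_module \<iota> M). y \<oplus>\<^bsub>transport_module \<iota> M\<^esub> x = \<zero>\<^bsub>transport_module \<iota> M\<^esub>"
        by (rule bexI[of _ "\<iota> (\<ominus>\<^bsub>M\<^esub> u)"]) (use u in \<open>auto simp: M.l_neg\<close>)
    qed (auto simp: M.a_ac)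
  qed (auto simp: M.smult_l_distr M.smult_r_distr M.smult_assoc1 M.R.cring_axioms)
qed

lemma transport_hom:
  assumes "inj_on \<iota> (carrier M)"
  shows "\<iota> \<in> mod_hom R M (transport_module \<iota> M)"
  using assms by (auto intro!: mod_homI)

lemma transport_inv_hom:
  assumes "module R M" "inj_on \<iota> (carrier M)"
  shows "inv_into (carrier M) \<iota> \<in> mod_hom R (transport_module \<iota> M) M"
proof -
  interpret M: module R M by fact
  show ?thesis using assms(2) by (auto intro!: mod_homI)
qed

text \<open>Choosing preimages embeds the target of a surjection as well, so the lifting lemmas
  below ask only for an embedding of the source.\<close>

lemma inj_on_quotient:
  assumes "inj_on \<iota> B" "g ` B = C"
  shows "inj_on (\<iota> \<circ> inv_into B g) C"
  using assms by (auto intro!: comp_inj_on inj_on_inv_into inj_on_subset[OF assms(1)] inv_into_into)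

text \<open>A lifting problem along a surjection \<open>g : B \<rightarrow> C\<close> can be moved into the universe as soon as
  the source \<open>B\<close> embeds into it.\<close>

lemma lifts_along_transport:
  fixes B :: "('a, 'b, 'p) module_scheme" and C :: "('a, 'c, 'q) module_scheme"
    and \<iota> :: "'b \<Rightarrow> 'u" and \<kappa> :: "'c \<Rightarrow> 'u"
  assumes B: "module R B" and C: "module R C" and g: "g \<in> mod_hom R B C"
    and \<iota>: "inj_on \<iota> (carrier B)" and \<kappa>: "inj_on \<kappa> (carrier C)"
  shows "lifts_along R P (transport_module \<iota> B) (\<lambda>x. \<kappa> (g (inv_into (carrier B) \<iota> x))) (transport_module \<kappa> C)
    \<longleftrightarrow> lifts_along R P B g C"
    (is "?L \<longleftrightarrow> ?R")
proof
  assume L: ?L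
  show ?R unfolding lifts_along_def
  proof
    fix f assume f: "f \<in> mod_hom R P C"
    obtain h where h: "h \<in> mod_hom R P (transport_module \<iota> B)"
      and eq: "\<And>x. x \<in> carrier P \<Longrightarrow> \<kappa> (g (inv_into (carrier B) \<iota> (h x))) = \<kappa> (f x)"
      using bspec[OF L[unfolded lifts_along_def] mod_hom_compose[OF f transport_hom[OF \<kappa>]]] by auto
    have h': "(\<lambda>x. inv_into (carrier B) \<iota> (h x)) \<in> mod_hom R P B"
      by (rule mod_hom_compose[OF h transport_inv_hom[OF B \<iota>]])
    show "\<exists>h\<in>mod_hom R P B. \<forall>x\<in>carrier P. g (h x) = f x"
      using mod_hom_closed[OF g mod_hom_closed[OF h']] mod_hom_closed[OF f]
      by (intro bexI[OF _ h'] ballI) (blast intro: inj_onD[OF \<kappa> eq])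
  qed
next
  assume R: ?R
  show ?L unfolding lifts_along_def
  proof
    fix f assume f: "f \<in> mod_hom R P (transport_module \<kappa> C)"
    obtain h where h: "h \<in> mod_hom R P B"
      and eq: "\<And>x. x \<in> carrier P \<Longrightarrow> g (h x) = inv_into (carrier C) \<kappa> (f x)"
      using bspec[OF R[unfolded lifts_along_def] mod_hom_compose[OF f transport_inv_hom[OF C \<kappa>]]] by auto
    have "\<kappa> (g (inv_into (carrier B) \<iota> (\<iota> (h x)))) = f x" if "x \<in> carrier P" for x
      using that eq[OF that] mod_hom_closed[OF h] mod_hom_closed[OF f that] \<iota>
      by (auto simp: f_inv_into_f)
    then show "\<exists>h\<in>mod_hom R P (transport_module \<iota> B).
        \<forall>x\<in>carrier P. \<kappa> (g (inv_into (carrier B) \<iota> (h x))) = f x"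
      by (intro bexI[OF _ mod_hom_compose[OF h transport_hom[OF \<iota>]]] ballI)
  qed
qed

lemma transport_epi:
  assumes B: "module R B" and C: "module R C" and g: "g \<in> mod_hom R B C" "g ` carrier B = carrier C"
    and \<iota>: "inj_on \<iota> (carrier B)" and \<kappa>: "inj_on \<kappa> (carrier C)"
  shows "(\<lambda>x. \<kappa> (g (inv_into (carrier B) \<iota> x))) \<in> mod_hom R (transport_module \<iota> B) (transport_module \<kappa> C)"
    and "(\<lambda>x. \<kappa> (g (inv_into (carrier B) \<iota> x))) ` carrier (transport_module \<iota> B) = carrier (transport_module \<kappa> C)"
proof -
  show "(\<lambda>x. \<kappa> (g (inv_into (carrier B) \<iota> x))) \<in> mod_hom R (transport_module \<iota> B) (transport_module \<kappa> C)"
    by (intro mod_hom_compose[OF mod_hom_compose[OF transport_inv_hom[OF B \<iota>] g(1)] transport_hom[OF \<kappa>]])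
  show "(\<lambda>x. \<kappa> (g (inv_into (carrier B) \<iota> x))) ` carrier (transport_module \<iota> B) = carrier (transport_module \<kappa> C)"
    using \<iota> by (simp add: image_image flip: g(2))
qed

text \<open>Frees projectivity from the universe: \<open>B\<close> and \<open>C\<close> may have any
  type as long as \<open>B\<close> embeds into 'u, since both can be replaced by their copies
  there.\<close>

lemma projective_module_lifts:
  fixes \<iota> :: "'b \<Rightarrow> 'u" and B :: "('a, 'b, 'p) module_scheme" and C :: "('a, 'c, 'q) module_scheme"
  assumes P: "projective_module TYPE('u) R P"
    and B: "module R B" and C: "module R C" and g: "g \<in> mod_hom R B C" "g ` carrier B = carrier C"
    and \<iota>: "inj_on \<iota> (carrier B)"
  shows "lifts_along R P B g C"
proof -
  obtain \<kappa> :: "'c \<Rightarrow> 'u" where \<kappa>: "inj_on \<kappa> (carrier C)"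
    using inj_on_quotient[OF \<iota> g(2)] by blast
  show ?thesis
    unfolding lifts_along_transport[OF B C g(1) \<iota> \<kappa>, symmetric]
    using P module_transport[OF B \<iota>] module_transport[OF C \<kappa>] transport_epi[OF B C g \<iota> \<kappa>]
    unfolding projective_module_def by blast
qed

text \<open>The same passage to copies for pure projectivity. Lifting out of a finitely presented
  \<open>F\<close> is not affected by copying \<open>B\<close> and \<open>C\<close>, so purity may
  be checked on the original map.\<close>

lemma pure_projective_lifts:
  fixes \<iota> :: "'b \<Rightarrow> 'u" and B :: "('a, 'b, 'p) module_scheme" and C :: "('a, 'c, 'q) module_scheme"
  assumes P: "pure_projective TYPE('u) R P"
    and B: "module R B" and C: "module R C" and g: "g \<in> mod_hom R B C" "g ` carrier B = carrier C"
    and \<iota>: "inj_on \<iota> (carrier B)"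
    and pure: "\<And>F :: ('a, 'u) module. finitely_presented R F \<Longrightarrow> lifts_along R F B g C"
  shows "lifts_along R P B g C"
proof -
  obtain \<kappa> :: "'c \<Rightarrow> 'u" where \<kappa>: "inj_on \<kappa> (carrier C)"
    using inj_on_quotient[OF \<iota> g(2)] by blast
  let ?B = "transport_module \<iota> B" and ?C = "transport_module \<kappa> C"
  let ?g = "\<lambda>x. \<kappa> (g (inv_into (carrier B) \<iota> x))"
  \<comment> \<open>The kernel with its inclusion completes the transported surjection to a short
    exact sequence.\<close>
  let ?K = "a_kernel ?B ?C ?g"
  note g' = transport_epi[OF B C g \<iota> \<kappa>] and B' = module_transport[OF B \<iota>] and C' = module_transport[OF C \<kappa>]
  have K: "submodule ?K R ?B"
    by (rule submodule_a_kernel[OF B' C' g'(1)])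
  have "pure_exact TYPE('u) R (?B\<lparr>carrier := ?K\<rparr>) (\<lambda>x. x) ?B ?g ?C"
    unfolding pure_exact_def short_exact_def
    using lifts_along_transport[OF B C g(1) \<iota> \<kappa>] pure
    by (intro conjI B' C' g' submodule.submodule_is_module[OF K B'] allI impI)
      (auto simp: mod_hom_def a_kernel_iff)
  then show ?thesis
    unfolding lifts_along_transport[OF B C g(1) \<iota> \<kappa>, symmetric]
    using P unfolding pure_projective_def by blast
qed

section \<open>Ideals and direct sums as modules\<close>

lemma ideal_module_simps [simp]:
  "carrier (ideal_module R I) = I"
  "\<zero>\<^bsub>ideal_module R I\<^esub> = \<zero>\<^bsub>R\<^esub>"
  "x \<oplus>\<^bsub>ideal_module R I\<^esub> y = x \<oplus>\<^bsub>R\<^esub> y"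
  "a \<odot>\<^bsub>ideal_module R I\<^esub> x = a \<otimes>\<^bsub>R\<^esub> x"
  by (simp_all add: ideal_module_def)

lemma module_ideal:
  assumes "cring R" "ideal I R"
  shows "module R (ideal_module R I)"
proof -
  interpret cring R by fact
  interpret I: ideal I R by fact
  show ?thesis
  proof (rule moduleI)
    show "abelian_group (ideal_module R I)"
      by (rule abelian_groupI)
        (auto simp: I.Icarr a_ac r_neg intro!: bexI[of _ "\<ominus>\<^bsub>R\<^esub> _"] I.a_inv_closed)
  qed (auto simp: I.Icarr l_distr r_distr m_assoc I.I_l_closed cring_axioms)
qed

lemma module_regular: "cring R \<Longrightarrow> module R (regular_module R)"
  by (simp add: module_ideal cring_def ring.oneideal)

section \<open>Direct sums and their universal property\<close>

lemma direct_sum_simps [simp]: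
  "x \<in> carrier (direct_sum K M) \<longleftrightarrow>
    x \<in> (\<Pi>\<^sub>E i\<in>K. carrier (M i)) \<and> finite {i \<in> K. x i \<noteq> \<zero>\<^bsub>M i\<^esub>}"
  "\<zero>\<^bsub>direct_sum K M\<^esub> = (\<lambda>i\<in>K. \<zero>\<^bsub>M i\<^esub>)"
  "x \<oplus>\<^bsub>direct_sum K M\<^esub> y = (\<lambda>i\<in>K. x i \<oplus>\<^bsub>M i\<^esub> y i)"
  "a \<odot>\<^bsub>direct_sum K M\<^esub> x = (\<lambda>i\<in>K. a \<odot>\<^bsub>M i\<^esub> x i)"
  by (simp_all add: direct_sum_def)

lemma module_direct_sum:
  assumes "cring R" "\<And>i. i \<in> K \<Longrightarrow> module R (M i)"
  shows "module R (direct_sum K M)"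
proof -
  interpret cring R by fact
  have agr: "abelian_group (M i)" if "i \<in> K" for i
    using assms(2)[OF that] by (simp add: module_def)
  note agm = abelian_group.axioms(1)[OF agr]
  have fin2: "finite {i \<in> K. x i \<oplus>\<^bsub>M i\<^esub> y i \<noteq> \<zero>\<^bsub>M i\<^esub>}"
    if "finite {i \<in> K. x i \<noteq> \<zero>\<^bsub>M i\<^esub>}" "finite {i \<in> K. y i \<noteq> \<zero>\<^bsub>M i\<^esub>}" for x y
    by (rule finite_subset[OF _ finite_UnI[OF that]])
      (auto simp: abelian_monoid.l_zero[OF agm] abelian_monoid.zero_closed[OF agm])
  have fin1: "finite {i \<in> K. a \<odot>\<^bsub>M i\<^esub> x i \<noteq> \<zero>\<^bsub>M i\<^esub>}"
    if "finite {i \<in> K. x i \<noteq> \<zero>\<^bsub>M i\<^esub>}" "a \<in> carrier R" for a x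
    by (rule finite_subset[OF _ that(1)]) (auto simp: module.smult_r_null[OF assms(2)] that)
  show ?thesis
  proof (rule moduleI)
    show "abelian_group (direct_sum K M)"
    proof (rule abelian_groupI)
      fix x y assume "x \<in> carrier (direct_sum K M)" "y \<in> carrier (direct_sum K M)"
      then show "x \<oplus>\<^bsub>direct_sum K M\<^esub> y \<in> carrier (direct_sum K M)"
        using fin2 by (auto simp: PiE_iff abelian_monoid.a_closed[OF agm] cong: conj_cong)
      from \<open>x \<in> _\<close> \<open>y \<in> _\<close>
      show "x \<oplus>\<^bsub>direct_sum K M\<^esub> y = y \<oplus>\<^bsub>direct_sum K M\<^esub> x"
        by (auto simp: PiE_iff abelian_monoid.a_comm[OF agm] intro!: restrict_ext)
    next
      fix x y z
      assume "x \<in> carrier (direct_sum K M)" "y \<in> carrier (direct_sum K M)" "z \<in> carrier (direct_sum K M)"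
      then show "x \<oplus>\<^bsub>direct_sum K M\<^esub> y \<oplus>\<^bsub>direct_sum K M\<^esub> z = x \<oplus>\<^bsub>direct_sum K M\<^esub> (y \<oplus>\<^bsub>direct_sum K M\<^esub> z)"
        by (auto simp: PiE_iff abelian_monoid.a_assoc[OF agm] intro!: restrict_ext)
    next
      fix x assume x: "x \<in> carrier (direct_sum K M)"
      then show "\<zero>\<^bsub>direct_sum K M\<^esub> \<oplus>\<^bsub>direct_sum K M\<^esub> x = x"
        by (auto simp: PiE_iff extensional_def abelian_monoid.l_zero[OF agm] fun_eq_iff)
      have "finite {i \<in> K. \<ominus>\<^bsub>M i\<^esub> x i \<noteq> \<zero>\<^bsub>M i\<^esub>}"
        using x by (elim finite_subset[rotated] conjE direct_sum_simps(1)[THEN iffD1, elim_format])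
          (auto simp: PiE_iff abelian_group.minus_equality[OF agr] abelian_monoid.zero_closed[OF agm]
            abelian_monoid.l_zero[OF agm])
      then show "\<exists>y\<in>carrier (direct_sum K M). y \<oplus>\<^bsub>direct_sum K M\<^esub> x = \<zero>\<^bsub>direct_sum K M\<^esub>"
        using x
        by (intro bexI[of _ "\<lambda>i\<in>K. \<ominus>\<^bsub>M i\<^esub> x i"])
          (auto simp: PiE_iff abelian_group.a_inv_closed[OF agr] abelian_group.l_neg[OF agr]
            intro!: restrict_ext cong: conj_cong)
    qed (auto simp: abelian_monoid.zero_closed[OF agm])
  qed (use fin1 in \<open>auto simp: PiE_iff extensional_def fun_eq_iff cring_axioms module.smult_l_distr[OF assms(2)]
      module.smult_r_distr[OF assms(2)] module.smult_assoc1[OF assms(2)] module.smult_closed[OF assms(2)]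
      module.smult_one[OF assms(2)] cong: conj_cong\<close>)
qed

definition direct_sum_inj ::
  "'i set \<Rightarrow> ('i \<Rightarrow> ('a, 'b, 'p) module_scheme) \<Rightarrow> 'i \<Rightarrow> 'b \<Rightarrow> 'i \<Rightarrow> 'b"
  where "direct_sum_inj K M i v = (\<lambda>j\<in>K. if j = i then v else \<zero>\<^bsub>M j\<^esub>)"

lemma direct_sum_inj_hom:
  assumes "\<And>i. i \<in> K \<Longrightarrow> module R (M i)" "i \<in> K"
  shows "direct_sum_inj K M i \<in> mod_hom R (M i) (direct_sum K M)"
proof -
  have ag: "abelian_monoid (M i)" if "i \<in> K" for i
    using assms(1)[OF that] by (simp add: module_def abelian_group_def)
  have "finite {j \<in> K. j = i}" by simp
  note f = finite_subset[OF _ this]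
  show ?thesis
    using assms(2)
    by (intro mod_homI)
      (auto simp: direct_sum_inj_def fun_eq_iff abelian_monoid.l_zero[OF ag] module.smult_r_null[OF assms(1)]
        abelian_monoid.zero_closed[OF ag] abelian_monoid.a_closed[OF ag] module.smult_closed[OF assms(1)] intro: f)
qed

text \<open>The map out of a coproduct induced by the family \<open>h\<close>. It sums over the
  support of \<open>x\<close>, because \<open>finsum\<close> over an infinite index set returns a
  default value.\<close>

definition direct_sum_copair ::
  "('i \<Rightarrow> ('a, 'b, 'p) module_scheme) \<Rightarrow> ('a, 'c, 'q) module_scheme \<Rightarrow> 'i set \<Rightarrow> ('i \<Rightarrow> 'b \<Rightarrow> 'c)
    \<Rightarrow> ('i \<Rightarrow> 'b) \<Rightarrow> 'c"
  where "direct_sum_copair M N K h x = (\<Oplus>\<^bsub>N\<^esub>i\<in>{i \<in> K. x i \<noteq> \<zero>\<^bsub>M i\<^esub>}. h i (x i))"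

context
  fixes R :: "('a, 'm) ring_scheme" and M :: "'i \<Rightarrow> ('a, 'b, 'p) module_scheme"
    and N :: "('a, 'c, 'q) module_scheme" and K :: "'i set" and h :: "'i \<Rightarrow> 'b \<Rightarrow> 'c"
  assumes M: "\<And>i. i \<in> K \<Longrightarrow> module R (M i)"
    and N: "module R N"
    and h: "\<And>i. i \<in> K \<Longrightarrow> h i \<in> mod_hom R (M i) N"
begin

interpretation N: module R N by (rule N)

text \<open>Terms outside the support vanish, so any finite index set containing it gives the same
  sum. This provides a common index set for elements with different supports, as additivity
  requires.\<close>

lemma direct_sum_copair_eq:
  assumes "x \<in> carrier (direct_sum K M)" "finite F" "F \<subseteq> K" "{i \<in> K. x i \<noteq> \<zero>\<^bsub>M i\<^esub>} \<subseteq> F"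
  shows "direct_sum_copair M N K h x = (\<Oplus>\<^bsub>N\<^esub>i\<in>F. h i (x i))"
  unfolding direct_sum_copair_def
  using assms mod_hom_closed[OF h]
  by (intro N.add.finprod_mono_neutral_cong_left)
    (auto simp: PiE_iff mod_hom_zero[OF M N h])

lemma direct_sum_copair_hom: "direct_sum_copair M N K h \<in> mod_hom R (direct_sum K M) N"
proof -
  interpret D: module R "direct_sum K M"
    by (rule module_direct_sum[OF N.R.cring_axioms M])
  have fin: "finite {i \<in> K. x i \<noteq> \<zero>\<^bsub>M i\<^esub>}" and mem: "\<And>i. i \<in> K \<Longrightarrow> x i \<in> carrier (M i)"
    and hmem: "\<And>i. i \<in> K \<Longrightarrow> h i (x i) \<in> carrier N"
    if "x \<in> carrier (direct_sum K M)" for x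
    using that mod_hom_closed[OF h] by (auto simp: PiE_iff)
  show ?thesis
  proof (rule mod_homI)
    fix x assume x: "x \<in> carrier (direct_sum K M)"
    show "direct_sum_copair M N K h x \<in> carrier N"
      using hmem[OF x] by (auto simp: direct_sum_copair_def intro!: N.finsum_closed)
    fix a assume a: "a \<in> carrier R"
    let ?F = "{i \<in> K. x i \<noteq> \<zero>\<^bsub>M i\<^esub>}"
    have ax: "a \<odot>\<^bsub>direct_sum K M\<^esub> x \<in> carrier (direct_sum K M)"
      using a x by (rule D.smult_closed)
    have "direct_sum_copair M N K h (a \<odot>\<^bsub>direct_sum K M\<^esub> x)
        = (\<Oplus>\<^bsub>N\<^esub>i\<in>?F. h i ((a \<odot>\<^bsub>direct_sum K M\<^esub> x) i))"
      using a by (intro direct_sum_copair_eq ax fin x) (auto simp: module.smult_r_null[OF M])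
    also have "\<dots> = (\<Oplus>\<^bsub>N\<^esub>i\<in>?F. a \<odot>\<^bsub>N\<^esub> h i (x i))"
      using a hmem[OF x] mem[OF x] by (intro N.finsum_cong') (auto simp: mod_hom_smult[OF h])
    also have "\<dots> = a \<odot>\<^bsub>N\<^esub> direct_sum_copair M N K h x"
      unfolding direct_sum_copair_def
      using a hmem[OF x] by (intro N.finsum_smult_ldistr[symmetric] fin x) auto
    finally show "direct_sum_copair M N K h (a \<odot>\<^bsub>direct_sum K M\<^esub> x) = a \<odot>\<^bsub>N\<^esub> direct_sum_copair M N K h x" .
  next
    fix x y assume x: "x \<in> carrier (direct_sum K M)" and y: "y \<in> carrier (direct_sum K M)"
    let ?F = "{i \<in> K. x i \<noteq> \<zero>\<^bsub>M i\<^esub>} \<union> {i \<in> K. y i \<noteq> \<zero>\<^bsub>M i\<^esub>}"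
    have F: "finite ?F" using fin[OF x] fin[OF y] by simp
    have xy: "x \<oplus>\<^bsub>direct_sum K M\<^esub> y \<in> carrier (direct_sum K M)"
      using x y by (rule D.a_closed)
    have agm: "abelian_monoid (M i)" if "i \<in> K" for i
      using M[OF that] by (simp add: module_def abelian_group_def)
    have "direct_sum_copair M N K h (x \<oplus>\<^bsub>direct_sum K M\<^esub> y)
        = (\<Oplus>\<^bsub>N\<^esub>i\<in>?F. h i ((x \<oplus>\<^bsub>direct_sum K M\<^esub> y) i))"
      by (intro direct_sum_copair_eq xy F)
        (auto simp: abelian_monoid.l_zero[OF agm] abelian_monoid.zero_closed[OF agm])
    also have "\<dots> = (\<Oplus>\<^bsub>N\<^esub>i\<in>?F. h i (x i) \<oplus>\<^bsub>N\<^esub> h i (y i))"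
      using hmem[OF x] hmem[OF y] mem[OF x] mem[OF y]
      by (intro N.finsum_cong') (auto simp: mod_hom_add[OF h])
    also have "\<dots> = (\<Oplus>\<^bsub>N\<^esub>i\<in>?F. h i (x i)) \<oplus>\<^bsub>N\<^esub> (\<Oplus>\<^bsub>N\<^esub>i\<in>?F. h i (y i))"
      using hmem[OF x] hmem[OF y] by (intro N.finsum_addf) auto
    also have "(\<Oplus>\<^bsub>N\<^esub>i\<in>?F. h i (x i)) = direct_sum_copair M N K h x"
      by (intro direct_sum_copair_eq[symmetric] x F) auto
    also have "(\<Oplus>\<^bsub>N\<^esub>i\<in>?F. h i (y i)) = direct_sum_copair M N K h y"
      by (intro direct_sum_copair_eq[symmetric] y F) auto
    finally show "direct_sum_copair M N K h (x \<oplus>\<^bsub>direct_sum K M\<^esub> y)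
      = direct_sum_copair M N K h x \<oplus>\<^bsub>N\<^esub> direct_sum_copair M N K h y" .
  qed
qed

lemma direct_sum_copair_inj:
  assumes i: "i \<in> K" and v: "v \<in> carrier (M i)"
  shows "direct_sum_copair M N K h (direct_sum_inj K M i v) = h i v"
proof -
  have "direct_sum_copair M N K h (direct_sum_inj K M i v) = (\<Oplus>\<^bsub>N\<^esub>j\<in>{i}. h j (direct_sum_inj K M i v j))"
  proof (rule direct_sum_copair_eq)
    show "direct_sum_inj K M i v \<in> carrier (direct_sum K M)"
      using M i v by (blast intro: mod_hom_closed direct_sum_inj_hom)
  qed (use i in \<open>auto simp: direct_sum_inj_def\<close>)
  then show ?thesis
    using i mod_hom_closed[OF h[OF i] v] by (simp add: direct_sum_inj_def)
qed

end

section \<open>Embedding direct sums into the universe\<close>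

lemma infinite_pair_inj:
  assumes "infinite (UNIV :: 'u set)"
  obtains p :: "'u \<times> 'u \<Rightarrow> 'u" where "inj p"
proof -
  have "|UNIV \<times> UNIV :: ('u \<times> 'u) set| \<le>o |UNIV :: 'u set|"
    using card_of_Times_same_infinite[OF assms] by (rule ordIso_imp_ordLeq)
  then show ?thesis
    using that by (auto simp flip: card_of_ordLeq)
qed

text \<open>An element of a direct sum is determined by its graph over its support, a finite set of
  pairs (index, value). Pairs are coded by elements of 'u, and an infinite type has as many finite
  subsets as elements.\<close>

lemma direct_sum_embeds:
  fixes K :: "'i set" and M :: "'i \<Rightarrow> ('a, 'b, 'p) module_scheme" and \<alpha> :: "'i \<Rightarrow> 'u" and \<beta> :: "'b \<Rightarrow> 'u"
  assumes u: "infinite (UNIV :: 'u set)" and \<alpha>: "inj_on \<alpha> K" and \<beta>: "inj_on \<beta> A"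
    and M: "\<And>i. i \<in> K \<Longrightarrow> carrier (M i) \<subseteq> A"
  obtains \<kappa> :: "('i \<Rightarrow> 'b) \<Rightarrow> 'u" where "inj_on \<kappa> (carrier (direct_sum K M))"
proof -
  obtain p :: "'u \<times> 'u \<Rightarrow> 'u" where p: "inj p"
    using infinite_pair_inj[OF u] .
  obtain \<phi> :: "'u set \<Rightarrow> 'u" where \<phi>: "inj_on \<phi> (Fpow UNIV)"
    using eqpoll_Fpow[OF u] by (auto simp: eqpoll_def bij_betw_def)
  define \<gamma> where "\<gamma> x = (\<lambda>i. p (\<alpha> i, \<beta> (x i))) ` {i \<in> K. x i \<noteq> \<zero>\<^bsub>M i\<^esub>}" for x
  have eq: "x = y" if x: "x \<in> carrier (direct_sum K M)" and y: "y \<in> carrier (direct_sum K M)"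
    and e: "\<gamma> x = \<gamma> y" for x y
  proof -
    \<comment> \<open>Equal codes force agreement on the support of the first element. Exchanging
      the two covers the other support, and elsewhere both values are zero.\<close>
    have *: "z' i = z i" if z: "z \<in> carrier (direct_sum K M)" "z' \<in> carrier (direct_sum K M)"
      "\<gamma> z = \<gamma> z'" "i \<in> K" "z i \<noteq> \<zero>\<^bsub>M i\<^esub>" for z z' i
    proof -
      from that have "p (\<alpha> i, \<beta> (z i)) \<in> \<gamma> z'" by (auto simp: \<gamma>_def)
      then obtain j where j: "j \<in> K" "p (\<alpha> i, \<beta> (z i)) = p (\<alpha> j, \<beta> (z' j))"
        by (auto simp: \<gamma>_def)
      then have "\<alpha> i = \<alpha> j" "\<beta> (z i) = \<beta> (z' j)"
        by (auto dest: injD[OF p])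
      moreover have "z i \<in> A" "z' j \<in> A"
        using z M[OF \<open>i \<in> K\<close>] M[OF \<open>j \<in> K\<close>] j by (auto simp: PiE_iff)
      ultimately show ?thesis
        using inj_onD[OF \<alpha> _ \<open>i \<in> K\<close> \<open>j \<in> K\<close>] inj_onD[OF \<beta>] by auto
    qed
    show ?thesis
    proof (rule ext)
      fix i
      consider "i \<notin> K" | "i \<in> K" "x i \<noteq> \<zero>\<^bsub>M i\<^esub>" | "i \<in> K" "y i \<noteq> \<zero>\<^bsub>M i\<^esub>"
        | "x i = \<zero>\<^bsub>M i\<^esub>" "y i = \<zero>\<^bsub>M i\<^esub>"
        by blast
      then show "x i = y i"
      proof cases
        case 1
        then show ?thesis using x y by (auto simp: PiE_iff extensional_def)
      next
        case 2
        then show ?thesis using *[OF x y e] by simp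
      next
        case 3
        then show ?thesis using *[OF y x e[symmetric]] by simp
      qed simp
    qed
  qed
  have "inj_on (\<lambda>x. \<phi> (\<gamma> x)) (carrier (direct_sum K M))"
  proof (rule inj_onI)
    fix x y assume x: "x \<in> carrier (direct_sum K M)" and y: "y \<in> carrier (direct_sum K M)"
      and "\<phi> (\<gamma> x) = \<phi> (\<gamma> y)"
    then have "\<gamma> x = \<gamma> y"
      by (intro inj_onD[OF \<phi>]) (auto simp: Fpow_def \<gamma>_def)
    with x y show "x = y" by (rule eq)
  qed
  then show ?thesis by (rule that)
qed

section \<open>Pure projective ideals of a domain\<close>

text \<open>The images of the standard basis vectors generate the image of \<open>f\<close>.\<close>

lemma free_module_image_in_genideal:
  assumes R: "cring R" and I: "ideal I R" and f: "f \<in> mod_hom R (free_module R n) (ideal_module R I)"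
  obtains S where "S \<subseteq> I" "finite S" "f ` carrier (free_module R n) \<subseteq> genideal R S"
proof -
  interpret R: cring R by fact
  let ?M = "\<lambda>_::nat. regular_module R"
  have free: "free_module R n = direct_sum {..<n} ?M" by (simp add: free_module_def)
  have M: "module R (regular_module R)" by (rule module_regular[OF R])
  have F: "module R (free_module R n)" unfolding free by (rule module_direct_sum[OF R M])
  note inj = direct_sum_inj_hom[of "{..<n}" R ?M, OF M, folded free]
  define e where "e k = direct_sum_inj {..<n} ?M k \<one>\<^bsub>R\<^esub>" for k
  have e: "e k \<in> carrier (free_module R n)" if "k < n" for k
    using mod_hom_closed[OF inj, of k "\<one>\<^bsub>R\<^esub>"] that by (simp add: e_def)
  define S where "S = (\<lambda>k. f (e k)) ` {..<n}"
  have S: "S \<subseteq> I" using e mod_hom_closed[OF f] by (auto simp: S_def)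
  have SR: "S \<subseteq> carrier R" using S ideal.Icarr[OF I] by auto
  interpret S: ideal "genideal R S" R by (rule R.genideal_ideal[OF SR])
  \<comment> \<open>Here \<open>m\<close> bounds the support of \<open>v\<close>; the induction
    splits off the last coordinate as a multiple of a basis vector.\<close>
  have "f v \<in> genideal R S"
    if "v \<in> carrier (free_module R n)" "m \<le> n" "\<And>k. m \<le> k \<Longrightarrow> k < n \<Longrightarrow> v k = \<zero>\<^bsub>R\<^esub>" for v m
    using that
  proof (induction m arbitrary: v)
    case 0
    then have "v = \<zero>\<^bsub>free_module R n\<^esub>"
      by (auto simp: free fun_eq_iff PiE_iff extensional_def)
    then have "f v = \<zero>\<^bsub>R\<^esub>"
      using mod_hom_zero[OF F module_ideal[OF R I] f] by simp
    then show ?case by simp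
  next
    case (Suc m)
    let ?w = "\<lambda>k\<in>{..<n}. if k = m then \<zero>\<^bsub>R\<^esub> else v k"
    have v: "v m \<in> carrier R" using Suc.prems(1,2) by (auto simp: free PiE_iff)
    have w: "?w \<in> carrier (free_module R n)"
      using Suc.prems(1) by (auto simp: free PiE_iff)
    have "v = (v m \<odot>\<^bsub>free_module R n\<^esub> e m) \<oplus>\<^bsub>free_module R n\<^esub> ?w"
      using Suc.prems(1,2)
      by (auto simp: free e_def direct_sum_inj_def fun_eq_iff PiE_iff extensional_def)
    moreover have "f ((v m \<odot>\<^bsub>free_module R n\<^esub> e m) \<oplus>\<^bsub>free_module R n\<^esub> ?w) = v m \<otimes>\<^bsub>R\<^esub> f (e m) \<oplus>\<^bsub>R\<^esub> f ?w"
      using v w e[of m] Suc.prems(2) module.smult_closed[OF F v]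
      by (simp add: mod_hom_add[OF f] mod_hom_smult[OF f] del: restrict_apply)
    moreover have "f ?w \<in> genideal R S"
      using Suc.prems(2,3) by (intro Suc.IH w) auto
    moreover have "f (e m) \<in> genideal R S"
      using Suc.prems(2) R.genideal_self[OF SR] by (auto simp: S_def)
    ultimately show ?case
      using v by (simp add: S.I_l_closed)
  qed
  from this[OF _ order_refl] have "f ` carrier (free_module R n) \<subseteq> genideal R S" by auto
  with S show ?thesis by (intro that[of S]) (auto simp: S_def)
qed

text \<open>The sum map \<open>\<Oplus>S. (S) \<rightarrow> I\<close> over the finite subsets \<open>S\<close> of \<open>I\<close> is a pure epimorphism, because
  finitely generated modules have finitely generated images in \<open>I\<close>. A section of it has finite support: in a
  module of rank one the support is already determined by a single nonzero element.\<close>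

lemma pure_projective_ideal_fg:
  fixes R :: "('a, 'm) ring_scheme" (structure)
  assumes R: "domain R" and u: "infinite (UNIV :: 'u set)" and j: "inj_on (j :: 'a \<Rightarrow> 'u) (carrier R)"
    and I: "ideal I R" and pp: "pure_projective TYPE('u) R (ideal_module R I)"
  shows "\<exists>A\<subseteq>carrier R. finite A \<and> I = genideal R A"
proof (cases "I \<subseteq> {\<zero>\<^bsub>R\<^esub>}")
  case True
  interpret domain R by fact
  interpret I: ideal I R by fact
  from True I.zero_closed have "I = {\<zero>\<^bsub>R\<^esub>}" by auto
  then show ?thesis
    using genideal_zero by (intro exI[of _ "{\<zero>\<^bsub>R\<^esub>}"]) auto
next
  case False
  interpret domain R by fact
  interpret I: ideal I R by fact
  note cr = cring_axioms
  note MI = module_ideal[OF cr I]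
  let ?M = "\<lambda>S. ideal_module R (Idl S)"
  let ?B = "direct_sum (Fpow I) ?M"
  have SR: "S \<subseteq> carrier R" if "S \<in> Fpow I" for S
    using that I.Icarr by (auto simp: Fpow_def)
  have MS: "module R (?M S)" if "S \<in> Fpow I" for S
    by (rule module_ideal[OF cr genideal_ideal[OF SR[OF that]]])
  have sub: "Idl S \<subseteq> I" if "S \<in> Fpow I" for S
    using that by (intro genideal_minimal I) (auto simp: Fpow_def)
  have B: "module R ?B" by (rule module_direct_sum[where K = "Fpow I" and M = ?M, OF cr MS])
  let ?g = "direct_sum_copair ?M (ideal_module R I) (Fpow I) (\<lambda>_ x. x)"
  have incl: "(\<lambda>x. x) \<in> mod_hom R (?M S) (ideal_module R I)" if "S \<in> Fpow I" for S
    using sub[OF that] by (intro mod_homI) auto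
  note copair = direct_sum_copair_eq[where K = "Fpow I" and M = ?M, OF MS MI incl]
    direct_sum_copair_hom[where K = "Fpow I" and M = ?M, OF MS MI incl]
    direct_sum_copair_inj[where K = "Fpow I" and M = ?M, OF MS MI incl]
  note g = copair(2)
  have g_inj: "?g (direct_sum_inj (Fpow I) ?M S v) = v" if "S \<in> Fpow I" "v \<in> Idl S" for S v
    using copair(3)[of S v] that by simp
  have inj_hom: "direct_sum_inj (Fpow I) ?M S \<in> mod_hom R (?M S) ?B" if "S \<in> Fpow I" for S
    by (rule direct_sum_inj_hom[where K = "Fpow I" and M = ?M, OF MS that])
  have surj: "?g ` carrier ?B = carrier (ideal_module R I)"
  proof
    show "?g ` carrier ?B \<subseteq> carrier (ideal_module R I)"
      using mod_hom_closed[OF g] by auto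
    show "carrier (ideal_module R I) \<subseteq> ?g ` carrier ?B"
    proof
      fix x assume "x \<in> carrier (ideal_module R I)"
      then have x: "{x} \<in> Fpow I" "x \<in> Idl {x}"
        using genideal_self[of "{x}"] I.Icarr by (auto simp: Fpow_def)
      show "x \<in> ?g ` carrier ?B"
        using g_inj[OF x] mod_hom_closed[OF inj_hom[OF x(1)], of x] x(2) by (metis ideal_module_simps(1) imageI)
    qed
  qed
  \<comment> \<open>The index set consists of finite subsets of \<open>I\<close>. Applying
    \<open>j\<close> elementwise and then coding finite subsets of 'u by elements embeds it into the
    universe.\<close>
  obtain \<phi> :: "'u set \<Rightarrow> 'u" where \<phi>: "inj_on \<phi> (Fpow UNIV)"
    using eqpoll_Fpow[OF u] by (auto simp: eqpoll_def bij_betw_def)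
  have "inj_on ((`) j) (Fpow I)"
    by (rule inj_on_image_Fpow[OF inj_on_subset[OF j]]) (auto simp: I.Icarr)
  then have "inj_on (\<phi> \<circ> (`) j) (Fpow I)"
    by (rule comp_inj_on) (rule inj_on_subset[OF \<phi>], auto simp: Fpow_def)
  then obtain \<kappa> :: "('a set \<Rightarrow> 'a) \<Rightarrow> 'u" where \<kappa>: "inj_on \<kappa> (carrier ?B)"
    by (rule direct_sum_embeds[OF u _ j, of _ _ ?M]) (use sub I.Icarr in fastforce)+
  have pure: "lifts_along R F ?B ?g (ideal_module R I)" if fp: "finitely_presented R F" for F :: "('a, 'u) module"
    unfolding lifts_along_def
  proof
    fix f assume f: "f \<in> mod_hom R F (ideal_module R I)"
    from fp obtain n q where q: "q \<in> mod_hom R (free_module R n) F" "q ` carrier (free_module R n) = carrier F"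
      by (auto simp: finitely_presented_def)
    obtain S where S: "S \<subseteq> I" "finite S" "(\<lambda>v. f (q v)) ` carrier (free_module R n) \<subseteq> Idl S"
      using free_module_image_in_genideal[OF cr I mod_hom_compose[OF q(1) f]] by blast
    then have S': "S \<in> Fpow I" by (simp add: Fpow_def)
    have fS: "f x \<in> Idl S" if "x \<in> carrier F" for x
      using that S(3) by (auto simp flip: q(2))
    \<comment> \<open>Since \<open>f\<close> lands in one finitely generated subideal, it lifts into
      the single summand with index \<open>S\<close>.\<close>
    then have "f \<in> mod_hom R F (?M S)"
      using f by (auto intro!: mod_homI simp: mod_hom_add[OF f] mod_hom_smult[OF f])
    then have "(\<lambda>x. direct_sum_inj (Fpow I) ?M S (f x)) \<in> mod_hom R F ?B"
      by (rule mod_hom_compose) (rule inj_hom[OF S'])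
    then show "\<exists>h\<in>mod_hom R F ?B. \<forall>x\<in>carrier F. ?g (h x) = f x"
      by (rule bexI[rotated]) (simp add: g_inj[OF S' fS])
  qed
  have "lifts_along R (ideal_module R I) ?B ?g (ideal_module R I)"
    by (rule pure_projective_lifts[OF pp B MI g surj \<kappa> pure])
  then obtain s where s: "s \<in> mod_hom R (ideal_module R I) ?B" and gs: "\<And>x. x \<in> I \<Longrightarrow> ?g (s x) = x"
    unfolding lifts_along_def using mod_hom_id by fastforce
  obtain z where z: "z \<in> I" "z \<noteq> \<zero>" using False by auto
  have sB: "s x \<in> carrier ?B" if "x \<in> I" for x
    using mod_hom_closed[OF s, of x] that by simp
  have sS: "s x S \<in> Idl S" "s x S \<in> carrier R" if "x \<in> I" "S \<in> Fpow I" for x S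
    using sB[OF that(1)] that(2) sub[OF that(2)] I.Icarr by (auto simp: PiE_iff)
  define \<Lambda> where "\<Lambda> = {S \<in> Fpow I. s z S \<noteq> \<zero>}"
  have \<Lambda>: "finite \<Lambda>" "\<Lambda> \<subseteq> Fpow I"
    using sB[OF z(1)] by (auto simp: \<Lambda>_def)
  \<comment> \<open>Linearity gives z s(w) = s(z w) = w s(z) in every coordinate. Where s(z)
    vanishes, so does s(w), because z is nonzero in a domain.\<close>
  have supp: "s w S = \<zero>" if w: "w \<in> I" and S: "S \<in> Fpow I" "S \<notin> \<Lambda>" for w S
  proof -
    have "z \<otimes> s w S = s (z \<otimes> w) S"
      using mod_hom_smult[OF s, of z w] z(1) w S by (simp add: I.Icarr)
    also have "\<dots> = s (w \<otimes> z) S"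
      using z(1) w by (simp add: m_comm I.Icarr)
    also have "\<dots> = w \<otimes> s z S"
      using mod_hom_smult[OF s, of w z] z(1) w S by (simp add: I.Icarr)
    also have "\<dots> = \<zero>"
      using S w by (simp add: \<Lambda>_def I.Icarr)
    finally show ?thesis
      using z sS(2)[OF w S(1)] by (simp add: I.Icarr integral_iff)
  qed
  let ?A = "\<Union>\<Lambda>"
  have A: "?A \<subseteq> I" "finite ?A" using \<Lambda> by (auto simp: Fpow_def)
  then have AR: "?A \<subseteq> carrier R" using I.Icarr by auto
  interpret A: ideal "Idl ?A" R by (rule genideal_ideal[OF AR])
  have "I \<subseteq> Idl ?A"
  proof
    fix x assume x: "x \<in> I"
    have "?g (s x) = (\<Oplus>\<^bsub>ideal_module R I\<^esub>S\<in>\<Lambda>. s x S)"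
      by (rule copair(1)[OF _ _ sB[OF x] \<Lambda>]) (use supp[OF x] in auto)
    \<comment> \<open>Coordinate \<open>S\<close> of \<open>s x\<close> lies in
      \<open>Idl S\<close>, and each such ideal is contained in the one generated by the union of
      the finite support family.\<close>
    moreover have "(\<Oplus>\<^bsub>ideal_module R I\<^esub>S\<in>L. s x S) \<in> Idl ?A" if "L \<subseteq> \<Lambda>" for L
      using finite_subset[OF that \<Lambda>(1)] that
    proof (induction L rule: finite_induct)
      case empty
      interpret MI: module R "ideal_module R I" by (rule MI)
      show ?case using A.zero_closed by simp
    next
      case (insert S L)
      interpret MI: module R "ideal_module R I" by (rule MI)
      have "s x S \<in> I" if "S \<in> \<Lambda>" for S
        using sS(1)[OF x] sub that \<Lambda>(2) by blast
      moreover have "Idl S \<subseteq> Idl ?A"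
        using insert.prems by (intro genideal_minimal A.ideal_axioms) (use genideal_self[OF AR] in auto)
      then have "s x S \<in> Idl ?A"
        using sS(1)[OF x, of S] insert.prems \<Lambda>(2) by auto
      ultimately show ?case
        using insert by (subst MI.finsum_insert) auto
    qed
    ultimately show "x \<in> Idl ?A" using gs[OF x] order_refl by metis
  qed
  moreover have "Idl ?A \<subseteq> I" by (rule genideal_minimal[OF I A(1)])
  ultimately show ?thesis using A AR by blast
qed

section \<open>Invertible ideals in noetherian domains\<close>

text \<open>Invertibility of an ideal without reference to the field of fractions: a fractional inverse
  is \<open>d\<^sup>-\<^sup>1J\<close>.\<close>

definition divides_principal :: "('a, 'm) ring_scheme \<Rightarrow> 'a set \<Rightarrow> bool"
  where "divides_principal R I \<longleftrightarrow>
    (\<exists>J d. ideal J R \<and> d \<in> carrier R - {\<zero>\<^bsub>R\<^esub>} \<and> I \<cdot>\<^bsub>R\<^esub> J = PIdl\<^bsub>R\<^esub> d)"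

text \<open>The elementwise closure properties of an ideal, without the simplification rules that come with
  \<open>ideal\<close>: these become expensive when several ideals are present.\<close>

locale ideal_elements = cring R for R (structure) and I +
  assumes is_ideal: "ideal I R"
begin

lemma Icarr: "x \<in> I \<Longrightarrow> x \<in> carrier R"
  by (rule ideal.Icarr[OF is_ideal])

lemma zero_closed: "\<zero> \<in> I"
  by (rule additive_subgroup.zero_closed[OF ideal.axioms(1)[OF is_ideal]])

lemma a_closed: "x \<in> I \<Longrightarrow> y \<in> I \<Longrightarrow> x \<oplus> y \<in> I"
  by (rule additive_subgroup.a_closed[OF ideal.axioms(1)[OF is_ideal]])

lemma a_inv_closed: "x \<in> I \<Longrightarrow> \<ominus> x \<in> I"
  by (rule additive_subgroup.a_inv_closed[OF ideal.axioms(1)[OF is_ideal]])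

lemmas I_l_closed = ideal.I_l_closed[OF is_ideal]
  and I_r_closed = ideal.I_r_closed[OF is_ideal]

end

section \<open>Ideal arithmetic and Nakayama's lemma\<close>

lemma (in cring) ideal_elementsI: "ideal I R \<Longrightarrow> ideal_elements R I"
  by (intro ideal_elements.intro ideal_elements_axioms.intro cring_axioms)

text \<open>Closure under negation is multiplication by -1.\<close>

lemma (in cring) idealI_cring:
  assumes "I \<subseteq> carrier R" "\<zero> \<in> I" "\<And>x y. x \<in> I \<Longrightarrow> y \<in> I \<Longrightarrow> x \<oplus> y \<in> I"
    and "\<And>a x. a \<in> carrier R \<Longrightarrow> x \<in> I \<Longrightarrow> a \<otimes> x \<in> I"
  shows "ideal I R"
proof (rule idealI[OF ring_axioms])
  show "subgroup I (add_monoid R)"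
  proof (rule subgroup.intro)
    fix x assume x: "x \<in> I"
    have "\<ominus> x \<in> I"
      using assms(4)[of "\<ominus> \<one>", OF _ x] x assms(1) by (auto simp: l_minus)
    then show "inv\<^bsub>add_monoid R\<^esub> x \<in> I" by (simp add: a_inv_def)
  qed (use assms in auto)
next
  fix a x assume ax: "a \<in> I" "x \<in> carrier R"
  show "x \<otimes> a \<in> I" using ax(2,1) by (rule assms(4))
  then show "a \<otimes> x \<in> I" using ax assms(1) m_comm[of a x] by auto
qed

lemma (in cring) ideal_prod_mono:
  "I \<subseteq> I' \<Longrightarrow> J \<subseteq> J' \<Longrightarrow> I \<cdot> J \<subseteq> I' \<cdot> J'"
proof
  fix x assume "I \<subseteq> I'" "J \<subseteq> J'" "x \<in> I \<cdot> J"
  from this(3,1,2) show "x \<in> I' \<cdot> J'"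
    by (induction x rule: ideal_prod.induct) (auto intro: ideal_prod.intros)
qed

lemma (in cring) mem_PIdl_iff: "x \<in> PIdl d \<longleftrightarrow> (\<exists>r\<in>carrier R. x = r \<otimes> d)"
  by (auto simp: cgenideal_def)

lemma (in cring) genideal_insert_subset:
  assumes "y \<in> carrier R" "A \<subseteq> carrier R" "x \<in> Idl (insert y A)"
  obtains r v where "r \<in> carrier R" "v \<in> Idl A" "x = r \<otimes> y \<oplus> v"
proof -
  have "insert y A \<subseteq> PIdl y <+>\<^bsub>R\<^esub> Idl A"
  proof
    interpret A: ideal_elements R "Idl A" by (rule ideal_elementsI, rule genideal_ideal[OF assms(2)])
    fix z assume "z \<in> insert y A"
    then have "z = y \<oplus> \<zero> \<and> y \<in> PIdl y \<and> \<zero> \<in> Idl A \<or> z = \<zero> \<oplus> z \<and> \<zero> \<in> PIdl y \<and> z \<in> Idl A"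
      using assms(1,2) genideal_self[OF assms(2)] cgenideal_self[OF assms(1)]
        additive_subgroup.zero_closed[OF ideal.axioms(1)[OF cgenideal_ideal[OF assms(1)]]] A.zero_closed
      by auto
    then show "z \<in> PIdl y <+>\<^bsub>R\<^esub> Idl A" unfolding set_add_def' by blast
  qed
  then have "Idl (insert y A) \<subseteq> PIdl y <+>\<^bsub>R\<^esub> Idl A"
    by (intro genideal_minimal add_ideals cgenideal_ideal genideal_ideal assms(1,2))
  with assms(3) have "x \<in> PIdl y <+>\<^bsub>R\<^esub> Idl A" by blast
  then show ?thesis
    using that by (auto simp: set_add_def' mem_PIdl_iff)
qed

text \<open>Generators are eliminated one at a time, which avoids determinants. The multiplier
  \<open>s\<close>, congruent to 1 modulo \<open>L\<close>, is part of the statement because each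
  elimination changes it. At the end a multiplier kills the last generator; it is nonzero since 1 is
  not in \<open>L\<close>, so in a domain the generator is zero.\<close>

lemma (in domain) nakayama:
  assumes "finite A" "A \<subseteq> carrier R" and L: "ideal L R" "\<one> \<notin> L"
    and "s \<in> carrier R" "s \<ominus> \<one> \<in> L" "\<And>x. x \<in> A \<Longrightarrow> s \<otimes> x \<in> L \<cdot> (Idl A)"
  shows "A \<subseteq> {\<zero>}"
  using assms(1,2,5-)
proof (induction A arbitrary: s rule: finite_induct)
  case empty
  then show ?case by simp
next
  case (insert y A)
  interpret L: ideal_elements R L by (rule ideal_elementsI, rule L)
  have AR: "A \<subseteq> carrier R" and y: "y \<in> carrier R" and s: "s \<in> carrier R" using insert.prems by auto
  interpret P: ideal_elements R "L \<cdot> (Idl A)"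
    by (rule ideal_elementsI, rule ideal_prod_is_ideal[OF L(1) genideal_ideal[OF AR]])
  have split: "\<exists>l\<in>L. \<exists>w\<in>L \<cdot> (Idl A). x = l \<otimes> y \<oplus> w" if "x \<in> L \<cdot> (Idl (insert y A))" for x
    using that
  proof (induction x rule: ideal_prod.induct)
    case (prod i j)
    obtain r v where rv: "r \<in> carrier R" "v \<in> Idl A" "j = r \<otimes> y \<oplus> v"
      using genideal_insert_subset[OF y AR prod(2)] .
    moreover have "v \<in> carrier R"
      using rv(2) by (rule ideal.Icarr[OF genideal_ideal[OF AR]])
    ultimately have "i \<otimes> j = (i \<otimes> r) \<otimes> y \<oplus> i \<otimes> v"
      using y prod(1) by (simp add: L.Icarr r_distr m_assoc)
    then show ?case
      using prod(1) rv(1,2) unfolding rv(3)[symmetric] by (blast intro: L.I_r_closed ideal_prod.prod)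
  next
    case (sum s1 s2)
    then obtain l1 w1 l2 w2 where w: "l1 \<in> L" "w1 \<in> L \<cdot> (Idl A)" "s1 = l1 \<otimes> y \<oplus> w1"
      "l2 \<in> L" "w2 \<in> L \<cdot> (Idl A)" "s2 = l2 \<otimes> y \<oplus> w2" by auto
    then have "s1 \<oplus> s2 = (l1 \<oplus> l2) \<otimes> y \<oplus> (w1 \<oplus> w2)"
      using y by (simp add: L.Icarr P.Icarr l_distr a_ac)
    with w show ?case by (blast intro: L.a_closed P.a_closed)
  qed
  obtain l w where lw: "l \<in> L" "w \<in> L \<cdot> (Idl A)" "s \<otimes> y = l \<otimes> y \<oplus> w"
    using split insert.prems(4)[of y] by blast
  \<comment> \<open>Moving the \<open>y\<close>-term of \<open>s y = l y + w\<close> to the left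
    gives \<open>t y = w\<close>, which no longer involves \<open>y\<close> on the right, and
    \<open>t\<close> is still congruent to 1.\<close>
  define t where "t = s \<ominus> l"
  have t: "t \<in> carrier R" using s lw(1) by (simp add: t_def L.Icarr)
  have ty: "t \<otimes> y = w"
  proof -
    have "t \<otimes> y = s \<otimes> y \<ominus> l \<otimes> y"
      using s lw(1) y by (simp add: t_def L.Icarr minus_eq l_distr l_minus)
    also have "\<dots> = w" unfolding lw(3)
      using lw y by (simp add: L.Icarr P.Icarr minus_eq a_ac r_neg r_neg2)
    finally show ?thesis .
  qed
  have t1: "t \<ominus> \<one> \<in> L"
  proof -
    have "t \<ominus> \<one> = (s \<ominus> \<one>) \<ominus> l"
      using s lw(1) by (simp add: t_def L.Icarr minus_eq a_ac)
    then show ?thesis using insert.prems(3) lw(1)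
      by (simp add: minus_eq L.a_closed L.a_inv_closed)
  qed
  \<comment> \<open>The multiplier \<open>t s\<close> works for the remaining generators: in
    \<open>t s x = l' (t y) + t w'\<close> the term \<open>t y\<close> may be replaced by
    \<open>w\<close>.\<close>
  have "A \<subseteq> {\<zero>}"
  proof (rule insert.IH[OF AR])
    show "t \<otimes> s \<in> carrier R" using t s by simp
    have "t \<otimes> s \<ominus> \<one> = (t \<ominus> \<one>) \<otimes> s \<oplus> (s \<ominus> \<one>)"
      using t s by (simp add: minus_eq l_distr l_minus a_assoc r_neg1)
    then show "t \<otimes> s \<ominus> \<one> \<in> L"
      using t1 insert.prems(3) s by (simp add: L.I_r_closed L.a_closed)
    fix x assume x: "x \<in> A"
    then obtain l' w' where lw': "l' \<in> L" "w' \<in> L \<cdot> (Idl A)" "s \<otimes> x = l' \<otimes> y \<oplus> w'"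
      using split insert.prems(4)[of x] by blast
    have xc: "x \<in> carrier R" using x AR by auto
    have "t \<otimes> s \<otimes> x = l' \<otimes> (t \<otimes> y) \<oplus> t \<otimes> w'"
      using lw' t s y xc by (simp add: m_assoc r_distr L.Icarr P.Icarr m_lcomm)
    then show "t \<otimes> s \<otimes> x \<in> L \<cdot> (Idl A)"
      using lw' lw(2) t by (simp add: ty P.I_l_closed L.Icarr P.a_closed)
  qed
  moreover have "y = \<zero>"
  proof -
    have "Idl A \<subseteq> {\<zero>}"
      using \<open>A \<subseteq> {\<zero>}\<close> by (intro genideal_minimal zeroideal)
    then have "L \<cdot> (Idl A) \<subseteq> L \<cdot> {\<zero>}"
      by (intro ideal_prod_mono) auto
    also have "\<dots> \<subseteq> {\<zero>}"
      using ideal_prod_inter[OF L(1) zeroideal] by auto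
    finally have "t \<otimes> y = \<zero>" using lw(2) ty by auto
    moreover have "t \<noteq> \<zero>"
    proof
      assume "t = \<zero>"
      with t1 have "\<ominus> \<one> \<in> L" by (simp add: minus_eq)
      from L.a_inv_closed[OF this] L(2) show False by simp
    qed
    ultimately show ?thesis using t y by (simp add: integral_iff)
  qed
  ultimately show ?case by simp
qed

text \<open>In a noetherian ring the union of a nonempty chain of ideals belongs to the chain, so
  Zorn's lemma applies to any nonempty family of ideals.\<close>

lemma (in noetherian_ring) maximal_ideal_in_family:
  assumes "Fam \<noteq> {}" "\<And>I. I \<in> Fam \<Longrightarrow> ideal I R"
  obtains M where "M \<in> Fam" "\<And>I. I \<in> Fam \<Longrightarrow> M \<subseteq> I \<Longrightarrow> I = M"
proof -
  have "\<exists>M\<in>Fam. \<forall>I\<in>Fam. M \<subseteq> I \<longrightarrow> I = M"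
  proof (rule subset_Zorn_nonempty[OF assms(1)])
    fix C assume C: "C \<noteq> {}" "subset.chain Fam C"
    then have "subset.chain {I. ideal I R} C"
      using assms(2) by (auto simp: pred_on.chain_def)
    from ideal_chain_is_trivial[OF C(1) this] C(2) show "\<Union>C \<in> Fam"
      by (auto simp: pred_on.chain_def)
  qed
  with that show ?thesis by blast
qed

text \<open>An ideal maximal among the non-invertible ones behaves as the maximal ideal of a local ring
  of depth at least two: it is a maximal ideal and equals its own product with its inverse.\<close>

locale maximal_noninvertible = noetherian_domain +
  fixes p
  assumes p_ideal: "ideal p R" and p_nonzero: "p \<noteq> {\<zero>}" and p_noninv: "\<not> divides_principal R p"
    and p_max: "\<And>J. ideal J R \<Longrightarrow> p \<subseteq> J \<Longrightarrow> \<not> divides_principal R J \<Longrightarrow> J = p"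
begin

sublocale cring R ..
sublocale p: ideal_elements R p by (rule ideal_elementsI) (rule p_ideal)

lemma noninvertibleI:
  assumes "ideal J R" "d \<in> carrier R" "d \<noteq> \<zero>" "p \<cdot> J = PIdl d"
  shows False
  using assms p_noninv by (auto simp: divides_principal_def)

text \<open>The unit ideal is its own inverse, with generator 1 for the product.\<close>

lemma one_notin_p: "\<one> \<notin> p"
proof
  assume "\<one> \<in> p"
  have "p \<cdot> carrier R = p"
    using ideal_prod_one[OF p_ideal] .
  then show False
    using noninvertibleI[OF oneideal one_closed one_not_zero] ideal.one_imp_carrier[OF p_ideal \<open>\<one> \<in> p\<close>]
    by (auto simp: mem_PIdl_iff set_eq_iff)
qed

text \<open>Nakayama's lemma for a finite generating set of \<open>p\<close>, started with
  multiplier 1.\<close>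

lemma not_subset_prod:
  assumes "ideal L R" "\<one> \<notin> L"
  shows "\<not> p \<subseteq> L \<cdot> p"
proof
  assume sub: "p \<subseteq> L \<cdot> p"
  obtain A where A: "A \<subseteq> carrier R" "finite A" "p = Idl A"
    using finetely_gen[OF p_ideal] by blast
  have "A \<subseteq> {\<zero>}"
  proof (rule nakayama[OF A(2,1) assms one_closed])
    show "\<one> \<ominus> \<one> \<in> L" using additive_subgroup.zero_closed[OF ideal.axioms(1)[OF assms(1)]]
      by (simp add: minus_eq r_neg)
    show "\<one> \<otimes> x \<in> L \<cdot> (Idl A)" if "x \<in> A" for x
      using that A(1) sub genideal_self[OF A(1)] by (auto simp flip: A(3) simp: subset_iff)
  qed
  then have "p \<subseteq> {\<zero>}"
    unfolding A(3) by (intro genideal_minimal zeroideal)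
  with p.zero_closed p_nonzero show False by auto
qed

text \<open>A proper ideal L strictly above p is invertible by the choice of p. Then N = p L^-1
  contains p, and N is noninvertible because p = N L is. Hence N = p by maximality, so p = L p,
  which Nakayama's lemma forbids.\<close>

lemma p_maximal:
  assumes L: "ideal L R" "p \<subseteq> L" "L \<noteq> p"
  shows "\<one> \<in> L"
proof (rule ccontr)
  assume "\<one> \<notin> L"
  interpret L: ideal_elements R L by (rule ideal_elementsI, rule L)
  obtain L' d where L': "ideal L' R" and d: "d \<in> carrier R" "d \<noteq> \<zero>" and LL': "L \<cdot> L' = PIdl d"
  proof -
    have "divides_principal R L" using p_max L by blast
    then show ?thesis using that unfolding divides_principal_def by blast
  qed
  interpret L': ideal_elements R L' by (rule ideal_elementsI, rule L')
  interpret pL': ideal_elements R "p \<cdot> L'" by (rule ideal_elementsI, rule ideal_prod_is_ideal[OF p_ideal L'])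
  \<comment> \<open>This is p L^-1 written without fractions: the inverse of \<open>L\<close> is
    \<open>L'\<close> divided by \<open>d\<close>.\<close>
  define N where "N = {n \<in> carrier R. d \<otimes> n \<in> p \<cdot> L'}"
  have N: "ideal N R"
    using d by (intro idealI_cring)
      (auto simp: N_def r_distr pL'.a_closed pL'.zero_closed pL'.I_l_closed m_lcomm)
  interpret N: ideal_elements R N by (rule ideal_elementsI, rule N)
  \<comment> \<open>Divisibility by \<open>d\<close> comes from p L' being contained in L L' =
    (d).\<close>
  have pL'_dN: "\<exists>n\<in>N. x = d \<otimes> n" if "x \<in> p \<cdot> L'" for x
  proof -
    have "x \<in> PIdl d"
      using that ideal_prod_mono[OF L(2) order_refl, of L'] LL' by blast
    then obtain n where n: "n \<in> carrier R" "x = n \<otimes> d" unfolding mem_PIdl_iff by blast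
    then have "x = d \<otimes> n" using d(1) by (simp only: m_comm)
    with n(1) that show ?thesis unfolding N_def by blast
  qed
  have d_mem: "d \<in> L \<cdot> L'" unfolding LL' by (rule cgenideal_self[OF d(1)])
  have "p \<subseteq> N"
  proof
    fix x assume x: "x \<in> p"
    have "t \<otimes> x \<in> p \<cdot> L'" if "t \<in> L \<cdot> L'" for t
      using that
    proof (induction t rule: ideal_prod.induct)
      case (prod i j)
      then have "i \<otimes> j \<otimes> x = (i \<otimes> x) \<otimes> j"
        using x by (simp add: m_ac L.Icarr L'.Icarr p.Icarr)
      then show ?case using prod x by (auto intro!: ideal_prod.prod p.I_l_closed L.Icarr)
    next
      case (sum s1 s2)
      then have "s1 \<in> carrier R" "s2 \<in> carrier R"
        using ideal_prod_in_carrier[OF L(1) L'] by auto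
      then show ?case using sum x by (simp add: l_distr p.Icarr pL'.a_closed)
    qed
    from this[OF d_mem] x show "x \<in> N" by (simp add: N_def p.Icarr)
  qed
  moreover have "\<not> divides_principal R N"
  proof
    assume "divides_principal R N"
    then obtain N' e where N': "ideal N' R" and e: "e \<in> carrier R" "e \<noteq> \<zero>" and NN': "N \<cdot> N' = PIdl e"
      by (auto simp: divides_principal_def)
    interpret N': ideal_elements R N' by (rule ideal_elementsI, rule N')
    interpret pLN: ideal_elements R "p \<cdot> L' \<cdot> N'" by (rule ideal_elementsI, rule ideal_prod_is_ideal[OF pL'.is_ideal N'])
    have "p \<cdot> L' \<cdot> N' \<subseteq> PIdl (d \<otimes> e)"
    proof
      interpret de: ideal_elements R "PIdl (d \<otimes> e)" by (rule ideal_elementsI) (use d e in \<open>auto intro: cgenideal_ideal\<close>)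
      fix x assume "x \<in> p \<cdot> L' \<cdot> N'"
      then show "x \<in> PIdl (d \<otimes> e)"
      proof (induction x rule: ideal_prod.induct)
        case (prod i j)
        obtain n where n: "n \<in> N" "i = d \<otimes> n" using pL'_dN[OF prod(1)] by blast
        have "n \<otimes> j \<in> PIdl e" using n(1) prod(2) unfolding NN'[symmetric] by (rule ideal_prod.prod)
        then obtain r where r: "r \<in> carrier R" "n \<otimes> j = r \<otimes> e" by (auto simp: mem_PIdl_iff)
        have "i \<otimes> j = r \<otimes> (d \<otimes> e)"
          using n prod(2) d e r by (simp add: m_assoc N.Icarr N'.Icarr m_lcomm)
        then show ?case using r by (auto simp: mem_PIdl_iff)
      qed (rule de.a_closed)
    qed
    moreover have "d \<otimes> t \<in> p \<cdot> L' \<cdot> N'" if "t \<in> N \<cdot> N'" for t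
      using that
    proof (induction t rule: ideal_prod.induct)
      case (prod i j)
      then show ?case
        using d ideal_prod.prod[of "d \<otimes> i" "p \<cdot> L'" j N' R] by (simp add: N_def m_assoc N'.Icarr)
    next
      case (sum s1 s2)
      then have "s1 \<in> carrier R" "s2 \<in> carrier R"
        using ideal_prod_in_carrier[OF N N'] by auto
      then show ?case using sum d by (simp add: r_distr pLN.a_closed)
    qed
    then have "d \<otimes> e \<in> p \<cdot> L' \<cdot> N'"
      unfolding NN' using cgenideal_self[OF e(1)] by auto
    then have "PIdl (d \<otimes> e) \<subseteq> p \<cdot> L' \<cdot> N'"
      by (rule cgenideal_minimal[OF pLN.is_ideal])
    ultimately have "p \<cdot> (L' \<cdot> N') = PIdl (d \<otimes> e)"
      using ideal_prod_assoc[OF p_ideal L' N'] by auto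
    then show False
      using d e by (intro noninvertibleI[of "L' \<cdot> N'" "d \<otimes> e"] ideal_prod_is_ideal L' N')
        (auto simp: integral_iff)
  qed
  ultimately have Np: "N = p" by (intro p_max N)
  interpret Lp: ideal_elements R "L \<cdot> p" by (rule ideal_elementsI, rule ideal_prod_is_ideal[OF L(1) p_ideal])
  have "p \<subseteq> L \<cdot> p"
  proof
    fix x assume x: "x \<in> p"
    \<comment> \<open>The claim is proved for all \<open>t\<close> in L L' to allow induction on
      products and sums; only \<open>t = d\<close> is wanted, where cancelling \<open>d\<close> puts
      \<open>x\<close> into L p.\<close>
    have "\<exists>m\<in>L \<cdot> p. t \<otimes> x = d \<otimes> m" if "t \<in> L \<cdot> L'" for t
      using that
    proof (induction t rule: ideal_prod.induct)
      case (prod i j)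
      obtain n where n: "n \<in> p" "x \<otimes> j = d \<otimes> n"
        using pL'_dN[OF ideal_prod.prod[OF x prod(2)]] by (auto simp: Np)
      have "i \<otimes> j \<otimes> x = i \<otimes> (x \<otimes> j)"
        using prod x by (simp add: m_ac L.Icarr L'.Icarr p.Icarr)
      also have "\<dots> = d \<otimes> (i \<otimes> n)"
        unfolding n(2) using prod n(1) d by (simp add: m_lcomm L.Icarr p.Icarr)
      finally show ?case using prod(1) n(1) by (auto intro: ideal_prod.prod)
    next
      case (sum s1 s2)
      then obtain m1 m2 where m: "m1 \<in> L \<cdot> p" "s1 \<otimes> x = d \<otimes> m1" "m2 \<in> L \<cdot> p" "s2 \<otimes> x = d \<otimes> m2"
        by auto
      from sum have "s1 \<in> carrier R" "s2 \<in> carrier R"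
        using ideal_prod_in_carrier[OF L(1) L'] by auto
      then have "(s1 \<oplus> s2) \<otimes> x = d \<otimes> (m1 \<oplus> m2)"
        using m x d by (simp add: l_distr r_distr p.Icarr Lp.Icarr)
      then show ?case using m by (auto intro: Lp.a_closed)
    qed
    from this[OF d_mem] obtain m where "m \<in> L \<cdot> p" "d \<otimes> x = d \<otimes> m" by auto
    then show "x \<in> L \<cdot> p"
      using d x by (simp add: m_lcancel p.Icarr Lp.Icarr)
  qed
  with not_subset_prod[OF L(1) \<open>\<one> \<notin> L\<close>] show False by simp
qed

text \<open>Put q = u/v. If the ideal q p were not inside p, maximality of p would give 1 = a + q a'
  with a and a' in p. Then R + R q would be an inverse of p: its product with p lies in R and
  contains 1.\<close>

lemma p_fractions_stable:
  assumes u: "u \<in> carrier R" and v: "v \<in> carrier R" "v \<noteq> \<zero>"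
    and uv: "\<And>x. x \<in> p \<Longrightarrow> u \<otimes> x \<in> PIdl v"
    and x: "x \<in> p"
  shows "\<exists>y\<in>p. u \<otimes> x = v \<otimes> y"
proof -
  \<comment> \<open>The ideal q p, which the assumption places inside R.\<close>
  define Q where "Q = {y \<in> carrier R. \<exists>x\<in>p. v \<otimes> y = u \<otimes> x}"
  have Q: "ideal Q R"
  proof (rule idealI_cring)
    show "\<zero> \<in> Q" using u v by (auto simp: Q_def intro!: bexI[of _ \<zero>] p.zero_closed)
    show "y \<oplus> y' \<in> Q" if "y \<in> Q" "y' \<in> Q" for y y'
    proof -
      from that obtain a a' where a: "y \<in> carrier R" "y' \<in> carrier R" "a \<in> p" "a' \<in> p"
        "v \<otimes> y = u \<otimes> a" "v \<otimes> y' = u \<otimes> a'" by (auto simp: Q_def)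
      then have "v \<otimes> (y \<oplus> y') = u \<otimes> (a \<oplus> a')"
        using u v by (simp add: r_distr p.Icarr)
      with a show ?thesis by (auto simp: Q_def p.a_closed)
    qed
    show "c \<otimes> y \<in> Q" if "c \<in> carrier R" "y \<in> Q" for c y
    proof -
      from that obtain a where a: "y \<in> carrier R" "a \<in> p" "v \<otimes> y = u \<otimes> a" by (auto simp: Q_def)
      have "v \<otimes> (c \<otimes> y) = c \<otimes> (v \<otimes> y)" using a v that by (simp add: m_lcomm)
      also have "\<dots> = u \<otimes> (c \<otimes> a)" unfolding a(3) using a that u by (simp add: m_lcomm p.Icarr)
      finally show ?thesis using a that p.I_l_closed by (auto simp: Q_def)
    qed
  qed (auto simp: Q_def)
  interpret Q: ideal_elements R Q by (rule ideal_elementsI, rule Q)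
  have "Q \<subseteq> p"
  proof (rule ccontr)
    assume "\<not> Q \<subseteq> p"
    then obtain c where c: "c \<in> Q" "c \<notin> p" by auto
    have "c = \<zero> \<oplus> c" using c by (simp add: Q.Icarr)
    then have "c \<in> p <+>\<^bsub>R\<^esub> Q" using c p.zero_closed unfolding set_add_def' by blast
    moreover have "p \<subseteq> p <+>\<^bsub>R\<^esub> Q"
    proof
      fix b assume "b \<in> p"
      then have "b = b \<oplus> \<zero>" by (simp add: p.Icarr)
      then show "b \<in> p <+>\<^bsub>R\<^esub> Q" using \<open>b \<in> p\<close> Q.zero_closed unfolding set_add_def' by blast
    qed
    ultimately have "\<one> \<in> p <+>\<^bsub>R\<^esub> Q"
      using c(2) by (intro p_maximal add_ideals p_ideal Q) auto
    then obtain a b where ab: "a \<in> p" "b \<in> Q" "\<one> = a \<oplus> b"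
      by (auto simp: set_add_def')
    from CollectD[OF ab(2)[unfolded Q_def]]
    obtain a' where a': "a' \<in> p" "v \<otimes> b = u \<otimes> a'" "b \<in> carrier R" by blast
    \<comment> \<open>R + R q multiplied by the denominator \<open>v\<close>; the equation to reach
      is p J = (v).\<close>
    let ?J = "PIdl u <+>\<^bsub>R\<^esub> PIdl v"
    have J: "ideal ?J R" by (intro add_ideals cgenideal_ideal u v)
    interpret pJ: ideal_elements R "p \<cdot> ?J" by (rule ideal_elementsI, rule ideal_prod_is_ideal[OF p_ideal J])
    interpret V: ideal_elements R "PIdl v" by (rule ideal_elementsI, rule cgenideal_ideal[OF v(1)])
    interpret U: ideal_elements R "PIdl u" by (rule ideal_elementsI, rule cgenideal_ideal[OF u])
    have "p \<cdot> ?J \<subseteq> PIdl v"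
    proof
      fix z assume "z \<in> p \<cdot> ?J"
      then show "z \<in> PIdl v"
      proof (induction z rule: ideal_prod.induct)
        case (prod i j)
        then obtain r s where rs: "r \<in> carrier R" "s \<in> carrier R" "j = r \<otimes> u \<oplus> s \<otimes> v"
          by (auto simp: set_add_def' mem_PIdl_iff)
        then have "i \<otimes> j = r \<otimes> (u \<otimes> i) \<oplus> (i \<otimes> s) \<otimes> v"
          using prod(1) u v by (simp add: r_distr m_ac p.Icarr)
        moreover have "r \<otimes> (u \<otimes> i) \<in> PIdl v" by (intro V.I_l_closed uv prod(1) rs(1))
        moreover have "(i \<otimes> s) \<otimes> v \<in> PIdl v"
          using prod(1) rs(2) by (auto simp: mem_PIdl_iff p.Icarr)
        ultimately show ?case by (simp add: V.a_closed)
      qed (rule V.a_closed)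
    qed
    moreover have "v \<in> p \<cdot> ?J"
    proof -
      have "u = u \<oplus> \<zero>" "v = \<zero> \<oplus> v"
        using u v by simp_all
      then have uJ: "u \<in> ?J" and vJ: "v \<in> ?J"
        using cgenideal_self[OF u] cgenideal_self[OF v(1)] U.zero_closed V.zero_closed
        unfolding set_add_def' by blast+
      have "v = v \<otimes> (a \<oplus> b)" using v by (simp flip: ab(3))
      also have "\<dots> = a \<otimes> v \<oplus> a' \<otimes> u"
        using v u ab(1) a' by (simp add: r_distr p.Icarr m_comm)
      finally show ?thesis
        using ideal_prod.prod[OF ab(1) vJ, of R] ideal_prod.prod[OF a'(1) uJ, of R] pJ.a_closed by metis
    qed
    then have "PIdl v \<subseteq> p \<cdot> ?J" by (rule cgenideal_minimal[OF pJ.is_ideal])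
    ultimately show False using noninvertibleI[OF J v] by blast
  qed
  moreover obtain y where y: "y \<in> carrier R" "u \<otimes> x = y \<otimes> v"
    using uv[OF x] by (auto simp: mem_PIdl_iff)
  then have eq: "v \<otimes> y = u \<otimes> x" using v(1) by (simp only: m_comm)
  have "y \<in> Q" unfolding Q_def using y(1) x eq by blast
  ultimately show ?thesis using eq by (metis subsetD)
qed

text \<open>Nakayama's lemma makes p p a proper part of p, so some N is maximal among the proper
  subideals of p containing p p. Then p/N is generated by any \<open>x\<^sub>0\<close> outside N,
  and p kills it. The annihilator of this generator is therefore p, by maximality of p. The last two
  properties together say that r -> r x0 induces an isomorphism from R/p to p/N.\<close>

lemma exists_simple_quotient:
  obtains N x\<^sub>0 where "ideal N R" "p \<cdot> p \<subseteq> N" "N \<subseteq> p" "x\<^sub>0 \<in> p" "x\<^sub>0 \<notin> N"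
    "\<And>x. x \<in> p \<Longrightarrow> \<exists>r\<in>carrier R. x \<ominus> r \<otimes> x\<^sub>0 \<in> N"
    "\<And>r. r \<in> carrier R \<Longrightarrow> r \<otimes> x\<^sub>0 \<in> N \<longleftrightarrow> r \<in> p"
proof -
  let ?F = "{N. ideal N R \<and> p \<cdot> p \<subseteq> N \<and> N \<subseteq> p \<and> N \<noteq> p}"
  have "p \<cdot> p \<in> ?F"
    using not_subset_prod[OF p_ideal one_notin_p] ideal_prod_inter[OF p_ideal p_ideal]
      ideal_prod_is_ideal[OF p_ideal p_ideal] by auto
  then obtain N where N: "N \<in> ?F" "\<And>I. I \<in> ?F \<Longrightarrow> N \<subseteq> I \<Longrightarrow> I = N"
    using maximal_ideal_in_family[of ?F] by blast
  interpret N: ideal_elements R N by (rule ideal_elementsI) (use N(1) in auto)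
  obtain x\<^sub>0 where x\<^sub>0: "x\<^sub>0 \<in> p" "x\<^sub>0 \<notin> N" using N(1) by auto
  note x\<^sub>0c = p.Icarr[OF x\<^sub>0(1)]
  let ?N = "N <+>\<^bsub>R\<^esub> PIdl x\<^sub>0"
  interpret X: ideal_elements R "PIdl x\<^sub>0" by (rule ideal_elementsI, rule cgenideal_ideal[OF x\<^sub>0c])
  have sub: "N \<subseteq> ?N"
  proof
    fix b assume "b \<in> N"
    then have "b = b \<oplus> \<zero>" by (simp add: N.Icarr)
    then show "b \<in> ?N" using \<open>b \<in> N\<close> X.zero_closed unfolding set_add_def' by blast
  qed
  have "x\<^sub>0 = \<zero> \<oplus> x\<^sub>0" using x\<^sub>0c by simp
  then have "x\<^sub>0 \<in> ?N"
    using N.zero_closed cgenideal_self[OF x\<^sub>0c] unfolding set_add_def' by blast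
  moreover have "?N \<subseteq> p"
    using N(1) x\<^sub>0 by (auto simp: set_add_def' mem_PIdl_iff intro!: p.a_closed p.I_l_closed)
  ultimately have p_eq: "?N = p"
    using N(1) N(2)[of ?N] sub x\<^sub>0(2) add_ideals[OF N.is_ideal X.is_ideal] by blast
  have gen: "\<exists>r\<in>carrier R. x \<ominus> r \<otimes> x\<^sub>0 \<in> N" if x: "x \<in> p" for x
  proof -
    obtain n r where nr: "n \<in> N" "r \<in> carrier R" "x = n \<oplus> r \<otimes> x\<^sub>0"
      using x unfolding p_eq[symmetric] by (auto simp: set_add_def' mem_PIdl_iff)
    then have "x \<ominus> r \<otimes> x\<^sub>0 = n"
      using x\<^sub>0c by (simp add: N.Icarr minus_eq a_assoc r_neg)
    with nr(1,2) show ?thesis by metis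
  qed
  let ?A = "{r \<in> carrier R. r \<otimes> x\<^sub>0 \<in> N}"
  have "ideal ?A R"
    using x\<^sub>0c by (intro idealI_cring) (auto simp: l_distr m_assoc N.a_closed N.zero_closed N.I_l_closed)
  moreover have pA: "p \<subseteq> ?A"
    using N(1) x\<^sub>0(1) by (auto simp: p.Icarr intro: ideal_prod.prod)
  moreover have "\<one> \<notin> ?A" using x\<^sub>0(2) x\<^sub>0c by simp
  ultimately have "?A = p" using p_maximal by blast
  then have "r \<otimes> x\<^sub>0 \<in> N \<longleftrightarrow> r \<in> p" if "r \<in> carrier R" for r
    using that by auto
  with N(1) x\<^sub>0 gen show ?thesis by (intro that[of N x\<^sub>0]) auto
qed

end

section \<open>Vanishing of Ext and splitting of extensions\<close>

lemma (in abelian_group) eq_if_minus_eq_zero: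
  assumes "x \<ominus> y = \<zero>" "x \<in> carrier G" "y \<in> carrier G"
  shows "x = y"
  using assms minus_equality[of x "\<ominus> y"] by (simp add: minus_eq)

text \<open>Every cocycle is a coboundary. The right-hand side drops extensionality, so that
  cochains can be given by plain terms; restriction to the carrier is confined to this
  proof.\<close>

lemma trivial_Ext_iff:
  assumes B: "module R B" and PS: "module R (P (Suc i))" "module R (P i)" "module R (P (Suc (Suc i)))"
    and d: "\<And>i. d i \<in> mod_hom R (P (Suc i)) (P i)"
    and dd: "\<And>x. x \<in> carrier (P (Suc (Suc i))) \<Longrightarrow> d i (d (Suc i) x) = \<zero>\<^bsub>P i\<^esub>"
  shows "trivial_group (Ext_group R P d B (Suc i)) \<longleftrightarrow>
    (\<forall>f\<in>mod_hom R (P (Suc i)) B. (\<forall>x\<in>carrier (P (Suc (Suc i))). f (d (Suc i) x) = \<zero>\<^bsub>B\<^esub>) \<longrightarrow>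
      (\<exists>g\<in>mod_hom R (P i) B. \<forall>x\<in>carrier (P (Suc i)). f x = g (d i x)))"
    (is "?L \<longleftrightarrow> ?R")
proof -
  interpret B: module R B by fact
  let ?Z = "cocycles R P d B (Suc i)" and ?D = "coboundaries R P d B (Suc i)"
  let ?H = "(Hom_group R (P (Suc i)) B)\<lparr>carrier := ?Z\<rparr>"
  have restr: "restrict f (carrier (P k)) \<in> mod_hom R (P k) B" if "f \<in> mod_hom R (P k) B" "module R (P k)" for f k
    using that(1) mod_hom_cong[OF that(2), of "restrict f (carrier (P k))" f] by auto
  have Z: "f \<in> ?Z \<longleftrightarrow> f \<in> mod_hom R (P (Suc i)) B \<and> f \<in> extensional (carrier (P (Suc i))) \<and>
      (\<forall>x\<in>carrier (P (Suc (Suc i))). f (d (Suc i) x) = \<zero>\<^bsub>B\<^esub>)" for f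
    by (auto simp: cocycles_def kernel_def Hom_group_def coboundary_def compose_def fun_eq_iff restrict_def)
  have D: "f \<in> ?D \<longleftrightarrow> (\<exists>g\<in>mod_hom R (P i) B. f = (\<lambda>x\<in>carrier (P (Suc i)). g (d i x)))" for f
  proof
    assume "f \<in> ?D"
    then show "\<exists>g\<in>mod_hom R (P i) B. f = (\<lambda>x\<in>carrier (P (Suc i)). g (d i x))"
      by (auto simp: Hom_group_def coboundary_def compose_def)
  next
    assume "\<exists>g\<in>mod_hom R (P i) B. f = (\<lambda>x\<in>carrier (P (Suc i)). g (d i x))"
    then obtain g where g: "g \<in> mod_hom R (P i) B" "f = (\<lambda>x\<in>carrier (P (Suc i)). g (d i x))" by blast
    have "f = coboundary P d i (restrict g (carrier (P i)))"
      using mod_hom_closed[OF d[of i]] by (auto simp: g(2) coboundary_def compose_def)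
    with restr[OF g(1) PS(2)] show "f \<in> ?D"
      by (auto simp: Hom_group_def)
  qed
  have DZ: "?D \<subseteq> ?Z"
  proof
    fix f assume "f \<in> ?D"
    then obtain g where g: "g \<in> mod_hom R (P i) B" "f = (\<lambda>x\<in>carrier (P (Suc i)). g (d i x))"
      using D by blast
    have "f \<in> mod_hom R (P (Suc i)) B"
      unfolding g(2) by (rule restr[OF mod_hom_compose[OF d g(1)] PS(1)])
    then show "f \<in> ?Z"
      using mod_hom_closed[OF d[of "Suc i"]] mod_hom_zero[OF PS(2) B g(1)] by (auto simp: Z g(2) dd)
  qed
  have one: "\<one>\<^bsub>?H\<^esub> = (\<lambda>x\<in>carrier (P (Suc i)). \<zero>\<^bsub>B\<^esub>)" by (simp add: Hom_group_def)
  have mult: "f \<otimes>\<^bsub>?H\<^esub> g = (\<lambda>x\<in>carrier (P (Suc i)). f x \<oplus>\<^bsub>B\<^esub> g x)" for f g by (simp add: Hom_group_def)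
  have zD: "\<one>\<^bsub>?H\<^esub> \<in> ?D"
    unfolding one D by (intro bexI[OF _ mod_hom_const_zero[OF B]]) simp
  have rc: "rcosets\<^bsub>?H\<^esub> ?D = (\<lambda>a. (\<lambda>h. h \<otimes>\<^bsub>?H\<^esub> a) ` ?D) ` ?Z"
    by (auto simp: RCOSETS_def r_coset_def)
  have l_one: "\<one>\<^bsub>?H\<^esub> \<otimes>\<^bsub>?H\<^esub> a = a" if "a \<in> ?Z" for a
    using that mod_hom_closed[of a R "P (Suc i)" B] unfolding mult one Z
    by (auto simp: fun_eq_iff extensional_def)
  have "trivial_group (Ext_group R P d B (Suc i)) \<longleftrightarrow> ?Z \<subseteq> ?D"
  proof
    assume "trivial_group (Ext_group R P d B (Suc i))"
    then have *: "rcosets\<^bsub>?H\<^esub> ?D = {?D}"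
      by (simp add: trivial_group_def Ext_group_def FactGroup_def)
    show "?Z \<subseteq> ?D"
    proof
      fix a assume a: "a \<in> ?Z"
      then have "(\<lambda>h. h \<otimes>\<^bsub>?H\<^esub> a) ` ?D \<in> {?D}"
        unfolding *[symmetric] rc by (rule imageI)
      then have "(\<lambda>h. h \<otimes>\<^bsub>?H\<^esub> a) ` ?D = ?D" by (rule singletonD)
      \<comment> \<open>The coset of \<open>a\<close> contains \<open>a\<close> itself and must
        equal the only coset.\<close>
      then show "a \<in> ?D" using zD l_one[OF a] by force
    qed
  next
    \<comment> \<open>Triviality also includes the group axioms of the quotient, so its single coset
      must be shown to multiply to itself.\<close>
    assume "?Z \<subseteq> ?D"
    with DZ have eq: "?D = ?Z" by blast
    have cl: "f \<otimes>\<^bsub>?H\<^esub> g \<in> ?D" if "f \<in> ?D" "g \<in> ?D" for f g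
    proof -
      from that obtain f' g' where f': "f' \<in> mod_hom R (P i) B" "f = (\<lambda>x\<in>carrier (P (Suc i)). f' (d i x))"
        and g': "g' \<in> mod_hom R (P i) B" "g = (\<lambda>x\<in>carrier (P (Suc i)). g' (d i x))"
        unfolding D by blast
      show ?thesis
        unfolding D mult using f'(2) g'(2)
        by (intro bexI[OF _ mod_hom_plus[OF PS(2) B f'(1) g'(1)]]) auto
    qed
    have shift: "(\<lambda>h. h \<otimes>\<^bsub>?H\<^esub> a) ` ?D = ?D" if a: "a \<in> ?D" for a
    proof
      show "(\<lambda>h. h \<otimes>\<^bsub>?H\<^esub> a) ` ?D \<subseteq> ?D" using cl a by blast
      show "?D \<subseteq> (\<lambda>h. h \<otimes>\<^bsub>?H\<^esub> a) ` ?D"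
      proof
        fix b assume b: "b \<in> ?D"
        from a b obtain a' b' where a': "a' \<in> mod_hom R (P i) B" "a = (\<lambda>x\<in>carrier (P (Suc i)). a' (d i x))"
          and b': "b' \<in> mod_hom R (P i) B" "b = (\<lambda>x\<in>carrier (P (Suc i)). b' (d i x))"
          unfolding D by blast
        let ?c = "\<lambda>x\<in>carrier (P (Suc i)). b' (d i x) \<ominus>\<^bsub>B\<^esub> a' (d i x)"
        have "?c \<in> ?D"
          unfolding D by (intro bexI[OF _ mod_hom_diff[OF PS(2) B b'(1) a'(1)]]) auto
        moreover have "?c \<otimes>\<^bsub>?H\<^esub> a = b"
          unfolding mult a'(2) b'(2)
          using mod_hom_closed[OF a'(1) mod_hom_closed[OF d]] mod_hom_closed[OF b'(1) mod_hom_closed[OF d]]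
          by (auto simp: fun_eq_iff B.minus_eq B.a_assoc B.l_neg)
        ultimately show "b \<in> (\<lambda>h. h \<otimes>\<^bsub>?H\<^esub> a) ` ?D" by blast
      qed
    qed
    have carr: "rcosets\<^bsub>?H\<^esub> ?D = {?D}"
    proof -
      have "rcosets\<^bsub>?H\<^esub> ?D = (\<lambda>a. ?D) ` ?Z"
        unfolding rc by (rule image_cong[OF refl], rule shift, simp only: eq)
      then show ?thesis using zD eq by blast
    qed
    have "?D <#>\<^bsub>?H\<^esub> ?D = ?D"
    proof -
      have "?D <#>\<^bsub>?H\<^esub> ?D = (\<Union>a\<in>?D. (\<lambda>h. h \<otimes>\<^bsub>?H\<^esub> a) ` ?D)"
        unfolding set_mult_def by blast
      also have "\<dots> = (\<Union>a\<in>?D. ?D)" by (rule SUP_cong) (simp_all only: shift)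
      finally show ?thesis using zD by blast
    qed
    then have "group (?H Mod ?D)"
      by (intro groupI) (simp_all add: FactGroup_def carr del: coboundaries.simps)
    then show "trivial_group (Ext_group R P d B (Suc i))"
      by (simp add: trivial_group_def Ext_group_def carr FactGroup_def del: coboundaries.simps)
  qed
  also have "\<dots> \<longleftrightarrow> ?R"
  proof
    assume ZD: "?Z \<subseteq> ?D"
    show ?R
    proof (intro ballI impI)
      fix f assume f: "f \<in> mod_hom R (P (Suc i)) B" "\<forall>x\<in>carrier (P (Suc (Suc i))). f (d (Suc i) x) = \<zero>\<^bsub>B\<^esub>"
      have "restrict f (carrier (P (Suc i))) \<in> ?Z"
        unfolding Z using f restr[OF f(1) PS(1)] mod_hom_closed[OF d[of "Suc i"]] by auto
      with ZD obtain g where g: "g \<in> mod_hom R (P i) B"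
        "restrict f (carrier (P (Suc i))) = (\<lambda>x\<in>carrier (P (Suc i)). g (d i x))"
        using D by blast
      have "f x = g (d i x)" if "x \<in> carrier (P (Suc i))" for x
        using fun_cong[OF g(2), of x] that by simp
      with g(1) show "\<exists>g\<in>mod_hom R (P i) B. \<forall>x\<in>carrier (P (Suc i)). f x = g (d i x)" by blast
    qed
  next
    assume R: ?R
    show "?Z \<subseteq> ?D"
    proof
      fix f assume f: "f \<in> ?Z"
      then obtain g where "g \<in> mod_hom R (P i) B" "\<forall>x\<in>carrier (P (Suc i)). f x = g (d i x)"
        using R unfolding Z by blast
      moreover from this f have "f = (\<lambda>x\<in>carrier (P (Suc i)). g (d i x))"
        unfolding Z by (auto simp: extensional_def fun_eq_iff)
      ultimately show "f \<in> ?D" unfolding D by blast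
    qed
  qed
  finally show ?thesis .
qed

lemma projective_resolutionD:
  assumes "projective_resolution U R P d e A"
  shows "module R A" "\<And>i. module R (P i)" "\<And>i. projective_module U R (P i)"
    "\<And>i. d i \<in> mod_hom R (P (Suc i)) (P i)" "e \<in> mod_hom R (P 0) A" "e ` carrier (P 0) = carrier A"
    "d 0 ` carrier (P (Suc 0)) = a_kernel (P 0) A e"
    "\<And>i. d (Suc i) ` carrier (P (Suc (Suc i))) = a_kernel (P (Suc i)) (P i) (d i)"
  using assms by (auto simp: projective_resolution_def projective_module_def)

lemma projective_resolution_dd:
  assumes "projective_resolution U R P d e A"
  shows "x \<in> carrier (P (Suc 0)) \<Longrightarrow> e (d 0 x) = \<zero>\<^bsub>A\<^esub>"
    and "x \<in> carrier (P (Suc (Suc i))) \<Longrightarrow> d i (d (Suc i) x) = \<zero>\<^bsub>P i\<^esub>"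
  using imageI[of x "carrier (P (Suc 0))" "d 0"] imageI[of x "carrier (P (Suc (Suc i)))" "d (Suc i)"]
  unfolding projective_resolutionD(7,8)[OF assms] by (simp_all add: a_kernel_iff)

text \<open>If \<open>\<lambda> : P 0 \<rightarrow> E\<close> lifts the augmentation, then \<open>\<lambda> \<circ> d 0\<close> is a cocycle with values in the kernel
  \<open>B\<close> of \<open>E \<rightarrow> A\<close>; correcting \<open>\<lambda>\<close> by a cochain with that coboundary gives a map that descends to \<open>A\<close>.\<close>

lemma Ext_vanishes_splits:
  fixes E :: "('a, 'e, 'p) module_scheme" and \<iota> :: "'e \<Rightarrow> 'u"
    and A :: "('a, 'b, 'q) module_scheme" and B :: "('a, 'c, 'r) module_scheme"
  assumes ext: "Ext_vanishes TYPE('u) R 1 A B" and pd: "pd_le TYPE('u) R A n"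
    and ses: "short_exact R B \<beta> E \<pi> A" and \<iota>: "inj_on \<iota> (carrier E)"
  shows "\<exists>s\<in>mod_hom R A E. \<forall>x\<in>carrier A. \<pi> (s x) = x"
proof -
  \<comment> \<open>Vanishing of Ext quantifies over all resolutions; the bound on projective
    dimension provides one to apply it to.\<close>
  obtain P :: "nat \<Rightarrow> ('a, 'u) module" and d e where res: "projective_resolution TYPE('u) R P d e A"
    using pd by (auto simp: pd_le_def)
  note P = projective_resolutionD[OF res] and dd = projective_resolution_dd[OF res]
  from ses have B: "module R B" and E: "module R E" and \<beta>: "\<beta> \<in> mod_hom R B E" and \<pi>: "\<pi> \<in> mod_hom R E A"
    and inj: "inj_on \<beta> (carrier B)" and ker: "\<beta> ` carrier B = a_kernel E A \<pi>" and surj: "\<pi> ` carrier E = carrier A"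
    by (auto simp: short_exact_def)
  interpret A: module R A by (rule P)
  interpret E: module R E by (rule E)
  interpret B: module R B by (rule B)
  interpret P0: module R "P 0" by (rule P)
  obtain l where l: "l \<in> mod_hom R (P 0) E" "\<And>x. x \<in> carrier (P 0) \<Longrightarrow> \<pi> (l x) = e x"
    using projective_module_lifts[OF P(3)[of 0] E P(1) \<pi> surj \<iota>] P(5) unfolding lifts_along_def by blast
  let ?f = "\<lambda>x. inv_into (carrier B) \<beta> (l (d 0 x))"
  have lker: "l (d 0 x) \<in> \<beta> ` carrier B" if "x \<in> carrier (P (Suc 0))" for x
    using that dd(1)[of x] mod_hom_closed[OF P(4)[of 0]] mod_hom_closed[OF l(1)]
    by (simp add: ker a_kernel_iff l(2))
  then have f: "?f x \<in> carrier B" "\<beta> (?f x) = l (d 0 x)" if "x \<in> carrier (P (Suc 0))" for x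
    using that by (simp_all add: inv_into_into f_inv_into_f)
  interpret P1: module R "P (Suc 0)" by (rule P)
  have f_hom: "?f \<in> mod_hom R (P (Suc 0)) B"
  proof (rule mod_homI)
    show "?f x \<in> carrier B" if "x \<in> carrier (P (Suc 0))" for x using f that by simp
    show "?f (x \<oplus>\<^bsub>P (Suc 0)\<^esub> y) = ?f x \<oplus>\<^bsub>B\<^esub> ?f y" if "x \<in> carrier (P (Suc 0))" "y \<in> carrier (P (Suc 0))" for x y
      using that f[of x] f[of y] f[of "x \<oplus>\<^bsub>P (Suc 0)\<^esub> y"] mod_hom_closed[OF P(4)[of 0]]
      by (intro inj_onD[OF inj])
        (auto simp: mod_hom_add[OF \<beta>] mod_hom_add[OF P(4)[of 0]] mod_hom_add[OF l(1)])
    show "?f (a \<odot>\<^bsub>P (Suc 0)\<^esub> x) = a \<odot>\<^bsub>B\<^esub> ?f x" if "a \<in> carrier R" "x \<in> carrier (P (Suc 0))" for a x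
      using that f[of x] f[of "a \<odot>\<^bsub>P (Suc 0)\<^esub> x"] mod_hom_closed[OF P(4)[of 0]]
      by (intro inj_onD[OF inj])
        (auto simp: mod_hom_smult[OF \<beta>] mod_hom_smult[OF P(4)[of 0]] mod_hom_smult[OF l(1)])
  qed
  have f_cocycle: "?f (d (Suc 0) x) = \<zero>\<^bsub>B\<^esub>" if "x \<in> carrier (P (Suc (Suc 0)))" for x
  proof -
    have "d (Suc 0) x \<in> carrier (P (Suc 0))" using that mod_hom_closed[OF P(4)[of "Suc 0"], of x] by simp
    moreover have "l (d 0 (d (Suc 0) x)) = \<zero>\<^bsub>E\<^esub>"
      using that dd(2)[of x 0] mod_hom_zero[OF P(2) E l(1)] by simp
    ultimately show ?thesis
      using f[of "d (Suc 0) x"] mod_hom_zero[OF B E \<beta>] by (intro inj_onD[OF inj]) auto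
  qed
  have "trivial_group (Ext_group R P d B (Suc 0))"
    using ext res by (auto simp: Ext_vanishes_def)
  then obtain g where g: "g \<in> mod_hom R (P 0) B" "\<And>x. x \<in> carrier (P (Suc 0)) \<Longrightarrow> ?f x = g (d 0 x)"
    using trivial_Ext_iff[where P = P and d = d and i = 0, OF B P(2,2,2,4) dd(2)] f_hom f_cocycle
    by auto
  let ?l = "\<lambda>x. l x \<ominus>\<^bsub>E\<^esub> \<beta> (g x)"
  have l': "?l \<in> mod_hom R (P 0) E"
    by (rule mod_hom_diff[OF P(2) E l(1) mod_hom_compose[OF g(1) \<beta>]])
  have l'0: "?l x = \<zero>\<^bsub>E\<^esub>" if "x \<in> carrier (P 0)" "e x = \<zero>\<^bsub>A\<^esub>" for x
  proof -
    from that P(7) obtain y where y: "y \<in> carrier (P (Suc 0))" "x = d 0 y" by (auto simp: a_kernel_iff set_eq_iff image_iff)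
    have "\<beta> (g x) = l x"
      using f(2)[OF y(1)] g(2)[OF y(1)] y(2) by simp
    then show ?thesis using mod_hom_closed[OF l(1) that(1)] by (simp add: E.minus_eq E.r_neg)
  qed
  have l'_eq: "?l x = ?l y" if "x \<in> carrier (P 0)" "y \<in> carrier (P 0)" "e x = e y" for x y
  proof -
    have "e (x \<ominus>\<^bsub>P 0\<^esub> y) = \<zero>\<^bsub>A\<^esub>"
      using that mod_hom_closed[OF P(5)] by (simp add: mod_hom_minus[OF P(2) P(1) P(5)] A.minus_eq A.r_neg)
    then have "?l (x \<ominus>\<^bsub>P 0\<^esub> y) = \<zero>\<^bsub>E\<^esub>" using that by (intro l'0) auto
    then have "?l x \<ominus>\<^bsub>E\<^esub> ?l y = \<zero>\<^bsub>E\<^esub>" unfolding mod_hom_minus[OF P(2) E l' that(1,2)] .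
    then show ?thesis
      by (rule E.eq_if_minus_eq_zero) (use that mod_hom_closed[OF l'] in auto)
  qed
  have \<pi>l': "\<pi> (?l x) = e x" if "x \<in> carrier (P 0)" for x
  proof -
    have "\<beta> (g x) \<in> a_kernel E A \<pi>" using ker mod_hom_closed[OF g(1) that] by blast
    then have "\<pi> (\<beta> (g x)) = \<zero>\<^bsub>A\<^esub>" "\<beta> (g x) \<in> carrier E" by (simp_all add: a_kernel_iff)
    then show ?thesis
      using that mod_hom_closed[OF l(1)] mod_hom_closed[OF P(5)]
      by (simp add: mod_hom_minus[OF E P(1) \<pi>] l(2) A.minus_eq)
  qed
  \<comment> \<open>The corrected map takes equal values on any two preimages, so the choice made by
    \<open>inv_into\<close> does not affect linearity.\<close>
  let ?s = "\<lambda>x. ?l (inv_into (carrier (P 0)) e x)"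
  have r: "inv_into (carrier (P 0)) e x \<in> carrier (P 0)" "e (inv_into (carrier (P 0)) e x) = x"
    if "x \<in> carrier A" for x
    using that by (simp_all add: P(6)[symmetric] inv_into_into f_inv_into_f)
  have s_e: "?s (e x) = ?l x" if "x \<in> carrier (P 0)" for x
    using that mod_hom_closed[OF P(5)] by (intro l'_eq r) auto
  have "?s \<in> mod_hom R A E"
  proof (rule mod_homI)
    show "?s x \<in> carrier E" if "x \<in> carrier A" for x
      using mod_hom_closed[OF l' r(1)[OF that]] .
    show "?s (x \<oplus>\<^bsub>A\<^esub> y) = ?s x \<oplus>\<^bsub>E\<^esub> ?s y" if "x \<in> carrier A" "y \<in> carrier A" for x y
      using s_e[of "inv_into (carrier (P 0)) e x \<oplus>\<^bsub>P 0\<^esub> inv_into (carrier (P 0)) e y"] r that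
      by (simp only: mod_hom_add[OF l'] mod_hom_add[OF P(5)] P0.a_closed)
    show "?s (a \<odot>\<^bsub>A\<^esub> x) = a \<odot>\<^bsub>E\<^esub> ?s x" if "a \<in> carrier R" "x \<in> carrier A" for a x
      using s_e[of "a \<odot>\<^bsub>P 0\<^esub> inv_into (carrier (P 0)) e x"] r that
      by (simp only: mod_hom_smult[OF l'] mod_hom_smult[OF P(5)] P0.smult_closed)
  qed
  then show ?thesis
    using \<pi>l' r by (intro bexI[of _ ?s]) auto
qed

section \<open>Tilting ideals of a noetherian domain\<close>

text \<open>The ambient module R x R in which the pullback of R -> R/p along p -> p/N is cut out as
  a submodule.\<close>

definition square_module :: "('a, 'm) ring_scheme \<Rightarrow> ('a, 'a \<times> 'a) module"
  where "square_module R =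
    \<lparr>carrier = carrier R \<times> carrier R,
     monoid.mult = (\<lambda>_ _. (\<zero>\<^bsub>R\<^esub>, \<zero>\<^bsub>R\<^esub>)),
     one = (\<zero>\<^bsub>R\<^esub>, \<zero>\<^bsub>R\<^esub>),
     ring.zero = (\<zero>\<^bsub>R\<^esub>, \<zero>\<^bsub>R\<^esub>),
     ring.add = (\<lambda>x y. (fst x \<oplus>\<^bsub>R\<^esub> fst y, snd x \<oplus>\<^bsub>R\<^esub> snd y)),
     smult = (\<lambda>a x. (a \<otimes>\<^bsub>R\<^esub> fst x, a \<otimes>\<^bsub>R\<^esub> snd x))\<rparr>"

lemma square_module_simps [simp]:
  "carrier (square_module R) = carrier R \<times> carrier R"
  "\<zero>\<^bsub>square_module R\<^esub> = (\<zero>\<^bsub>R\<^esub>, \<zero>\<^bsub>R\<^esub>)"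
  "x \<oplus>\<^bsub>square_module R\<^esub> y = (fst x \<oplus>\<^bsub>R\<^esub> fst y, snd x \<oplus>\<^bsub>R\<^esub> snd y)"
  "a \<odot>\<^bsub>square_module R\<^esub> x = (a \<otimes>\<^bsub>R\<^esub> fst x, a \<otimes>\<^bsub>R\<^esub> snd x)"
  by (simp_all add: square_module_def)

lemma module_square:
  assumes "cring R"
  shows "module R (square_module R)"
proof -
  interpret cring R by fact
  show ?thesis
  proof (rule moduleI)
    show "abelian_group (square_module R)"
    proof (rule abelian_groupI)
      fix x assume "x \<in> carrier (square_module R)"
      then show "\<exists>y\<in>carrier (square_module R). y \<oplus>\<^bsub>square_module R\<^esub> x = \<zero>\<^bsub>square_module R\<^esub>"
        by (intro bexI[of _ "(\<ominus>\<^bsub>R\<^esub> fst x, \<ominus>\<^bsub>R\<^esub> snd x)"]) (auto simp: l_neg)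
    qed (auto simp: a_ac)
  qed (auto simp: l_distr r_distr m_assoc cring_axioms)
qed

context maximal_noninvertible
begin

text \<open>The elements \<open>(x, r)\<close> with \<open>x \<equiv> r x\<^sub>0\<close> modulo \<open>N\<close> form an extension of \<open>p\<close> by \<open>p\<close>. A section
  would be \<open>x \<mapsto> (x, q x)\<close> with \<open>q\<close> in the inverse of \<open>p\<close>; then \<open>q x \<in> p\<close>, so that \<open>x \<in> N\<close> for all \<open>x \<in> p\<close>.\<close>

lemma not_rigid:
  fixes j :: "'a \<Rightarrow> 'u"
  assumes u: "infinite (UNIV :: 'u set)" and j: "inj_on j (carrier R)"
    and pd: "pd_le TYPE('u) R (ideal_module R p) n"
    and ext: "Ext_vanishes TYPE('u) R 1 (ideal_module R p) (direct_sum {k :: 'k} (\<lambda>_. ideal_module R p))"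
  shows False
proof -
  obtain N x\<^sub>0 where N: "ideal N R" "p \<cdot> p \<subseteq> N" "N \<subseteq> p" and x\<^sub>0: "x\<^sub>0 \<in> p" "x\<^sub>0 \<notin> N"
    and gen: "\<And>x. x \<in> p \<Longrightarrow> \<exists>r\<in>carrier R. x \<ominus> r \<otimes> x\<^sub>0 \<in> N"
    and ann: "\<And>r. r \<in> carrier R \<Longrightarrow> r \<otimes> x\<^sub>0 \<in> N \<longleftrightarrow> r \<in> p"
    using exists_simple_quotient by metis
  interpret N: ideal_elements R N by (rule ideal_elementsI, rule N(1))
  note x\<^sub>0c = p.Icarr[OF x\<^sub>0(1)]
  let ?A = "ideal_module R p" and ?B = "direct_sum {k} (\<lambda>_. ideal_module R p)"
  let ?S = "square_module R"
  let ?E = "{(x, r). x \<in> p \<and> r \<in> carrier R \<and> x \<ominus> r \<otimes> x\<^sub>0 \<in> N}"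
  let ?EM = "?S\<lparr>carrier := ?E\<rparr>"
  \<comment> \<open>A direct sum over one index is a copy of p, read off at coordinate
    \<open>k\<close>.\<close>
  let ?\<beta> = "\<lambda>y. (\<zero>, y k)"
  have A: "module R ?A" by (rule module_ideal[OF cring_axioms p_ideal])
  have B: "module R ?B" by (rule module_direct_sum[OF cring_axioms A])
  interpret S: module R ?S by (rule module_square[OF cring_axioms])
  have "submodule ?E R ?S"
  proof (rule S.submoduleI)
    show "?E \<subseteq> carrier ?S" by (auto simp: p.Icarr)
    show "\<zero>\<^bsub>?S\<^esub> \<in> ?E" using x\<^sub>0c p.zero_closed N.zero_closed by (simp add: minus_eq)
  next
    fix z w assume "z \<in> ?E" "w \<in> ?E"
    then obtain x r y s where zw: "z = (x, r)" "w = (y, s)" "x \<in> p" "r \<in> carrier R" "x \<ominus> r \<otimes> x\<^sub>0 \<in> N"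
      "y \<in> p" "s \<in> carrier R" "y \<ominus> s \<otimes> x\<^sub>0 \<in> N" by auto
    moreover have "x \<oplus> y \<ominus> (r \<oplus> s) \<otimes> x\<^sub>0 = (x \<ominus> r \<otimes> x\<^sub>0) \<oplus> (y \<ominus> s \<otimes> x\<^sub>0)"
      using zw x\<^sub>0c by (simp add: p.Icarr l_distr minus_eq minus_add a_ac)
    ultimately show "z \<oplus>\<^bsub>?S\<^esub> w \<in> ?E" by (simp add: p.a_closed N.a_closed)
  next
    fix a z assume a: "a \<in> carrier R" and "z \<in> ?E"
    then obtain x r where z: "z = (x, r)" "x \<in> p" "r \<in> carrier R" "x \<ominus> r \<otimes> x\<^sub>0 \<in> N" by auto
    have eq: "a \<otimes> x \<ominus> a \<otimes> r \<otimes> x\<^sub>0 = a \<otimes> (x \<ominus> r \<otimes> x\<^sub>0)"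
      using z a x\<^sub>0c by (simp add: p.Icarr r_distr minus_eq r_minus m_assoc)
    show "a \<odot>\<^bsub>?S\<^esub> z \<in> ?E"
      using z a by (simp add: eq p.I_l_closed N.I_l_closed)
  next
    fix z assume "z \<in> ?E"
    then obtain x r where z: "z = (x, r)" "x \<in> p" "r \<in> carrier R" "x \<ominus> r \<otimes> x\<^sub>0 \<in> N" by auto
    have "\<ominus>\<^bsub>?S\<^esub> z = (\<ominus> x, \<ominus> r)"
      using z by (intro S.minus_equality) (auto simp: p.Icarr l_neg)
    moreover have "\<ominus> x \<ominus> \<ominus> r \<otimes> x\<^sub>0 = \<ominus> (x \<ominus> r \<otimes> x\<^sub>0)"
      using z x\<^sub>0c by (simp add: p.Icarr minus_eq minus_add l_minus)
    ultimately show "\<ominus>\<^bsub>?S\<^esub> z \<in> ?E"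
      using z by (simp add: p.a_inv_closed N.a_inv_closed)
  qed
  then have E: "module R ?EM"
    by (rule submodule.submodule_is_module[OF _ S.module_axioms])
  have "short_exact R ?B ?\<beta> ?EM fst ?A"
    unfolding short_exact_def
  proof (intro conjI A B E)
    \<comment> \<open>The kernel of the first projection consists of the r with r x0 in N, that is,
      r in p.\<close>
    have mem: "(\<zero>, r) \<in> ?E \<longleftrightarrow> r \<in> p" if "r \<in> carrier R" for r
    proof -
      have "\<zero> \<ominus> r \<otimes> x\<^sub>0 \<in> N \<longleftrightarrow> r \<otimes> x\<^sub>0 \<in> N"
        using N.a_inv_closed[of "r \<otimes> x\<^sub>0"] N.a_inv_closed[of "\<ominus> (r \<otimes> x\<^sub>0)"] x\<^sub>0c that
        by (auto simp: minus_eq)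
      then show ?thesis using that p.zero_closed by (simp add: ann)
    qed
    show "?\<beta> \<in> mod_hom R ?B ?EM"
    proof (rule mod_homI)
      fix y assume "y \<in> carrier ?B"
      then show "?\<beta> y \<in> carrier ?EM" using mem p.Icarr by (auto simp: PiE_iff)
    qed simp_all
    show "fst \<in> mod_hom R ?EM ?A" by (rule mod_homI) auto
    show "inj_on ?\<beta> (carrier ?B)"
    proof (rule inj_onI)
      fix x y assume "x \<in> carrier ?B" "y \<in> carrier ?B" "?\<beta> x = ?\<beta> y"
      then show "x = y" by (intro PiE_ext[of x "{k}" "\<lambda>_. p" y]) auto
    qed
    show "?\<beta> ` carrier ?B = a_kernel ?EM ?A fst"
    proof (intro equalityI subsetI)
      fix z assume "z \<in> ?\<beta> ` carrier ?B"
      then obtain r where r: "z = (\<zero>, r)" "r \<in> p" by (auto simp: PiE_iff)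
      then have "z \<in> ?E" using mem p.Icarr by blast
      then show "z \<in> a_kernel ?EM ?A fst" by (simp add: a_kernel_iff r(1))
    next
      fix z assume "z \<in> a_kernel ?EM ?A fst"
      then obtain r where r: "z = (\<zero>, r)" "r \<in> carrier R" "(\<zero>, r) \<in> ?E" by (auto simp: a_kernel_iff)
      then have "r \<in> p" using mem by blast
      then show "z \<in> ?\<beta> ` carrier ?B"
        using r(1) by (intro image_eqI[of _ _ "\<lambda>i\<in>{k}. r"]) auto
    qed
    show "fst ` carrier ?EM = carrier ?A" using gen by force
  qed
  moreover obtain c :: "'u \<times> 'u \<Rightarrow> 'u" where c: "inj c" using infinite_pair_inj[OF u] .
  have "inj_on (\<lambda>z. c (j (fst z), j (snd z))) (carrier ?EM)"
    by (rule inj_onI) (auto dest!: injD[OF c] intro: inj_onD[OF j] simp: p.Icarr)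
  ultimately obtain s where s: "s \<in> mod_hom R ?A ?EM" "\<And>x. x \<in> p \<Longrightarrow> fst (s x) = x"
    using Ext_vanishes_splits[OF ext pd] by fastforce
  define q where "q x = snd (s x)" for x
  have sE: "s x \<in> ?E" if "x \<in> p" for x
    using mod_hom_closed[OF s(1)] that by auto
  have q: "q x \<in> carrier R" "x \<ominus> q x \<otimes> x\<^sub>0 \<in> N" if "x \<in> p" for x
    using sE[OF that] s(2)[OF that] by (auto simp: q_def)
  have q_smult: "q (a \<otimes> x) = a \<otimes> q x" if "a \<in> carrier R" "x \<in> p" for a x
    using mod_hom_smult[OF s(1), of a x] that by (simp add: q_def)
  obtain v where v: "v \<in> p" "v \<noteq> \<zero>" using p_nonzero p.zero_closed by blast
  note vc = p.Icarr[OF v(1)]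
  \<comment> \<open>Linearity turns \<open>q\<close> into multiplication by the fraction
    \<open>q v / v\<close> with one fixed nonzero \<open>v\<close>.\<close>
  have qv: "q v \<otimes> x = v \<otimes> q x" if "x \<in> p" for x
    using q_smult[of x v] q_smult[of v x] v(1) that q(1)[OF v(1)] by (simp add: p.Icarr m_comm)
  have "q x\<^sub>0 \<in> p"
  proof -
    have "q v \<otimes> x \<in> PIdl v" if "x \<in> p" for x
      unfolding mem_PIdl_iff qv[OF that] using m_comm[OF vc q(1)[OF that]] q(1)[OF that] by blast
    from p_fractions_stable[OF q(1)[OF v(1)] vc v(2) this x\<^sub>0(1)]
    obtain y where "y \<in> p" "v \<otimes> q x\<^sub>0 = v \<otimes> y" using qv[OF x\<^sub>0(1)] by auto
    then show ?thesis
      using v(2) vc q(1)[OF x\<^sub>0(1)] by (simp add: m_lcancel p.Icarr)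
  qed
  \<comment> \<open>Membership of \<open>(x\<^sub>0, q x\<^sub>0)\<close> in the extension puts the
    difference of \<open>x\<^sub>0\<close> and this product into N, hence \<open>x\<^sub>0\<close>
    too, a contradiction.\<close>
  then have "q x\<^sub>0 \<otimes> x\<^sub>0 \<in> N" using ann q(1)[OF x\<^sub>0(1)] by blast
  then have "(x\<^sub>0 \<ominus> q x\<^sub>0 \<otimes> x\<^sub>0) \<oplus> q x\<^sub>0 \<otimes> x\<^sub>0 \<in> N"
    using q(2)[OF x\<^sub>0(1)] by (rule N.a_closed[rotated])
  moreover have "(x\<^sub>0 \<ominus> q x\<^sub>0 \<otimes> x\<^sub>0) \<oplus> q x\<^sub>0 \<otimes> x\<^sub>0 = x\<^sub>0"
    using q(1)[OF x\<^sub>0(1)] x\<^sub>0c by (simp add: minus_eq a_assoc l_neg)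
  ultimately show False using x\<^sub>0(2) by simp
qed

end

lemma pure_tilting_hereditary_imp_divides_principal:
  fixes R :: "('a, 'm) ring_scheme" (structure)
  assumes R: "domain R" and u: "infinite (UNIV :: 'u set)" and j: "inj_on (j :: 'a \<Rightarrow> 'u) (carrier R)"
    and pth: "pure_tilting_hereditary TYPE('u) R"
    and I: "ideal I R" "I \<noteq> {\<zero>}"
  shows "divides_principal R I"
proof (rule ccontr)
  assume nI: "\<not> divides_principal R I"
  interpret domain R by fact
  have "\<exists>A\<subseteq>carrier R. finite A \<and> J = Idl A" if J: "ideal J R" for J
  proof (cases "J = {\<zero>}")
    case True
    then show ?thesis using genideal_zero by (intro exI[of _ "{\<zero>}"]) auto
  next
    case False
    then show ?thesis
      using pure_projective_ideal_fg[OF R u j J] pth J by (auto simp: pure_tilting_hereditary_def)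
  qed
  then interpret noetherian_domain R
    by (intro noetherian_domain.intro noetherian_ringI domain_axioms)
  let ?F = "{J. ideal J R \<and> J \<noteq> {\<zero>} \<and> \<not> divides_principal R J}"
  obtain p where p: "p \<in> ?F" "\<And>J. J \<in> ?F \<Longrightarrow> p \<subseteq> J \<Longrightarrow> J = p"
    using maximal_ideal_in_family[of ?F] I nI by blast
  interpret maximal_noninvertible R p
  proof (intro maximal_noninvertible.intro maximal_noninvertible_axioms.intro noetherian_domain_axioms)
    show "J = p" if "ideal J R" "p \<subseteq> J" "\<not> divides_principal R J" for J
      using that p additive_subgroup.zero_closed[OF ideal.axioms(1)] by blast
  qed (use p(1) in auto)
  obtain n where "n_tilting TYPE('u) R n (ideal_module R p)"
    using pth p(1) by (auto simp: pure_tilting_hereditary_def tilting_def)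
  \<comment> \<open>The index \<open>undefined\<close> selects a sum of one copy of p; any element
    of 'u would do.\<close>
  then show False
    using not_rigid[OF u j, of n undefined] unfolding n_tilting_def by blast
qed

section \<open>Invertibility inside the field of fractions\<close>

context "domain"
begin

abbreviation (input) \<open>fr \<equiv> fraction R\<close>
abbreviation (input) \<open>Frac \<equiv> fraction_field R\<close>

lemma equiv_frac_rel: "equiv (nonzero_denom_pairs R) (frac_rel R)"
proof (rule equivI)
  show "frac_rel R \<subseteq> nonzero_denom_pairs R \<times> nonzero_denom_pairs R"
    by (auto simp: frac_rel_def)
  show "refl_on (nonzero_denom_pairs R) (frac_rel R)"
    by (auto simp: refl_on_def frac_rel_def)
  show "sym (frac_rel R)" by (auto simp: sym_def frac_rel_def)
  show "trans (frac_rel R)"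
  proof (rule transI)
    fix x y z assume "(x, y) \<in> frac_rel R" "(y, z) \<in> frac_rel R"
    then obtain a b c d e f where xyz: "x = (a, b)" "y = (c, d)" "z = (e, f)"
      and carr: "a \<in> carrier R" "b \<in> carrier R" "c \<in> carrier R" "d \<in> carrier R" "e \<in> carrier R" "f \<in> carrier R"
      and nz: "b \<noteq> \<zero>" "d \<noteq> \<zero>" "f \<noteq> \<zero>"
      and eq: "a \<otimes> d = c \<otimes> b" "c \<otimes> f = e \<otimes> d"
      by (auto simp: frac_rel_def nonzero_denom_pairs_def)
    \<comment> \<open>Multiply through by the middle denominator and cancel it, which is possible in
      a domain.\<close>
    have "d \<otimes> (a \<otimes> f) = (a \<otimes> d) \<otimes> f" using carr by (simp add: m_ac)
    also have "\<dots> = (c \<otimes> f) \<otimes> b" unfolding eq(1) using carr by (simp add: m_ac)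
    also have "\<dots> = d \<otimes> (e \<otimes> b)" unfolding eq(2) using carr by (simp add: m_ac)
    finally have "a \<otimes> f = e \<otimes> b" using carr nz by (simp add: m_lcancel)
    then show "(x, z) \<in> frac_rel R"
      using carr nz by (auto simp: xyz frac_rel_def nonzero_denom_pairs_def)
  qed
qed

lemma fraction_eq_iff:
  assumes "a \<in> carrier R" "b \<in> carrier R" "b \<noteq> \<zero>" "c \<in> carrier R" "d \<in> carrier R" "d \<noteq> \<zero>"
  shows "fr a b = fr c d \<longleftrightarrow> a \<otimes> d = c \<otimes> b"
  unfolding fraction_def
  using assms by (subst eq_equiv_class_iff[OF equiv_frac_rel]) (auto simp: nonzero_denom_pairs_def frac_rel_def)

lemma fraction_closed: "a \<in> carrier R \<Longrightarrow> b \<in> carrier R \<Longrightarrow> b \<noteq> \<zero> \<Longrightarrow> fr a b \<in> carrier Frac"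
  by (auto simp: fraction_field_def fraction_def nonzero_denom_pairs_def intro!: quotientI)

lemma fraction_cases:
  assumes "x \<in> carrier Frac"
  obtains a b where "a \<in> carrier R" "b \<in> carrier R" "b \<noteq> \<zero>" "x = fr a b"
  using assms by (auto simp: fraction_field_def nonzero_denom_pairs_def fraction_def elim!: quotientE)

lemma mem_fractionD:
  assumes "(c, d) \<in> fr a b"
  shows "a \<in> carrier R" "b \<in> carrier R" "b \<noteq> \<zero>" "c \<in> carrier R" "d \<in> carrier R" "d \<noteq> \<zero>" "a \<otimes> d = c \<otimes> b"
  using assms by (auto simp: fraction_def frac_rel_def nonzero_denom_pairs_def)

lemma mem_fraction_self: "a \<in> carrier R \<Longrightarrow> b \<in> carrier R \<Longrightarrow> b \<noteq> \<zero> \<Longrightarrow> (a, b) \<in> fr a b"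
  by (auto simp: fraction_def frac_rel_def nonzero_denom_pairs_def)

text \<open>The product is defined as a union over all representatives. All members of the union are
  the same class and there is at least one, so the union collapses.\<close>

lemma fraction_mult:
  assumes "a \<in> carrier R" "b \<in> carrier R" "b \<noteq> \<zero>" "c \<in> carrier R" "d \<in> carrier R" "d \<noteq> \<zero>"
  shows "fr a b \<otimes>\<^bsub>Frac\<^esub> fr c d = fr (a \<otimes> c) (b \<otimes> d)"
proof -
  have eq: "fr (a' \<otimes> c') (b' \<otimes> d') = fr (a \<otimes> c) (b \<otimes> d)"
    if "(a', b') \<in> fr a b" "(c', d') \<in> fr c d" for a' b' c' d'
  proof -
    note ab = mem_fractionD[OF that(1)] and cd = mem_fractionD[OF that(2)]
    have "(a \<otimes> c) \<otimes> (b' \<otimes> d') = (a \<otimes> b') \<otimes> (c \<otimes> d')" using ab(1-6) cd(1-6) by (simp add: m_ac)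
    also have "\<dots> = (a' \<otimes> c') \<otimes> (b \<otimes> d)" unfolding ab(7) cd(7) using ab(1-6) cd(1-6) by (simp add: m_ac)
    finally show ?thesis using ab(1-6) cd(1-6) by (subst fraction_eq_iff) (auto simp: integral_iff)
  qed
  have "fr a b \<otimes>\<^bsub>Frac\<^esub> fr c d = (\<Union>(a', b')\<in>fr a b. \<Union>(c', d')\<in>fr c d. fr (a' \<otimes> c') (b' \<otimes> d'))"
    by (simp add: fraction_field_def)
  also have "\<dots> = (\<Union>(a', b')\<in>fr a b. \<Union>(c', d')\<in>fr c d. fr (a \<otimes> c) (b \<otimes> d))"
    using eq by (intro SUP_cong refl) (auto intro!: SUP_cong)
  also have "\<dots> = fr (a \<otimes> c) (b \<otimes> d)"
    using mem_fraction_self[of a b] mem_fraction_self[of c d] assms by auto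
  finally show ?thesis .
qed

lemma fraction_add:
  assumes "a \<in> carrier R" "b \<in> carrier R" "b \<noteq> \<zero>" "c \<in> carrier R" "d \<in> carrier R" "d \<noteq> \<zero>"
  shows "fr a b \<oplus>\<^bsub>Frac\<^esub> fr c d = fr (a \<otimes> d \<oplus> c \<otimes> b) (b \<otimes> d)"
proof -
  have eq: "fr (a' \<otimes> d' \<oplus> c' \<otimes> b') (b' \<otimes> d') = fr (a \<otimes> d \<oplus> c \<otimes> b) (b \<otimes> d)"
    if "(a', b') \<in> fr a b" "(c', d') \<in> fr c d" for a' b' c' d'
  proof -
    note ab = mem_fractionD[OF that(1)] and cd = mem_fractionD[OF that(2)]
    have "(a \<otimes> d \<oplus> c \<otimes> b) \<otimes> (b' \<otimes> d') = (a \<otimes> b') \<otimes> (d \<otimes> d') \<oplus> (c \<otimes> d') \<otimes> (b \<otimes> b')"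
      using ab(1-6) cd(1-6) by (simp add: m_ac l_distr r_distr)
    also have "\<dots> = (a' \<otimes> d' \<oplus> c' \<otimes> b') \<otimes> (b \<otimes> d)"
      unfolding ab(7) cd(7) using ab(1-6) cd(1-6) by (simp add: m_ac l_distr r_distr)
    finally show ?thesis using ab(1-6) cd(1-6) by (subst fraction_eq_iff) (auto simp: integral_iff)
  qed
  have "fr a b \<oplus>\<^bsub>Frac\<^esub> fr c d = (\<Union>(a', b')\<in>fr a b. \<Union>(c', d')\<in>fr c d. fr (a' \<otimes> d' \<oplus> c' \<otimes> b') (b' \<otimes> d'))"
    by (simp add: fraction_field_def)
  also have "\<dots> = (\<Union>(a', b')\<in>fr a b. \<Union>(c', d')\<in>fr c d. fr (a \<otimes> d \<oplus> c \<otimes> b) (b \<otimes> d))"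
    using eq by (intro SUP_cong refl) (auto intro!: SUP_cong)
  also have "\<dots> = fr (a \<otimes> d \<oplus> c \<otimes> b) (b \<otimes> d)"
    using mem_fraction_self[of a b] mem_fraction_self[of c d] assms by auto
  finally show ?thesis .
qed

lemma fraction_add_same:
  assumes "a \<in> carrier R" "c \<in> carrier R" "d \<in> carrier R" "d \<noteq> \<zero>"
  shows "fr a d \<oplus>\<^bsub>Frac\<^esub> fr c d = fr (a \<oplus> c) d"
  using assms by (subst fraction_add) (auto simp: fraction_eq_iff integral_iff l_distr m_assoc)

lemma fraction_field_zero: "d \<in> carrier R \<Longrightarrow> d \<noteq> \<zero> \<Longrightarrow> \<zero>\<^bsub>Frac\<^esub> = fr \<zero> d"
  by (simp add: fraction_field_def fraction_eq_iff)

lemma abelian_group_fraction_field: "abelian_group Frac"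
proof (rule abelian_groupI)
  show "\<zero>\<^bsub>Frac\<^esub> \<in> carrier Frac" by (simp add: fraction_field_zero[of \<one>] fraction_closed)
  fix x y z assume "x \<in> carrier Frac" "y \<in> carrier Frac" "z \<in> carrier Frac"
  then obtain a b c d e f where xyz: "x = fr a b" "y = fr c d" "z = fr e f"
    and carr: "a \<in> carrier R" "b \<in> carrier R" "c \<in> carrier R" "d \<in> carrier R" "e \<in> carrier R" "f \<in> carrier R"
    and nz: "b \<noteq> \<zero>" "d \<noteq> \<zero>" "f \<noteq> \<zero>"
    by (metis fraction_cases)
  show "x \<oplus>\<^bsub>Frac\<^esub> y \<in> carrier Frac"
    using carr nz by (simp add: xyz fraction_add fraction_closed integral_iff)
  show "x \<oplus>\<^bsub>Frac\<^esub> y = y \<oplus>\<^bsub>Frac\<^esub> x"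
    using carr nz by (simp add: xyz fraction_add m_comm a_comm)
  show "x \<oplus>\<^bsub>Frac\<^esub> y \<oplus>\<^bsub>Frac\<^esub> z = x \<oplus>\<^bsub>Frac\<^esub> (y \<oplus>\<^bsub>Frac\<^esub> z)"
    using carr nz by (simp add: xyz fraction_add integral_iff l_distr r_distr m_ac a_ac)
next
  fix x assume "x \<in> carrier Frac"
  then obtain a b where ab: "a \<in> carrier R" "b \<in> carrier R" "b \<noteq> \<zero>" "x = fr a b"
    by (rule fraction_cases)
  then show "\<zero>\<^bsub>Frac\<^esub> \<oplus>\<^bsub>Frac\<^esub> x = x"
    by (simp add: fraction_field_zero[of b] fraction_add_same)
  show "\<exists>y\<in>carrier Frac. y \<oplus>\<^bsub>Frac\<^esub> x = \<zero>\<^bsub>Frac\<^esub>"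
    using ab by (intro bexI[of _ "fr (\<ominus> a) b"])
      (simp_all add: fraction_field_zero[of b] fraction_add_same fraction_closed l_neg)
qed

text \<open>Moves ideal products between R and its field of fractions, with \<open>d\<close> as
  common denominator.\<close>

lemma ideal_prod_fraction_field:
  assumes I: "ideal I R" and J: "ideal J R" and d: "d \<in> carrier R" "d \<noteq> \<zero>"
  shows "frac_embed R ` I \<cdot>\<^bsub>Frac\<^esub> ((\<lambda>y. fr y d) ` J) = (\<lambda>t. fr t d) ` (I \<cdot> J)"
proof -
  interpret I: ideal_elements R I by (rule ideal_elementsI, rule I)
  interpret J: ideal_elements R J by (rule ideal_elementsI, rule J)
  have emb_mult: "frac_embed R x \<otimes>\<^bsub>Frac\<^esub> fr y d = fr (x \<otimes> y) d" if "x \<in> I" "y \<in> J" for x y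
    using that d by (simp add: frac_embed_def fraction_mult I.Icarr J.Icarr)
  have carr: "t \<in> carrier R" if "t \<in> I \<cdot> J" for t
    using that ideal_prod_in_carrier[OF I J] by blast
  show ?thesis
  proof (intro equalityI subsetI)
    fix z assume "z \<in> frac_embed R ` I \<cdot>\<^bsub>Frac\<^esub> ((\<lambda>y. fr y d) ` J)"
    then show "z \<in> (\<lambda>t. fr t d) ` (I \<cdot> J)"
    proof (induction z rule: ideal_prod.induct)
      case (prod i j)
      then show ?case using emb_mult by (auto intro!: imageI ideal_prod.prod)
    next
      case (sum s1 s2)
      then obtain t1 t2 where "t1 \<in> I \<cdot> J" "t2 \<in> I \<cdot> J" "s1 = fr t1 d" "s2 = fr t2 d" by auto
      then show ?case
        using d carr by (auto simp: fraction_add_same intro!: imageI ideal_prod.sum)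
    qed
  next
    fix z assume "z \<in> (\<lambda>t. fr t d) ` (I \<cdot> J)"
    then obtain t where t: "t \<in> I \<cdot> J" "z = fr t d" by blast
    from t(1) show "z \<in> frac_embed R ` I \<cdot>\<^bsub>Frac\<^esub> ((\<lambda>y. fr y d) ` J)"
      unfolding t(2)
    proof (induction t rule: ideal_prod.induct)
      case (prod i j)
      then show ?case by (subst emb_mult[symmetric]) (auto intro: ideal_prod.prod)
    next
      case (sum s1 s2)
      then show ?case
        using d carr by (auto simp: fraction_add_same[symmetric] intro: ideal_prod.sum)
    qed
  qed
qed

lemma invertible_ideal_iff:
  assumes I: "ideal I R"
  shows "invertible_ideal R I \<longleftrightarrow> divides_principal R I"
proof
  assume "divides_principal R I"
  then obtain J d where J: "ideal J R" and d: "d \<in> carrier R" "d \<noteq> \<zero>" and IJ: "I \<cdot> J = PIdl d"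
    by (auto simp: divides_principal_def)
  interpret J: ideal_elements R J by (rule ideal_elementsI, rule J)
  interpret K: abelian_group Frac by (rule abelian_group_fraction_field)
  let ?J = "(\<lambda>y. fr y d) ` J"
  have "fractional_ideal R ?J"
    unfolding fractional_ideal_def
  proof (intro conjI ballI)
    have "subgroup ?J (add_monoid Frac)"
    proof (rule subgroup.intro)
      fix x y assume "x \<in> ?J" "y \<in> ?J"
      then show "x \<otimes>\<^bsub>add_monoid Frac\<^esub> y \<in> ?J"
        using d by (auto simp: fraction_add_same J.Icarr intro!: imageI J.a_closed)
    next
      fix x assume "x \<in> ?J"
      then obtain y where y: "y \<in> J" "x = fr y d" by blast
      have "\<ominus>\<^bsub>Frac\<^esub> x = fr (\<ominus> y) d"
        using y d by (intro K.minus_equality)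
          (simp_all add: fraction_add_same J.Icarr l_neg fraction_field_zero[of d] fraction_closed)
      then have "\<ominus>\<^bsub>Frac\<^esub> x \<in> ?J"
        using y(1) J.a_inv_closed by blast
      then show "inv\<^bsub>add_monoid Frac\<^esub> x \<in> ?J" by (simp only: a_inv_def)
    next
      show "\<one>\<^bsub>add_monoid Frac\<^esub> \<in> ?J"
        using d J.zero_closed by (auto simp: fraction_field_zero[of d])
    qed (use d in \<open>auto simp: fraction_closed J.Icarr\<close>)
    then show "additive_subgroup ?J Frac" by (rule additive_subgroup.intro)
    show "frac_embed R a \<otimes>\<^bsub>Frac\<^esub> x \<in> ?J" if "a \<in> carrier R" "x \<in> ?J" for a x
      using that d by (auto simp: frac_embed_def fraction_mult J.Icarr intro!: imageI J.I_l_closed)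
    show "\<exists>s\<in>carrier R - {\<zero>}. \<forall>x\<in>?J. frac_embed R s \<otimes>\<^bsub>Frac\<^esub> x \<in> frac_embed R ` carrier R"
    proof (intro bexI[of _ d] ballI)
      fix x assume "x \<in> ?J"
      then obtain y where y: "y \<in> J" "x = fr y d" by blast
      then have "frac_embed R d \<otimes>\<^bsub>Frac\<^esub> x = frac_embed R y"
        using d by (simp add: frac_embed_def fraction_mult fraction_eq_iff J.Icarr m_comm)
      then show "frac_embed R d \<otimes>\<^bsub>Frac\<^esub> x \<in> frac_embed R ` carrier R" using y J.Icarr by auto
    qed (use d in auto)
  qed
  moreover have "(\<lambda>t. fr t d) ` (PIdl d) = frac_embed R ` carrier R"
  proof -
    have "fr (r \<otimes> d) d = frac_embed R r" if "r \<in> carrier R" for r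
      using that d by (simp add: frac_embed_def fraction_eq_iff)
    then show ?thesis by (force simp: cgenideal_def)
  qed
  ultimately show "invertible_ideal R I"
    unfolding invertible_ideal_def using ideal_prod_fraction_field[OF I J d] IJ by auto
next
  assume "invertible_ideal R I"
  then obtain J where JF: "fractional_ideal R J"
    and IJ: "frac_embed R ` I \<cdot>\<^bsub>Frac\<^esub> J = frac_embed R ` carrier R"
    by (auto simp: invertible_ideal_def)
  from JF have J: "additive_subgroup J Frac" "\<And>a x. a \<in> carrier R \<Longrightarrow> x \<in> J \<Longrightarrow> frac_embed R a \<otimes>\<^bsub>Frac\<^esub> x \<in> J"
    by (simp_all add: fractional_ideal_def)
  from JF obtain s where s: "s \<in> carrier R" "s \<noteq> \<zero>"
    "\<And>x. x \<in> J \<Longrightarrow> frac_embed R s \<otimes>\<^bsub>Frac\<^esub> x \<in> frac_embed R ` carrier R"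
    unfolding fractional_ideal_def by blast
  interpret J: additive_subgroup J Frac by (rule J(1))
  \<comment> \<open>This is s J, an ideal of R because \<open>s\<close> is a common denominator of
    \<open>J\<close>.\<close>
  define J' where "J' = {y \<in> carrier R. fr y s \<in> J}"
  have J': "ideal J' R"
  proof (rule idealI_cring)
    show "\<zero> \<in> J'" using J.zero_closed s by (simp add: J'_def fraction_field_zero[of s])
    show "x \<oplus> y \<in> J'" if "x \<in> J'" "y \<in> J'" for x y
      using that s J.a_closed[of "fr x s" "fr y s"] by (simp add: J'_def fraction_add_same)
    show "a \<otimes> x \<in> J'" if "a \<in> carrier R" "x \<in> J'" for a x
      using that s J(2)[of a "fr x s"] by (simp add: J'_def frac_embed_def fraction_mult)
  qed (auto simp: J'_def)
  have JJ': "J = (\<lambda>y. fr y s) ` J'"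
  proof (intro equalityI subsetI)
    fix x assume x: "x \<in> J"
    then have "x \<in> carrier Frac" using J.a_subset by blast
    then obtain a b where ab: "a \<in> carrier R" "b \<in> carrier R" "b \<noteq> \<zero>" "x = fr a b"
      by (rule fraction_cases)
    obtain y where y: "y \<in> carrier R" "frac_embed R s \<otimes>\<^bsub>Frac\<^esub> x = frac_embed R y" using s(3)[OF x] by auto
    then have "s \<otimes> a = y \<otimes> b"
      using ab s by (simp add: frac_embed_def fraction_mult fraction_eq_iff)
    then have "x = fr y s" using ab y s by (simp add: fraction_eq_iff m_comm)
    then show "x \<in> (\<lambda>y. fr y s) ` J'" using x y by (auto simp: J'_def)
  qed (auto simp: J'_def)
  have eq: "(\<lambda>t. fr t s) ` (I \<cdot> J') = frac_embed R ` carrier R"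
    using ideal_prod_fraction_field[OF I J' s(1,2)] IJ JJ' by simp
  have frac_iff: "fr t s = frac_embed R r \<longleftrightarrow> t = r \<otimes> s" if "t \<in> carrier R" "r \<in> carrier R" for t r
    using that s by (simp add: frac_embed_def fraction_eq_iff)
  have carr: "t \<in> carrier R" if "t \<in> I \<cdot> J'" for t
    using that ideal_prod_in_carrier[OF I J'] by blast
  have "I \<cdot> J' = PIdl s"
  proof (intro equalityI subsetI)
    fix t assume t: "t \<in> I \<cdot> J'"
    then have "fr t s \<in> frac_embed R ` carrier R" unfolding eq[symmetric] by (rule imageI)
    then show "t \<in> PIdl s" using frac_iff[OF carr[OF t]] by (auto simp: mem_PIdl_iff)
  next
    fix t assume "t \<in> PIdl s"
    then obtain r where r: "r \<in> carrier R" "t = r \<otimes> s" by (auto simp: mem_PIdl_iff)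
    then have "frac_embed R r \<in> (\<lambda>t. fr t s) ` (I \<cdot> J')" unfolding eq by blast
    then obtain t' where "t' \<in> I \<cdot> J'" "fr t' s = frac_embed R r" by auto
    then show "t \<in> I \<cdot> J'" using frac_iff[OF carr r(1)] r(2) by auto
  qed
  then show "divides_principal R I"
    using J' s by (auto simp: divides_principal_def)
qed

end

section \<open>Invertible ideals are 0-tilting\<close>

text \<open>Splitting the augmentation makes the identity of the resolution null-homotopic in
  positive degrees. The hypothesis speaks of surjections onto \<open>A\<close> itself because
  \<open>projective_module\<close> only tests targets over 'u, while \<open>A\<close> may have
  another type.\<close>

lemma projective_Ext_vanishes:
  fixes A :: "('a, 'b, 'p) module_scheme"
  assumes A: "\<And>(B :: ('a, 'u) module) g. module R B \<Longrightarrow> g \<in> mod_hom R B A \<Longrightarrow> g ` carrier B = carrier A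
      \<Longrightarrow> lifts_along R A B g A"
    and B: "module R B"
  shows "Ext_vanishes TYPE('u) R (Suc i) A B"
  unfolding Ext_vanishes_def
proof (intro allI impI)
  fix P :: "nat \<Rightarrow> ('a, 'u) module" and d e
  assume res: "projective_resolution TYPE('u) R P d e A"
  note P = projective_resolutionD[OF res] and dd = projective_resolution_dd[OF res]
  obtain t where t: "t \<in> mod_hom R A (P 0)" "\<And>x. x \<in> carrier A \<Longrightarrow> e (t x) = x"
    using bspec[OF A[OF P(2) P(5,6), unfolded lifts_along_def] mod_hom_id] by blast
  \<comment> \<open>Projectivity of \<open>P i\<close> against \<open>d i\<close> with its target
    cut down to the image, which is a submodule since exactness makes it a kernel.\<close>
  have lift: "\<exists>s\<in>mod_hom R (P i) (P (Suc i)). \<forall>x\<in>carrier (P i). d i (s x) = f x"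
    if f: "f \<in> mod_hom R (P i) (P i)" "\<And>x. x \<in> carrier (P i) \<Longrightarrow> f x \<in> d i ` carrier (P (Suc i))" for f i
  proof -
    let ?C = "P i\<lparr>carrier := d i ` carrier (P (Suc i))\<rparr>"
    have "submodule (d i ` carrier (P (Suc i))) R (P i)"
      by (cases i) (simp_all add: P(7,8) submodule_a_kernel[OF P(2) P(1) P(5)] submodule_a_kernel[OF P(2,2,4)])
    then have C: "module R ?C" by (rule submodule.submodule_is_module[OF _ P(2)])
    have "f \<in> mod_hom R (P i) ?C" "d i \<in> mod_hom R (P (Suc i)) ?C"
      using f P(4)[of i] by (auto simp: mod_hom_def)
    then show ?thesis
      using P(3)[of i] P(2)[of "Suc i"] C unfolding projective_module_def lifts_along_def by force
  qed
  \<comment> \<open>Two neighbouring components of the homotopy are carried along, since each is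
    built from the one before. In degree 0 the splitting \<open>t\<close> of the augmentation takes
    the place of the missing component.\<close>
  have htpy: "\<exists>s s'. s \<in> mod_hom R (P i) (P (Suc i)) \<and> s' \<in> mod_hom R (P (Suc i)) (P (Suc (Suc i))) \<and>
      (\<forall>x\<in>carrier (P (Suc i)). d (Suc i) (s' x) = x \<ominus>\<^bsub>P (Suc i)\<^esub> s (d i x))" for i
  proof (induction i)
    case 0
    interpret P0: module R "P 0" by (rule P)
    interpret P1: module R "P (Suc 0)" by (rule P)
    interpret A: module R A by (rule P)
    let ?f = "\<lambda>x. x \<ominus>\<^bsub>P 0\<^esub> t (e x)"
    have f: "?f \<in> mod_hom R (P 0) (P 0)"
      by (rule mod_hom_diff[OF P(2,2) mod_hom_id mod_hom_compose[OF P(5) t(1)]])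
    have te: "t (e x) \<in> carrier (P 0)" if "x \<in> carrier (P 0)" for x
      using mod_hom_closed[OF t(1) mod_hom_closed[OF P(5) that]] .
    have "?f x \<in> d 0 ` carrier (P (Suc 0))" if "x \<in> carrier (P 0)" for x
      using that te[OF that] mod_hom_closed[OF P(5) that]
      by (simp add: P(7) a_kernel_iff mod_hom_minus[OF P(2) P(1) P(5)] t(2) A.minus_eq A.r_neg)
    from lift[OF f this] obtain s where s: "s \<in> mod_hom R (P 0) (P (Suc 0))"
      "\<And>x. x \<in> carrier (P 0) \<Longrightarrow> d 0 (s x) = ?f x" by blast
    let ?g = "\<lambda>x. x \<ominus>\<^bsub>P (Suc 0)\<^esub> s (d 0 x)"
    have g: "?g \<in> mod_hom R (P (Suc 0)) (P (Suc 0))"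
      by (rule mod_hom_diff[OF P(2,2) mod_hom_id mod_hom_compose[OF P(4) s(1)]])
    have "?g x \<in> d (Suc 0) ` carrier (P (Suc (Suc 0)))" if x: "x \<in> carrier (P (Suc 0))" for x
    proof -
      have dx: "d 0 x \<in> carrier (P 0)" by (rule mod_hom_closed[OF P(4) x])
      have "d 0 (s (d 0 x)) = d 0 x"
        using dd(1)[OF x] dx mod_hom_zero[OF P(1,2) t(1)] by (simp add: s(2) P0.minus_eq)
      then show ?thesis
        using x dx mod_hom_closed[OF s(1) dx]
        by (simp add: P(8) a_kernel_iff mod_hom_minus[OF P(2,2,4)] P0.minus_eq P0.r_neg)
    qed
    from lift[OF g this] s(1) show ?case by blast
  next
    case (Suc i)
    then obtain s s' where s: "s \<in> mod_hom R (P i) (P (Suc i))" "s' \<in> mod_hom R (P (Suc i)) (P (Suc (Suc i)))"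
      "\<And>x. x \<in> carrier (P (Suc i)) \<Longrightarrow> d (Suc i) (s' x) = x \<ominus>\<^bsub>P (Suc i)\<^esub> s (d i x)" by blast
    interpret Pi: module R "P (Suc i)" by (rule P)
    let ?g = "\<lambda>x. x \<ominus>\<^bsub>P (Suc (Suc i))\<^esub> s' (d (Suc i) x)"
    have g: "?g \<in> mod_hom R (P (Suc (Suc i))) (P (Suc (Suc i)))"
      by (rule mod_hom_diff[OF P(2,2) mod_hom_id mod_hom_compose[OF P(4) s(2)]])
    interpret Pii: module R "P (Suc (Suc i))" by (rule P)
    have "?g x \<in> d (Suc (Suc i)) ` carrier (P (Suc (Suc (Suc i))))" if x: "x \<in> carrier (P (Suc (Suc i)))" for x
    proof -
      have dx: "d (Suc i) x \<in> carrier (P (Suc i))" by (rule mod_hom_closed[OF P(4) x])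
      have "d (Suc i) (s' (d (Suc i) x)) = d (Suc i) x"
        using dd(2)[OF x] dx mod_hom_zero[OF P(2,2) s(1)] by (simp add: s(3) Pi.minus_eq)
      then show ?thesis
        using x dx mod_hom_closed[OF s(2) dx]
        by (simp add: P(8) a_kernel_iff mod_hom_minus[OF P(2,2,4)] Pi.minus_eq Pi.r_neg)
    qed
    from lift[OF g this] s(2) show ?case by blast
  qed
  interpret Pi: module R "P (Suc i)" by (rule P)
  interpret B: module R B by (rule B)
  obtain s s' where s: "s \<in> mod_hom R (P i) (P (Suc i))" "s' \<in> mod_hom R (P (Suc i)) (P (Suc (Suc i)))"
    "\<And>x. x \<in> carrier (P (Suc i)) \<Longrightarrow> d (Suc i) (s' x) = x \<ominus>\<^bsub>P (Suc i)\<^esub> s (d i x)"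
    using htpy[of i] by blast
  show "trivial_group (Ext_group R P d B (Suc i))"
  proof (rule iffD2[OF trivial_Ext_iff[where P = P and d = d and i = i, OF B P(2,2,2,4) dd(2)]], assumption,
      intro ballI impI)
    fix f assume f: "f \<in> mod_hom R (P (Suc i)) B"
      and f0: "\<forall>x\<in>carrier (P (Suc (Suc i))). f (d (Suc i) x) = \<zero>\<^bsub>B\<^esub>"
    \<comment> \<open>By the homotopy, x minus s (d x) is a boundary, and a cocycle vanishes on
      boundaries; so \<open>f\<close> is the coboundary of f composed with s.\<close>
    have "f x = f (s (d i x))" if x: "x \<in> carrier (P (Suc i))" for x
    proof -
      have sd: "s (d i x) \<in> carrier (P (Suc i))"
        by (rule mod_hom_closed[OF s(1) mod_hom_closed[OF P(4) x]])
      have "f (x \<ominus>\<^bsub>P (Suc i)\<^esub> s (d i x)) = \<zero>\<^bsub>B\<^esub>"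
        using f0 mod_hom_closed[OF s(2) x] s(3)[OF x] by metis
      then have "f x \<ominus>\<^bsub>B\<^esub> f (s (d i x)) = \<zero>\<^bsub>B\<^esub>"
        using x sd by (simp add: mod_hom_minus[OF P(2) B f])
      then show ?thesis
        using mod_hom_closed[OF f] x sd by (rule_tac B.eq_if_minus_eq_zero) auto
    qed
    then show "\<exists>g\<in>mod_hom R (P i) B. \<forall>x\<in>carrier (P (Suc i)). f x = g (d i x)"
      by (intro bexI[OF _ mod_hom_compose[OF s(1) f]]) auto
  qed
qed

text \<open>The image of \<open>i\<close> has the kernel of \<open>p\<close> as complement: x is i
  (p x) plus an element killed by \<open>p\<close>.\<close>

lemma retract_direct_summand:
  assumes M: "module R M" and D: "module R D" and i: "i \<in> mod_hom R M D" and p: "p \<in> mod_hom R D M"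
    and pi: "\<And>x. x \<in> carrier M \<Longrightarrow> p (i x) = x"
  shows "direct_summand R M D"
proof -
  interpret M: module R M by (rule M)
  interpret D: module R D by (rule D)
  have iD: "\<And>x. x \<in> carrier M \<Longrightarrow> i x \<in> carrier D" and pM: "\<And>x. x \<in> carrier D \<Longrightarrow> p x \<in> carrier M"
    using mod_hom_closed[OF i] mod_hom_closed[OF p] by auto
  let ?N = "i ` carrier M" and ?N' = "a_kernel D M p"
  have "submodule ?N R D"
  proof (rule D.submoduleI)
    show "\<zero>\<^bsub>D\<^esub> \<in> ?N" using mod_hom_zero[OF M D i] M.zero_closed by (metis imageI)
    show "\<ominus>\<^bsub>D\<^esub> x \<in> ?N" if "x \<in> ?N" for x
    proof -
      from that obtain y where y: "y \<in> carrier M" "x = i y" by blast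
      have "i (\<ominus>\<^bsub>M\<^esub> y) = \<ominus>\<^bsub>D\<^esub> x"
        using mod_hom_minus[OF M D i, of "\<zero>\<^bsub>M\<^esub>" y] y iD[of y]
        by (simp add: M.minus_eq D.minus_eq mod_hom_zero[OF M D i])
      then show ?thesis using y by (metis M.a_inv_closed imageI)
    qed
    show "x \<oplus>\<^bsub>D\<^esub> y \<in> ?N" if "x \<in> ?N" "y \<in> ?N" for x y
      using that by (auto simp flip: mod_hom_add[OF i])
    show "a \<odot>\<^bsub>D\<^esub> x \<in> ?N" if "a \<in> carrier R" "x \<in> ?N" for a x
      using that by (auto simp flip: mod_hom_smult[OF i])
  qed (use iD in auto)
  moreover have "submodule ?N' R D" by (rule submodule_a_kernel[OF D M p])
  moreover have "?N \<inter> ?N' = {\<zero>\<^bsub>D\<^esub>}"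
  proof
    show "?N \<inter> ?N' \<subseteq> {\<zero>\<^bsub>D\<^esub>}"
      using pi mod_hom_zero[OF M D i] by (auto simp: a_kernel_iff)
    show "{\<zero>\<^bsub>D\<^esub>} \<subseteq> ?N \<inter> ?N'"
      using mod_hom_zero[OF M D i] mod_hom_zero[OF D M p] M.zero_closed
      by (auto simp: a_kernel_iff intro!: image_eqI[of _ i "\<zero>\<^bsub>M\<^esub>"])
  qed
  moreover have "?N <+>\<^bsub>D\<^esub> ?N' = carrier D"
  proof (intro equalityI subsetI)
    fix x assume "x \<in> ?N <+>\<^bsub>D\<^esub> ?N'"
    then show "x \<in> carrier D" using iD by (auto simp: set_add_def' a_kernel_iff)
  next
    fix x assume x: "x \<in> carrier D"
    let ?y = "i (p x)"
    have y: "?y \<in> carrier D" using iD pM x by simp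
    have "p (x \<ominus>\<^bsub>D\<^esub> ?y) = \<zero>\<^bsub>M\<^esub>"
      using x y pM pi by (simp add: mod_hom_minus[OF D M p] M.minus_eq M.r_neg)
    then have "x \<ominus>\<^bsub>D\<^esub> ?y \<in> ?N'" using x y by (simp add: a_kernel_iff)
    moreover have "x = ?y \<oplus>\<^bsub>D\<^esub> (x \<ominus>\<^bsub>D\<^esub> ?y)"
      using x y by (simp add: D.minus_eq D.a_lcomm D.r_neg)
    ultimately show "x \<in> ?N <+>\<^bsub>D\<^esub> ?N'"
      using pM[OF x] unfolding set_add_def' by blast
  qed
  moreover have "mod_iso R M (D\<lparr>carrier := ?N\<rparr>)"
    unfolding mod_iso_def
  proof (rule bexI)
    show "bij_betw i (carrier M) (carrier (D\<lparr>carrier := ?N\<rparr>))"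
      using inj_on_inverseI[of "carrier M" p i] pi by (auto simp: bij_betw_def)
    show "i \<in> mod_hom R M (D\<lparr>carrier := ?N\<rparr>)"
      using i by (auto simp: mod_hom_def)
  qed
  ultimately show ?thesis unfolding direct_summand_def by blast
qed

section \<open>Elements of ideal products as finite sums\<close>

context cring
begin

lemma finsum_regular:
  assumes "finite K" "f \<in> K \<rightarrow> carrier R"
  shows "finsum (regular_module R) f K = finsum R f K"
proof -
  interpret M: module R "regular_module R" by (rule module_regular[OF cring_axioms])
  show ?thesis
    using assms by (induction K rule: finite_induct) (auto simp: Pi_iff)
qed

text \<open>The indices are taken from 'u, as required of the direct sums in Add; infinitude of 'u
  always leaves a fresh index for one more product.\<close>

lemma ideal_prod_finsum:
  assumes u: "infinite (UNIV :: 'u set)" and I: "ideal I R" and J: "ideal J R" and t: "t \<in> I \<cdot> J"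
  obtains K :: "'u set" and x y where "finite K" "x \<in> K \<rightarrow> I" "y \<in> K \<rightarrow> J" "t = (\<Oplus>k\<in>K. x k \<otimes> y k)"
proof -
  interpret I: ideal_elements R I by (rule ideal_elementsI, rule I)
  interpret J: ideal_elements R J by (rule ideal_elementsI, rule J)
  define S where "S = {t. \<exists>(K :: 'u set) x y. finite K \<and> x \<in> K \<rightarrow> I \<and> y \<in> K \<rightarrow> J \<and> t = (\<Oplus>k\<in>K. x k \<otimes> y k)}"
  have SR: "S \<subseteq> carrier R"
    by (auto simp: S_def Pi_iff I.Icarr J.Icarr intro!: finsum_closed)
  \<comment> \<open>Adding \<open>t\<close> to an arbitrary \<open>s\<close> lets the sum case
    proceed by two successive additions, without making two index sets disjoint.\<close>
  have "s \<oplus> t \<in> S" if "s \<in> S" "t \<in> I \<cdot> J" for s t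
    using that(2,1)
  proof (induction t arbitrary: s rule: ideal_prod.induct)
    case (prod i j)
    from prod(3) obtain K :: "'u set" and x y where K: "finite K" "x \<in> K \<rightarrow> I" "y \<in> K \<rightarrow> J" "s = (\<Oplus>k\<in>K. x k \<otimes> y k)"
      unfolding S_def by blast
    obtain k where k: "k \<notin> K" using ex_new_if_finite[OF u K(1)] by blast
    have xy: "x l \<in> carrier R" "y l \<in> carrier R" if "l \<in> K" for l
      using that K(2,3) by (auto simp: Pi_iff I.Icarr J.Icarr)
    have cK: "(\<Oplus>l\<in>K. (x(k := i)) l \<otimes> (y(k := j)) l) = s"
      unfolding K(4) using k xy by (intro finsum_cong') auto
    have "(\<Oplus>l\<in>insert k K. (x(k := i)) l \<otimes> (y(k := j)) l) = i \<otimes> j \<oplus> s"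
      using K(1) k xy prod(1,2) by (subst finsum_insert) (auto simp: cK[simplified] I.Icarr J.Icarr)
    then have "s \<oplus> i \<otimes> j = (\<Oplus>l\<in>insert k K. (x(k := i)) l \<otimes> (y(k := j)) l)"
      using prod SR by (simp add: a_comm subset_iff I.Icarr J.Icarr)
    moreover have "x(k := i) \<in> insert k K \<rightarrow> I" "y(k := j) \<in> insert k K \<rightarrow> J" using K(2,3) prod(1,2) by auto
    ultimately show ?case unfolding S_def using K(1) by blast
  next
    case (sum s1 s2)
    then have "s1 \<in> carrier R" "s2 \<in> carrier R" "s \<in> carrier R"
      using ideal_prod_in_carrier[OF I J] SR by auto
    moreover have "(s \<oplus> s1) \<oplus> s2 \<in> S" by (intro sum.IH sum.prems)
    ultimately show ?case by (simp add: a_assoc)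
  qed
  moreover have "\<zero> \<in> S"
    unfolding S_def by (intro CollectI exI[of _ "{}"]) auto
  ultimately have "\<zero> \<oplus> t \<in> S" using t by blast
  then have "t \<in> S" using t ideal_prod_in_carrier[OF I J] by (auto simp: subset_iff)
  then show ?thesis using that unfolding S_def by blast
qed

end

lemma (in module) submodule_zero: "submodule {\<zero>\<^bsub>M\<^esub>} R M"
  by (rule submoduleI) (auto intro: M.minus_equality)

text \<open>The functional on \<open>I\<close> given by multiplication with \<open>y/d\<close>.\<close>

definition frac_functional :: "('a, 'm) ring_scheme \<Rightarrow> 'a \<Rightarrow> 'a \<Rightarrow> 'a \<Rightarrow> 'a"
  where "frac_functional R d y z = (SOME w. w \<in> carrier R \<and> y \<otimes>\<^bsub>R\<^esub> z = w \<otimes>\<^bsub>R\<^esub> d)"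

section \<open>Lifting and splitting through the dual basis of an invertible ideal\<close>

locale invertible_pair = domain R for R :: "('a, 'm) ring_scheme" (structure) +
  fixes I J d
  assumes I: "ideal I R" and J: "ideal J R" and d: "d \<in> carrier R" "d \<noteq> \<zero>" and IJ: "I \<cdot> J = PIdl d"
begin

sublocale I: ideal_elements R I by (rule ideal_elementsI, rule I)
sublocale J: ideal_elements R J by (rule ideal_elementsI, rule J)

abbreviation T where "T \<equiv> ideal_module R I"

lemma module_T: "module R T" by (rule module_ideal[OF cring_axioms I])

lemma d_mem: "d \<in> I \<cdot> J"
  unfolding IJ by (rule cgenideal_self[OF d(1)])

lemma frac_functional:
  assumes "y \<in> J" "z \<in> I"
  shows "frac_functional R d y z \<in> carrier R" "y \<otimes> z = frac_functional R d y z \<otimes> d"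
proof -
  have "z \<otimes> y \<in> PIdl d" using assms unfolding IJ[symmetric] by (auto intro: ideal_prod.prod)
  then have "\<exists>w. w \<in> carrier R \<and> y \<otimes> z = w \<otimes> d"
    using assms by (auto simp: mem_PIdl_iff m_comm I.Icarr J.Icarr)
  from someI_ex[OF this] show "frac_functional R d y z \<in> carrier R" "y \<otimes> z = frac_functional R d y z \<otimes> d"
    by (simp_all add: frac_functional_def)
qed

lemma d_cancel: "a \<in> carrier R \<Longrightarrow> b \<in> carrier R \<Longrightarrow> a \<otimes> d = b \<otimes> d \<Longrightarrow> a = b"
  using d m_rcancel by blast

lemma frac_functional_hom:
  assumes y: "y \<in> J"
  shows "frac_functional R d y \<in> mod_hom R T (regular_module R)"
proof (rule mod_homI)
  note F = frac_functional[OF y]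
  fix z assume z: "z \<in> carrier T"
  then show "frac_functional R d y z \<in> carrier (regular_module R)" using F(1) by simp
  fix z' assume z': "z' \<in> carrier T"
  have "frac_functional R d y (z \<oplus> z') = frac_functional R d y z \<oplus> frac_functional R d y z'"
    using z z' y d F[of z] F[of z'] F[of "z \<oplus> z'"]
    by (rule_tac d_cancel) (simp_all add: I.a_closed l_distr r_distr I.Icarr J.Icarr flip: F(2))
  then show "frac_functional R d y (z \<oplus>\<^bsub>T\<^esub> z')
      = frac_functional R d y z \<oplus>\<^bsub>regular_module R\<^esub> frac_functional R d y z'" by simp
next
  note F = frac_functional[OF y]
  fix a z assume a: "a \<in> carrier R" and z: "z \<in> carrier T"
  have "frac_functional R d y (a \<otimes> z) \<otimes> d = y \<otimes> (a \<otimes> z)"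
    using a z by (simp add: F(2) I.I_l_closed)
  also have "\<dots> = a \<otimes> (y \<otimes> z)" using a y z by (simp add: m_lcomm I.Icarr J.Icarr)
  also have "\<dots> = (a \<otimes> frac_functional R d y z) \<otimes> d"
    using a z F(1)[of z] d by (simp add: F(2) m_assoc)
  finally have "frac_functional R d y (a \<otimes> z) = a \<otimes> frac_functional R d y z"
    using a z F(1)[of z] F(1)[of "a \<otimes> z"] by (rule_tac d_cancel) (auto simp: I.I_l_closed)
  then show "frac_functional R d y (a \<odot>\<^bsub>T\<^esub> z) = a \<odot>\<^bsub>regular_module R\<^esub> frac_functional R d y z" by simp
qed

text \<open>Induction on \<open>t \<in> IJ\<close> yields a lift of \<open>(t/d)f\<close>; at \<open>t = d\<close> this is a lift of \<open>f\<close>.\<close>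

lemma lifts:
  fixes B :: "('a, 'b, 'p) module_scheme" and C :: "('a, 'c, 'q) module_scheme"
  assumes B: "module R B" and C: "module R C" and g: "g \<in> mod_hom R B C" "g ` carrier B = carrier C"
  shows "lifts_along R T B g C"
  unfolding lifts_along_def
proof
  fix f assume f: "f \<in> mod_hom R T C"
  interpret B: module R B by (rule B)
  interpret C: module R C by (rule C)
  have "\<exists>h\<in>mod_hom R T B. \<forall>z\<in>I. \<exists>w\<in>I. t \<otimes> z = w \<otimes> d \<and> g (h z) = f w" if "t \<in> I \<cdot> J" for t
    using that
  proof (induction t rule: ideal_prod.induct)
    case (prod i j)
    have "f i \<in> g ` carrier B" using mod_hom_closed[OF f, of i] prod(1) by (simp add: g(2))
    then obtain b where b: "b \<in> carrier B" "g b = f i" by auto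
    \<comment> \<open>For t = i j the lift sends z to (j z / d) b, where b is a preimage of f(i);
      the element w of the claim is t z / d.\<close>
    have h: "(\<lambda>r. r \<odot>\<^bsub>B\<^esub> b) \<in> mod_hom R (regular_module R) B"
      using b by (intro mod_homI) (auto simp: B.smult_l_distr B.smult_assoc1)
    show ?case
    proof (intro bexI[OF _ mod_hom_compose[OF frac_functional_hom[OF prod(2)] h]] ballI)
      fix z assume z: "z \<in> I"
      note F = frac_functional[OF prod(2) z]
      have "i \<otimes> j \<otimes> z = i \<otimes> (j \<otimes> z)" using prod z by (simp add: m_assoc I.Icarr J.Icarr)
      also have "\<dots> = (frac_functional R d j z \<otimes> i) \<otimes> d"
        unfolding F(2) using prod F(1) d by (simp add: m_ac I.Icarr)
      finally have "i \<otimes> j \<otimes> z = (frac_functional R d j z \<otimes> i) \<otimes> d" .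
      moreover have "g (frac_functional R d j z \<odot>\<^bsub>B\<^esub> b) = f (frac_functional R d j z \<otimes> i)"
        using mod_hom_smult[OF g(1) F(1) b(1)] mod_hom_smult[OF f F(1), of i] prod(1) b(2) by simp
      moreover have "frac_functional R d j z \<otimes> i \<in> I" using F(1) prod(1) by (rule I.I_l_closed[rotated])
      ultimately show "\<exists>w\<in>I. i \<otimes> j \<otimes> z = w \<otimes> d \<and> g (frac_functional R d j z \<odot>\<^bsub>B\<^esub> b) = f w" by blast
    qed
  next
    case (sum s1 s2)
    then obtain h1 h2 where h1: "h1 \<in> mod_hom R T B" "\<forall>z\<in>I. \<exists>w\<in>I. s1 \<otimes> z = w \<otimes> d \<and> g (h1 z) = f w"
      and h2: "h2 \<in> mod_hom R T B" "\<forall>z\<in>I. \<exists>w\<in>I. s2 \<otimes> z = w \<otimes> d \<and> g (h2 z) = f w" by blast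
    have s: "s1 \<in> carrier R" "s2 \<in> carrier R"
      using sum.hyps ideal_prod_in_carrier[OF I J] by auto
    show ?case
    proof (intro bexI[OF _ mod_hom_plus[OF module_T B h1(1) h2(1)]] ballI)
      fix z assume z: "z \<in> I"
      obtain w1 w2 where w: "w1 \<in> I" "s1 \<otimes> z = w1 \<otimes> d" "g (h1 z) = f w1"
        "w2 \<in> I" "s2 \<otimes> z = w2 \<otimes> d" "g (h2 z) = f w2" using h1(2) h2(2) z by blast
      have "(s1 \<oplus> s2) \<otimes> z = (w1 \<oplus> w2) \<otimes> d" using s w z d by (simp add: l_distr I.Icarr)
      moreover have "g (h1 z \<oplus>\<^bsub>B\<^esub> h2 z) = f (w1 \<oplus> w2)"
        using mod_hom_add[OF g(1)] mod_hom_closed[OF h1(1), of z] mod_hom_closed[OF h2(1), of z] z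
          mod_hom_add[OF f, of w1 w2] w by simp
      ultimately show "\<exists>w\<in>I. (s1 \<oplus> s2) \<otimes> z = w \<otimes> d \<and> g (h1 z \<oplus>\<^bsub>B\<^esub> h2 z) = f w"
        using I.a_closed[OF w(1,4)] by blast
    qed
  qed
  from this[OF d_mem] obtain h where h: "h \<in> mod_hom R T B" "\<forall>z\<in>I. \<exists>w\<in>I. d \<otimes> z = w \<otimes> d \<and> g (h z) = f w"
    by blast
  have "g (h z) = f z" if z: "z \<in> I" for z
  proof -
    obtain w where w: "w \<in> I" "d \<otimes> z = w \<otimes> d" "g (h z) = f w" using h(2) z by blast
    have "z \<otimes> d = w \<otimes> d" using w(2) z d by (simp add: m_comm I.Icarr)
    then have "z = w" using z w(1) by (rule_tac d_cancel) (auto simp: I.Icarr)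
    then show ?thesis using w(3) by simp
  qed
  then show "\<exists>h\<in>mod_hom R T B. \<forall>x\<in>carrier T. g (h x) = f x" using h(1) by (intro bexI[of _ h]) auto
qed

text \<open>Write d as a finite sum of products x_k y_k. The maps r -> (r x_k) and (z_k) -> sum of
  y_k z_k / d compose to the identity of R.\<close>

lemma regular_retract:
  assumes u: "infinite (UNIV :: 'u set)"
  obtains K :: "'u set" and i \<pi> where "i \<in> mod_hom R (regular_module R) (direct_sum K (\<lambda>_. T))"
    "\<pi> \<in> mod_hom R (direct_sum K (\<lambda>_. T)) (regular_module R)" "\<And>r. r \<in> carrier R \<Longrightarrow> \<pi> (i r) = r"
proof -
  obtain K :: "'u set" and x y where K: "finite K" and x: "x \<in> K \<rightarrow> I" and y: "y \<in> K \<rightarrow> J"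
    and d_eq: "d = (\<Oplus>k\<in>K. x k \<otimes> y k)"
    using ideal_prod_finsum[OF u I J d_mem] .
  note N = module_regular[OF cring_axioms]
  have xy: "x k \<in> carrier R" "y k \<in> carrier R" "x k \<in> I" "y k \<in> J" if "k \<in> K" for k
    using x y that by (auto simp: Pi_iff I.Icarr J.Icarr)
  let ?\<pi> = "direct_sum_copair (\<lambda>_. T) (regular_module R) K (\<lambda>k. frac_functional R d (y k))"
  let ?i = "\<lambda>r. \<lambda>k\<in>K. r \<otimes> x k"
  have i: "?i \<in> mod_hom R (regular_module R) (direct_sum K (\<lambda>_. T))"
    using K xy by (intro mod_homI) (auto simp: I.I_l_closed l_distr m_assoc fun_eq_iff)
  have hom: "frac_functional R d (y k) \<in> mod_hom R T (regular_module R)" if "k \<in> K" for k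
    using frac_functional_hom xy(4)[OF that] .
  note copair = direct_sum_copair_hom[where K = K and M = "\<lambda>_. T", OF module_T N hom]
    direct_sum_copair_eq[where K = K and M = "\<lambda>_. T", OF module_T N hom]
  have "?\<pi> (?i r) = r" if r: "r \<in> carrier R" for r
  proof (rule d_cancel)
    have ir: "?i r \<in> carrier (direct_sum K (\<lambda>_. T))" using mod_hom_closed[OF i] r by simp
    have rx: "r \<otimes> x k \<in> I" if "k \<in> K" for k using r xy(3)[OF that] by (rule I.I_l_closed[rotated])
    have F: "frac_functional R d (y k) (r \<otimes> x k) \<in> carrier R" if "k \<in> K" for k
      using frac_functional(1)[OF xy(4)[OF that] rx[OF that]] .
    have "?\<pi> (?i r) = (\<Oplus>k\<in>K. frac_functional R d (y k) (?i r k))"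
      using copair(2)[OF _ ir K order_refl] F K by (subst finsum_regular[symmetric]) auto
    also have "\<dots> = (\<Oplus>k\<in>K. frac_functional R d (y k) (r \<otimes> x k))"
      using F by (intro finsum_cong') auto
    finally have "?\<pi> (?i r) \<otimes> d = (\<Oplus>k\<in>K. frac_functional R d (y k) (r \<otimes> x k) \<otimes> d)"
      using F d K by (simp add: finsum_ldistr Pi_iff)
    also have "\<dots> = (\<Oplus>k\<in>K. r \<otimes> (x k \<otimes> y k))"
    proof (rule finsum_cong')
      fix k assume k: "k \<in> K"
      show "frac_functional R d (y k) (r \<otimes> x k) \<otimes> d = r \<otimes> (x k \<otimes> y k)"
        unfolding frac_functional(2)[OF xy(4)[OF k] rx[OF k], symmetric] using xy[OF k] r by (simp add: m_ac)
    qed (use xy r in auto)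
    also have "\<dots> = r \<otimes> d"
      unfolding d_eq using r K xy by (simp add: finsum_rdistr Pi_iff)
    finally show "?\<pi> (?i r) \<otimes> d = r \<otimes> d" .
    show "?\<pi> (?i r) \<in> carrier R"
      using mod_hom_closed[OF copair(1) ir] by simp
  qed (rule r)
  with i copair(1) show ?thesis by (intro that[of ?i K ?\<pi>]) auto
qed

lemma pure_projective: "pure_projective TYPE('u) R T"
  unfolding pure_projective_def
proof (intro conjI module_T allI impI)
  fix A B C :: "('a, 'u) module" and f g
  assume "pure_exact TYPE('u) R A f B g C"
  then show "lifts_along R T B g C"
    by (intro lifts) (auto simp: pure_exact_def short_exact_def)
qed

lemma zero_tilting:
  fixes j :: "'a \<Rightarrow> 'u"
  assumes u: "infinite (UNIV :: 'u set)" and j: "inj_on j (carrier R)"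
  shows "n_tilting TYPE('u) R 0 T"
  unfolding n_tilting_def
proof (intro conjI)
  have jI: "inj_on j (carrier T)" using j by (rule inj_on_subset) (auto simp: I.Icarr)
  have jR: "inj_on j (carrier (regular_module R))" using j by simp
  note N = module_regular[OF cring_axioms]
  let ?Q = "transport_module j T" and ?S = "transport_module j (regular_module R)"
  \<comment> \<open>The zero module is cut out of \<open>?Q\<close>, so the two share their zero and
    one constant map serves as every differential.\<close>
  let ?Z = "?Q\<lparr>carrier := {\<zero>\<^bsub>?Q\<^esub>}\<rparr>"
  have Q: "module R ?Q" by (rule module_transport[OF module_T jI])
  have S: "module R ?S" by (rule module_transport[OF N jR])
  interpret Q: module R ?Q by (rule Q)
  interpret S: module R ?S by (rule S)
  have Z: "module R ?Z" by (rule submodule.submodule_is_module[OF Q.submodule_zero Q])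
  show "module R T" by (rule module_T)
  show "\<forall>i\<ge>1. \<forall>K :: 'u set. Ext_vanishes TYPE('u) R i T (direct_sum K (\<lambda>_. T))"
  proof (intro allI impI)
    fix i :: nat and K :: "'u set" assume "1 \<le> i"
    then obtain i' where "i = Suc i'" by (cases i) auto
    then show "Ext_vanishes TYPE('u) R i T (direct_sum K (\<lambda>_. T))"
      using projective_Ext_vanishes[OF lifts[OF _ module_T] module_direct_sum[OF cring_axioms module_T]] by simp
  qed
  show "pd_le TYPE('u) R T 0"
  proof -
    let ?P = "\<lambda>i :: nat. if i = 0 then ?Q else ?Z"
    let ?d = "\<lambda>(i :: nat) (_ :: 'u). \<zero>\<^bsub>?Q\<^esub>"
    let ?e = "inv_into I j"
    have "projective_module TYPE('u) R ?Q"
      unfolding projective_module_def lifts_along_def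
    proof (intro conjI Q allI impI ballI)
      fix B C :: "('a, 'u) module" and g f
      assume B: "module R B \<and> module R C \<and> g \<in> mod_hom R B C \<and> g ` carrier B = carrier C"
        and f: "f \<in> mod_hom R ?Q C"
      obtain h where h: "h \<in> mod_hom R T B" "\<And>x. x \<in> I \<Longrightarrow> g (h x) = f (j x)"
        using bspec[OF lifts[of B C g, unfolded lifts_along_def] mod_hom_compose[OF transport_hom[OF jI] f]] B by auto
      have "g (h (?e x)) = f x" if "x \<in> carrier ?Q" for x
        using that h(2) jI by (auto simp: inv_into_f_f)
      moreover have "(\<lambda>x. h (?e x)) \<in> mod_hom R ?Q B"
        using mod_hom_compose[OF transport_inv_hom[OF module_T jI] h(1)] by simp
      ultimately show "\<exists>h\<in>mod_hom R ?Q B. \<forall>x\<in>carrier ?Q. g (h x) = f x" by (rule_tac bexI) auto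
    qed
    moreover have "projective_module TYPE('u) R ?Z"
      unfolding projective_module_def lifts_along_def
    proof (intro conjI Z allI impI ballI)
      fix B C :: "('a, 'u) module" and g f
      assume B: "module R B \<and> module R C \<and> g \<in> mod_hom R B C \<and> g ` carrier B = carrier C"
        and f: "f \<in> mod_hom R ?Z C"
      have "f \<zero>\<^bsub>?Q\<^esub> = \<zero>\<^bsub>C\<^esub>" "g \<zero>\<^bsub>B\<^esub> = \<zero>\<^bsub>C\<^esub>"
        using mod_hom_zero[OF Z _ f] mod_hom_zero[of R B C g] B by auto
      then show "\<exists>h\<in>mod_hom R ?Z B. \<forall>x\<in>carrier ?Z. g (h x) = f x"
        using B by (intro bexI[OF _ mod_hom_const_zero[of R B]]) auto
    qed
    moreover have e: "?e \<in> mod_hom R ?Q T" using transport_inv_hom[OF module_T jI] by simp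
    moreover have "?e ` carrier ?Q = carrier T" using jI by (auto simp: image_image)
    moreover have d: "?d i \<in> mod_hom R (?P (Suc i)) (?P i)" for i
      using mod_hom_const_zero[OF Q] mod_hom_const_zero[OF Z] by auto
    moreover have "?d 0 ` carrier (?P (Suc 0)) = a_kernel (?P 0) T ?e"
      using jI by (auto simp: a_kernel_iff I.zero_closed set_eq_iff)
    ultimately have "projective_resolution TYPE('u) R ?P ?d ?e T"
      unfolding projective_resolution_def using module_T by (auto simp: a_kernel_iff set_eq_iff)
    then show ?thesis unfolding pd_le_def by (rule_tac exI[of _ ?P], rule_tac exI, rule_tac exI) auto
  qed
  show "\<exists>r Ts d e. Add_coresolution TYPE('u) R T r Ts d e"
  proof -
    \<comment> \<open>The coresolution has r = 0: its only nonzero term is a copy of R itself, which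
      lies in Add(I) as a retract of a finite power of I.\<close>
    let ?Ts = "\<lambda>i :: nat. if i = 0 then ?S else ?Z"
    let ?d = "\<lambda>(i :: nat) (_ :: 'u). \<zero>\<^bsub>?Q\<^esub>"
    obtain K :: "'u set" and i \<pi> where i: "i \<in> mod_hom R (regular_module R) (direct_sum K (\<lambda>_. T))"
      and \<pi>: "\<pi> \<in> mod_hom R (direct_sum K (\<lambda>_. T)) (regular_module R)"
      and \<pi>i: "\<And>r. r \<in> carrier R \<Longrightarrow> \<pi> (i r) = r"
      by (rule regular_retract[OF u]) (rule that)
    have D: "module R (direct_sum K (\<lambda>_. T))" by (rule module_direct_sum[OF cring_axioms module_T])
    have "direct_summand R ?S (direct_sum K (\<lambda>_. T))"
      by (rule retract_direct_summand[OF S D mod_hom_compose[OF transport_inv_hom[OF N jR] i]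
            mod_hom_compose[OF \<pi> transport_hom[OF jR]]]) (use j \<pi>i in auto)
    moreover have "direct_summand R ?Z (direct_sum K (\<lambda>_. T))"
      by (rule retract_direct_summand[OF Z D mod_hom_const_zero[OF D] mod_hom_const_zero[OF Z]]) auto
    ultimately have add: "in_Add TYPE('u) R T (?Ts i)" for i
      using S Z unfolding in_Add_def by auto
    have "?d i \<in> mod_hom R (?Ts i) (?Ts (Suc i))" for i
      using mod_hom_const_zero[OF Z] by auto
    then have "Add_coresolution TYPE('u) R T 0 ?Ts ?d j"
      unfolding Add_coresolution_def using add transport_hom[OF jR] j by (auto simp: a_kernel_iff set_eq_iff)
    then show ?thesis by blast
  qed
qed

end

section \<open>The equivalence, closed as the cycle (1), (3), (2), (1)\<close>

lemma dedekind_imp_pure_0_tilting_hereditary: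
  fixes R :: "('a, 'm) ring_scheme" (structure)
  assumes D: "dedekind_domain R" and u: "infinite (UNIV :: 'u set)" and j: "inj_on (j :: 'a \<Rightarrow> 'u) (carrier R)"
  shows "pure_0_tilting_hereditary TYPE('u) R"
  unfolding pure_0_tilting_hereditary_def
proof (intro allI impI)
  fix I assume I: "ideal I R \<and> I \<noteq> {\<zero>}"
  interpret domain R using D by (simp add: dedekind_domain_def)
  have "divides_principal R I"
    using D I invertible_ideal_iff by (auto simp: dedekind_domain_def)
  then obtain J d where "ideal J R" "d \<in> carrier R" "d \<noteq> \<zero>" "I \<cdot> J = PIdl d"
    by (auto simp: divides_principal_def)
  with I interpret invertible_pair R I J d
    by (intro invertible_pair.intro invertible_pair_axioms.intro domain_axioms) auto
  show "pure_projective TYPE('u) R (ideal_module R I) \<and> n_tilting TYPE('u) R 0 (ideal_module R I)"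
    using pure_projective zero_tilting[OF u j] by blast
qed

theorem corollary4p9:
  fixes R :: "('a, 'm) ring_scheme"
  assumes R_domain: "domain R"
    and universe_infinite: "infinite (UNIV :: 'u set)"
    and universe_large: "\<exists>j :: 'a \<Rightarrow> 'u. inj_on j (carrier R)"
  shows "(dedekind_domain R \<longleftrightarrow> pure_tilting_hereditary TYPE('u) R) \<and>
         (pure_tilting_hereditary TYPE('u) R \<longleftrightarrow> pure_0_tilting_hereditary TYPE('u) R)"
proof -
  obtain j :: "'a \<Rightarrow> 'u" where j: "inj_on j (carrier R)" using universe_large by blast
  have "pure_0_tilting_hereditary TYPE('u) R" if "dedekind_domain R"
    using dedekind_imp_pure_0_tilting_hereditary[OF that universe_infinite j] .
  moreover have "pure_tilting_hereditary TYPE('u) R" if "pure_0_tilting_hereditary TYPE('u) R"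
    using that by (auto simp: pure_0_tilting_hereditary_def pure_tilting_hereditary_def tilting_def)
  moreover have "dedekind_domain R" if "pure_tilting_hereditary TYPE('u) R"
    using pure_tilting_hereditary_imp_divides_principal[OF R_domain universe_infinite j that]
      domain.invertible_ideal_iff[OF R_domain] R_domain
    by (auto simp: dedekind_domain_def)
  ultimately show ?thesis by blast
qed

end
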